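(* For every $(G,e)\in\mathcal{G}'$ (with a fixed ordering of $E(G)\setminus\{e\}$) there exist constants $c_1,c_2,c_3,c_4>0$ such that the following holds: if $n\ge e(G)-1$, $S\subseteq E(Q_n)$ has size $\delta\, e(Q_n)$, and $\delta\ge c_1 n^{-c_2}$, then at least a $c_3\delta^{c_4}$-proportion of all oriented embeddings $\psi: Q_{e(G)-1}\to Q_n$ satisfy $\psi(Y(G,e))\subseteq S$.
   Context: Multigraphs may have loops and parallel edges; $e(G)=|E(G)|$. A series-parallel graph is a multigraph with no $K_4$ minor. $\mathcal{G}'$ is the set of pairs $(G,e)$ with $G$ a connected series-parallel multigraph and $e\in E(G)$ neither a bridge nor a loop. Identifying subsets of $E(G)\setminus\{e\}$ with vertices of $Q_{e(G)-1}$, $Y(G,e)\subseteq E(Q_{e(G)-1})$ is the set of hypercube edges $\{T, T\cup\{e'\}\}$ such that both $T\cup\{e\}$ and $T\cup\{e'\}$ are edge sets of spanning trees of $G$. $e(Q_n) = n2^{n-1}$. An embedding $Q_d\to Q_n$ is a graph isomorphism of $Q_d$ onto a $d$-dimensional face of $Q_n$ (mapping edges to edges); it is oriented if it preserves the coordinatewise partial orders (equivalently, $\psi(x)_{\sigma(j)} = x_j$ for an injection $\sigma:[d]\to[n]$ with the other coordinates fixed to constants). *)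

theory Defs
  imports Complex_Main "HOL-Library.FuncSet"
begin

section \<open>Multigraphs\<close>

text \<open>Each edge has a set of ends, of size 2, or of size 1 for a loop. Values of \<open>ends\<close> outside
  \<open>edges\<close> are irrelevant.\<close>

record ('v, 'e) multigraph =
  verts :: "'v set"
  edges :: "'e set"
  ends :: "'e \<Rightarrow> 'v set"

definition finite_multigraph :: "('v, 'e) multigraph \<Rightarrow> bool" where
  "finite_multigraph G \<longleftrightarrow> finite (verts G) \<and> finite (edges G) \<and>
     (\<forall>e\<in>edges G. ends G e \<subseteq> verts G \<and> card (ends G e) \<in> {1, 2})"

definition is_loop :: "('v, 'e) multigraph \<Rightarrow> 'e \<Rightarrow> bool" where
  "is_loop G e \<longleftrightarrow> e \<in> edges G \<and> card (ends G e) = 1"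

definition adjacency :: "('v, 'e) multigraph \<Rightarrow> ('v \<times> 'v) set" where
  "adjacency G = {(u, v). \<exists>e\<in>edges G. ends G e = {u, v}}"

definition connected_graph :: "('v, 'e) multigraph \<Rightarrow> bool" where
  "connected_graph G \<longleftrightarrow> verts G \<noteq> {} \<and> (\<forall>u\<in>verts G. \<forall>v\<in>verts G. (u, v) \<in> (adjacency G)\<^sup>*)"

definition delete_edge :: "('v, 'e) multigraph \<Rightarrow> 'e \<Rightarrow> ('v, 'e) multigraph" where
  "delete_edge G e = G\<lparr>edges := edges G - {e}\<rparr>"

definition delete_vertex :: "('v, 'e) multigraph \<Rightarrow> 'v \<Rightarrow> ('v, 'e) multigraph" where
  "delete_vertex G v = G\<lparr>verts := verts G - {v}, edges := {e \<in> edges G. v \<notin> ends G e}\<rparr>"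

text \<open>Contraction of an edge \<open>e\<close> with distinct ends \<open>u\<close> and \<open>v\<close>; the merged vertex is called \<open>u\<close>.
  The other edges joining \<open>u\<close> and \<open>v\<close> become loops.\<close>

definition contract_edge :: "('v, 'e) multigraph \<Rightarrow> 'e \<Rightarrow> 'v \<Rightarrow> 'v \<Rightarrow> ('v, 'e) multigraph" where
  "contract_edge G e u v =
     \<lparr>verts = verts G - {v}, edges = edges G - {e},
      ends = (\<lambda>e'. (\<lambda>w. if w = v then u else w) ` ends G e')\<rparr>"

definition is_bridge :: "('v, 'e) multigraph \<Rightarrow> 'e \<Rightarrow> bool" where
  "is_bridge G e \<longleftrightarrow> e \<in> edges G \<and>
     (\<exists>u\<in>verts G. \<exists>v\<in>verts G. (u, v) \<in> (adjacency G)\<^sup>* \<and> (u, v) \<notin> (adjacency (delete_edge G e))\<^sup>*)"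

text \<open>Cycles of length 1 are loops, cycles of length 2 are pairs of parallel edges.\<close>

definition is_cycle :: "('v, 'e) multigraph \<Rightarrow> 'v list \<Rightarrow> 'e list \<Rightarrow> bool" where
  "is_cycle G vs es \<longleftrightarrow>
     vs \<noteq> [] \<and> length vs = length es \<and> distinct vs \<and> distinct es \<and>
     set vs \<subseteq> verts G \<and> set es \<subseteq> edges G \<and>
     (\<forall>i<length es. ends G (es ! i) = {vs ! i, vs ! (Suc i mod length vs)})"

definition is_tree :: "('v, 'e) multigraph \<Rightarrow> bool" where
  "is_tree G \<longleftrightarrow> connected_graph G \<and> (\<nexists>vs es. is_cycle G vs es)"

definition spanning_tree :: "('v, 'e) multigraph \<Rightarrow> 'e set \<Rightarrow> bool" where
  "spanning_tree G T \<longleftrightarrow> T \<subseteq> edges G \<and> is_tree (G\<lparr>edges := T\<rparr>)"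

section \<open>Minors and series-parallel graphs\<close>

text \<open>Contracting a loop is the same as deleting it, so only contractions of non-loops are listed.\<close>

inductive has_minor :: "('v, 'e) multigraph \<Rightarrow> ('v, 'e) multigraph \<Rightarrow> bool" for G where
  refl: "has_minor G G"
| del_edge: "has_minor G H \<Longrightarrow> e \<in> edges H \<Longrightarrow> has_minor G (delete_edge H e)"
| del_vertex: "has_minor G H \<Longrightarrow> v \<in> verts H \<Longrightarrow> has_minor G (delete_vertex H v)"
| contract: "has_minor G H \<Longrightarrow> e \<in> edges H \<Longrightarrow> ends H e = {u, v} \<Longrightarrow> u \<noteq> v \<Longrightarrow>
    has_minor G (contract_edge H e u v)"

definition graph_iso :: "('v, 'e) multigraph \<Rightarrow> ('w, 'f) multigraph \<Rightarrow> bool" where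
  "graph_iso G H \<longleftrightarrow> (\<exists>f g. bij_betw f (verts G) (verts H) \<and> bij_betw g (edges G) (edges H) \<and>
     (\<forall>e\<in>edges G. ends H (g e) = f ` ends G e))"

definition K4 :: "(nat, nat set) multigraph" where
  "K4 = \<lparr>verts = {..<4}, edges = {X. X \<subseteq> {..<4} \<and> card X = 2}, ends = (\<lambda>X. X)\<rparr>"

definition series_parallel :: "('v, 'e) multigraph \<Rightarrow> bool" where
  "series_parallel G \<longleftrightarrow> finite_multigraph G \<and> (\<nexists>H. has_minor G H \<and> graph_iso H K4)"

definition G_prime :: "(('v, 'e) multigraph \<times> 'e) set" where
  "G_prime = {(G, e). series_parallel G \<and> connected_graph G \<and>
                 e \<in> edges G \<and> \<not> is_bridge G e \<and> \<not> is_loop G e}"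

section \<open>Hypercubes\<close>

text \<open>The vertices of the cube on a coordinate set \<open>A\<close> are the subsets of \<open>A\<close>: the subset \<open>X\<close> stands
  for the 0/1-vector whose coordinate \<open>i\<close> is 1 iff \<open>i \<in> X\<close>, so that the coordinatewise order is
  inclusion. The cube \<open>Q\<^sub>n\<close> is the case \<open>A = {..<n}\<close>.\<close>

definition cube_edges :: "'a set \<Rightarrow> 'a set set set" where
  "cube_edges A = {{X, insert i X} | X i. X \<subseteq> A \<and> i \<in> A \<and> i \<notin> X}"

abbreviation Q_verts :: "nat \<Rightarrow> nat set set" where
  "Q_verts n \<equiv> Pow {..<n}"

abbreviation Q_edges :: "nat \<Rightarrow> nat set set set" where
  "Q_edges n \<equiv> cube_edges {..<n}"

text \<open>\<open>D\<close> is the set of free coordinates of the face; \<open>B\<close> is the set of fixed coordinates with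
  value 1.\<close>

definition is_face :: "nat \<Rightarrow> nat \<Rightarrow> nat set set \<Rightarrow> bool" where
  "is_face n d F \<longleftrightarrow> (\<exists>D B. D \<subseteq> {..<n} \<and> card D = d \<and> B \<subseteq> {..<n} - D \<and>
     F = {X \<in> Q_verts n. X - D = B})"

text \<open>Maps are extensional (undefined outside the vertex set of the domain), so that distinct elements
  of the sets below are distinct maps on \<open>Q_verts d\<close>.\<close>

definition embeddings :: "nat \<Rightarrow> nat \<Rightarrow> (nat set \<Rightarrow> nat set) set" where
  "embeddings d n = {\<psi> \<in> Q_verts d \<rightarrow>\<^sub>E Q_verts n.
     \<exists>F. is_face n d F \<and> bij_betw \<psi> (Q_verts d) F \<and>
       (\<forall>X\<in>Q_verts d. \<forall>Y\<in>Q_verts d. {X, Y} \<in> Q_edges d \<longleftrightarrow> {\<psi> X, \<psi> Y} \<in> Q_edges n)}"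

definition oriented_embeddings :: "nat \<Rightarrow> nat \<Rightarrow> (nat set \<Rightarrow> nat set) set" where
  "oriented_embeddings d n = {\<psi> \<in> embeddings d n.
     \<forall>X\<in>Q_verts d. \<forall>Y\<in>Q_verts d. X \<subseteq> Y \<longrightarrow> \<psi> X \<subseteq> \<psi> Y}"

section \<open>The set Y(G,e)\<close>

definition Y_set :: "('v, 'e) multigraph \<Rightarrow> 'e \<Rightarrow> 'e set set set" where
  "Y_set G e = {{T, insert e' T} | T e'. T \<subseteq> edges G - {e} \<and> e' \<in> edges G - {e} \<and> e' \<notin> T \<and>
     spanning_tree G (insert e T) \<and> spanning_tree G (insert e' T)}"

text \<open>Given an ordering \<open>\<sigma>\<close> of \<open>edges G - {e}\<close>, i.e. a bijection from \<open>{..<d}\<close> onto it, with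
  \<open>d = card (edges G) - 1\<close>, the vertex \<open>X\<close> of \<open>Q\<^sub>d\<close> is identified with the edge subset \<open>\<sigma> ` X\<close>.\<close>

definition Y_ordered :: "(nat \<Rightarrow> 'e) \<Rightarrow> ('v, 'e) multigraph \<Rightarrow> 'e \<Rightarrow> nat set set set" where
  "Y_ordered \<sigma> G e = {q \<in> Q_edges (card (edges G) - 1). (\<lambda>X. \<sigma> ` X) ` q \<in> Y_set G e}"

end

theory Submission
  imports Defs
begin

text \<open>\<open>Y(G,e)\<close> is contained in the corresponding set for a two-terminal network that has the edges of
  \<open>G - e\<close> and is built from single edges by series and parallel composition; its elements join the
  spanning 2-forests separating the two terminals to the spanning trees. For a parallel
  composition of \<open>s\<close> and \<open>t\<close>, Cauchy-Schwarz provides many pairs of edges of \<open>S\<close> with a common lower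
  end. Fixing the direction of one of them, the copies of \<open>t\<close> in the other edges are, together with
  the fixed direction, copies of \<open>t\<close> in parallel with an edge; fixing the coordinates used by \<open>t\<close>
  instead, the remaining direction runs through a dense set of edges of a smaller cube, in which
  copies of \<open>s\<close> are found. All losses are polynomial, and complementation exchanges parallel and
  series composition.\<close>

section \<open>Series-parallel decompositions\<close>

text \<open>The terminals are the ends of \<open>e\<close>: adding \<open>e\<close> to a forest that
  separates them gives a spanning tree, so the ends \<open>T\<close> and \<open>insert e' T\<close>
  of an element of \<open>Y_set G e\<close> are a cut and a tree. The edge \<open>e\<close> survives
  every reduction of the graph. If all vertices other than its ends have at least three neighbours,
  the presence of a third vertex forces a \<open>K4\<close> minor; hence some loop, parallel pair,
  pendant edge or series pair can be reduced until only two parallel edges are left. The obstacle in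
  a parallel composition is that arcs in directions of \<open>t\<close> are required above every cut
  of \<open>s\<close>, and conversely. Copies of \<open>s\<close> and \<open>t\<close> found
  independently have no reason to fit together. Therefore \<open>t\<close> is sought among pairs of
  arcs with a common lower end, which attaches one spare direction at all cuts of \<open>t\<close>
  simultaneously, and \<open>s\<close> is then placed along the spare directions. The bound carried
  through the induction is a power of the density minus a term of order 1/n; the threshold on
  \<delta> makes that term at most half of the power.\<close>

datatype (leaves: 'e) sp = Edge 'e | Par "'e sp" "'e sp" | Ser "'e sp" "'e sp"

primrec distinct_leaves :: "'e sp \<Rightarrow> bool" where
  "distinct_leaves (Edge f) = True"
| "distinct_leaves (Par s t) = (distinct_leaves s \<and> distinct_leaves t \<and> leaves s \<inter> leaves t = {})"
| "distinct_leaves (Ser s t) = (distinct_leaves s \<and> distinct_leaves t \<and> leaves s \<inter> leaves t = {})"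

definition join :: "'e set set \<Rightarrow> 'e set set \<Rightarrow> 'e set set" where
  "join X Y = {T \<union> U | T U. T \<in> X \<and> U \<in> Y}"

text \<open>For a network with the leaves as edges, \<open>trees\<close> are the spanning trees and \<open>cuts\<close> the spanning
  forests with two components, one around each terminal.\<close>

fun cuts :: "'e sp \<Rightarrow> 'e set set" and trees :: "'e sp \<Rightarrow> 'e set set" where
  "cuts (Edge f) = {{}}"
| "cuts (Par s t) = join (cuts s) (cuts t)"
| "cuts (Ser s t) = join (cuts s) (trees t) \<union> join (trees s) (cuts t)"
| "trees (Edge f) = {{f}}"
| "trees (Par s t) = join (cuts s) (trees t) \<union> join (trees s) (cuts t)"
| "trees (Ser s t) = join (trees s) (trees t)"

lemma joinI: "T \<in> X \<Longrightarrow> U \<in> Y \<Longrightarrow> T \<union> U \<in> join X Y"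
  by (auto simp: join_def)

lemma joinE:
  assumes "W \<in> join X Y"
  obtains T U where "W = T \<union> U" "T \<in> X" "U \<in> Y"
  using assms by (auto simp: join_def)

lemma finite_leaves [simp]: "finite (leaves t)"
  by (induction t) auto

lemma leaves_nonempty [simp]: "leaves t \<noteq> {}"
  by (induction t) auto

lemma card_leaves_pos: "card (leaves t) \<ge> 1"
  by (simp add: Suc_leI card_gt_0_iff)

lemma cuts_trees_subset: "T \<in> cuts t \<or> T \<in> trees t \<Longrightarrow> T \<subseteq> leaves t"
proof (induction t arbitrary: T)
  case (Par s t)
  then show ?case by (auto elim!: joinE; blast)
next
  case (Ser s t)
  then show ?case by (auto elim!: joinE; blast)
qed auto

lemma cuts_subset: "T \<in> cuts t \<Longrightarrow> T \<subseteq> leaves t"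
  and trees_subset: "T \<in> trees t \<Longrightarrow> T \<subseteq> leaves t"
  using cuts_trees_subset by blast+

lemma disjoint_Un_eqD:
  assumes "T \<union> U = T' \<union> U'" "T \<subseteq> X" "T' \<subseteq> X" "U \<subseteq> Y" "U' \<subseteq> Y" "X \<inter> Y = {}"
  shows "T = T'" "U = U'"
  using assms by blast+

text \<open>A spanning tree has one edge more than a separating 2-forest; the induction follows the
  composition instead of counting edges. The lemma decides on which side of a parallel composition a
  leaf lies when it turns a cut into a tree.\<close>

lemma cuts_trees_disjoint: "distinct_leaves t \<Longrightarrow> T \<in> cuts t \<Longrightarrow> T \<in> trees t \<Longrightarrow> False"
proof (induction t arbitrary: T)
  case (Edge f)
  then show ?case by simp
next
  case (Par s t)
  have dj: "leaves s \<inter> leaves t = {}" using Par.prems by simp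
  from Par.prems obtain T1 T2 where T: "T = T1 \<union> T2" "T1 \<in> cuts s" "T2 \<in> cuts t" by (auto elim: joinE)
  from Par.prems(3) consider U1 U2 where "T = U1 \<union> U2" "U1 \<in> cuts s" "U2 \<in> trees t"
    | U1 U2 where "T = U1 \<union> U2" "U1 \<in> trees s" "U2 \<in> cuts t" by (auto elim: joinE)
  then show ?case
  proof cases
    case 1
    then have "T2 = U2" using disjoint_Un_eqD(2)[OF _ cuts_subset cuts_subset cuts_subset trees_subset dj] T by metis
    then show ?thesis using 1 T Par by auto
  next
    case 2
    then have "T1 = U1" using disjoint_Un_eqD(1)[OF _ cuts_subset trees_subset cuts_subset cuts_subset dj] T by metis
    then show ?thesis using 2 T Par by auto
  qed
next
  case (Ser s t)
  have dj: "leaves s \<inter> leaves t = {}" using Ser.prems by simp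
  from Ser.prems obtain T1 T2 where T: "T = T1 \<union> T2" "T1 \<in> trees s" "T2 \<in> trees t" by (auto elim: joinE)
  from Ser.prems(2) consider U1 U2 where "T = U1 \<union> U2" "U1 \<in> cuts s" "U2 \<in> trees t"
    | U1 U2 where "T = U1 \<union> U2" "U1 \<in> trees s" "U2 \<in> cuts t" by (auto elim: joinE)
  then show ?case
  proof cases
    case 1
    then have "T1 = U1" using disjoint_Un_eqD(1)[OF _ trees_subset cuts_subset trees_subset trees_subset dj] T by metis
    then show ?thesis using 1 T Ser by auto
  next
    case 2
    then have "T2 = U2" using disjoint_Un_eqD(2)[OF _ trees_subset trees_subset trees_subset cuts_subset dj] T by metis
    then show ?thesis using 2 T Ser by auto
  qed
qed

text \<open>Some edge joins the two components of a separating forest. Consequently every cut is the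
  lower end of an arc in each copy, so a condition on the arcs of a copy reaches all cuts.\<close>

lemma cuts_extend:
  "distinct_leaves t \<Longrightarrow> T \<in> cuts t \<Longrightarrow> \<exists>f\<in>leaves t - T. insert f T \<in> trees t"
proof (induction t arbitrary: T)
  case (Edge f)
  then show ?case by simp
next
  case (Par s t)
  from Par.prems obtain T1 T2 where T: "T = T1 \<union> T2" "T1 \<in> cuts s" "T2 \<in> cuts t" by (auto elim: joinE)
  obtain f where f: "f \<in> leaves s - T1" "insert f T1 \<in> trees s" using Par.IH(1)[of T1] Par.prems T by auto
  have "insert f T = insert f T1 \<union> T2" using T by auto
  then have "insert f T \<in> trees (Par s t)" using joinI[OF f(2) T(3)] by simp
  moreover have "f \<notin> T2" using f cuts_subset[OF T(3)] Par.prems by auto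
  ultimately show ?case using f T by auto
next
  case (Ser s t)
  from Ser.prems consider T1 T2 where "T = T1 \<union> T2" "T1 \<in> cuts s" "T2 \<in> trees t"
    | T1 T2 where "T = T1 \<union> T2" "T1 \<in> trees s" "T2 \<in> cuts t" by (auto elim: joinE)
  then show ?case
  proof cases
    case 1
    obtain f where f: "f \<in> leaves s - T1" "insert f T1 \<in> trees s" using Ser.IH(1)[of T1] Ser.prems 1 by auto
    have "insert f T = insert f T1 \<union> T2" using 1 by auto
    then have "insert f T \<in> trees (Ser s t)" using joinI[OF f(2) 1(3)] by simp
    moreover have "f \<notin> T2" using f trees_subset[OF 1(3)] Ser.prems by auto
    ultimately show ?thesis using f 1 by auto
  next
    case 2
    obtain f where f: "f \<in> leaves t - T2" "insert f T2 \<in> trees t" using Ser.IH(2)[of T2] Ser.prems 2 by auto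
    have "insert f T = T1 \<union> insert f T2" using 2 by auto
    then have "insert f T \<in> trees (Ser s t)" using joinI[OF 2(2) f(2)] by simp
    moreover have "f \<notin> T1" using f trees_subset[OF 2(2)] Ser.prems by auto
    ultimately show ?thesis using f 2 by auto
  qed
qed

section \<open>Duality of two-terminal networks\<close>

primrec dual :: "'e sp \<Rightarrow> 'e sp" where
  "dual (Edge f) = Edge f"
| "dual (Par s t) = Ser (dual s) (dual t)"
| "dual (Ser s t) = Par (dual s) (dual t)"

lemma dual_dual [simp]: "dual (dual t) = t"
  by (induction t) auto

lemma leaves_dual [simp]: "leaves (dual t) = leaves t"
  by (induction t) auto

lemma distinct_leaves_dual [simp]: "distinct_leaves (dual t) = distinct_leaves t"
  by (induction t) auto

lemma join_complement:
  assumes "X \<inter> Y = {}" "P \<subseteq> Pow X" "R \<subseteq> Pow Y"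
  shows "join ((-) X ` P) ((-) Y ` R) = (-) (X \<union> Y) ` join P R"
proof -
  have eq: "X - T \<union> (Y - U) = X \<union> Y - (T \<union> U)" if "T \<in> P" "U \<in> R" for T U
    using that assms by blast
  show ?thesis
  proof (intro set_eqI iffI)
    fix W
    assume "W \<in> join ((-) X ` P) ((-) Y ` R)"
    then obtain T U where "T \<in> P" "U \<in> R" "W = X - T \<union> (Y - U)" by (auto elim: joinE)
    then show "W \<in> (-) (X \<union> Y) ` join P R" using eq joinI by (metis imageI)
  next
    fix W
    assume "W \<in> (-) (X \<union> Y) ` join P R"
    then obtain T U where "T \<in> P" "U \<in> R" "W = X \<union> Y - (T \<union> U)" by (auto elim: joinE)
    then show "W \<in> join ((-) X ` P) ((-) Y ` R)" using eq joinI by (metis imageI)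
  qed
qed

text \<open>This is planar duality. Closing the network by an edge between the terminals gives a
  plane graph; the complement of a spanning tree is a spanning tree of the dual graph, and the
  closing edge changes sides, which exchanges trees and cuts.\<close>

lemma cuts_trees_dual:
  "distinct_leaves t \<Longrightarrow> cuts (dual t) = (-) (leaves t) ` trees t \<and> trees (dual t) = (-) (leaves t) ` cuts t"
proof (induction t)
  case (Edge f)
  then show ?case by simp
next
  case (Par s t)
  then have dj: "leaves s \<inter> leaves t = {}" by simp
  have sub: "cuts s \<subseteq> Pow (leaves s)" "trees s \<subseteq> Pow (leaves s)"
    "cuts t \<subseteq> Pow (leaves t)" "trees t \<subseteq> Pow (leaves t)"
    by (auto dest: cuts_subset trees_subset)
  show ?case using Par sub by (simp add: image_Un join_complement[OF dj] Un_commute)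
next
  case (Ser s t)
  then have dj: "leaves s \<inter> leaves t = {}" by simp
  have sub: "cuts s \<subseteq> Pow (leaves s)" "trees s \<subseteq> Pow (leaves s)"
    "cuts t \<subseteq> Pow (leaves t)" "trees t \<subseteq> Pow (leaves t)"
    by (auto dest: cuts_subset trees_subset)
  show ?case using Ser sub by (simp add: image_Un join_complement[OF dj] Un_commute)
qed

section \<open>Supersaturation\<close>

text \<open>The pair \<open>(x, i)\<close> stands for the cube edge between \<open>x\<close> and \<open>insert i x\<close>.\<close>

definition arcs :: "nat set \<Rightarrow> (nat set \<times> nat) set" where
  "arcs V = {(x, i). i \<in> V \<and> x \<subseteq> V - {i}}"

definition injs :: "'e set \<Rightarrow> nat set \<Rightarrow> ('e \<Rightarrow> nat) set" where
  "injs L V = {J \<in> L \<rightarrow>\<^sub>E V. inj_on J L}"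

text \<open>\<open>J\<close> assigns a coordinate to each leaf and \<open>z\<close> is the set of
  fixed coordinates with value 1, so a pair of them describes an oriented face.\<close>

definition copy :: "'e sp \<Rightarrow> (nat set \<times> nat) set \<Rightarrow> ('e \<Rightarrow> nat) \<Rightarrow> nat set \<Rightarrow> bool" where
  "copy t S J z \<longleftrightarrow> (\<forall>T\<in>cuts t. \<forall>f\<in>leaves t - T. insert f T \<in> trees t \<longrightarrow> (z \<union> J ` T, J f) \<in> S)"

definition copies :: "'e sp \<Rightarrow> nat set \<Rightarrow> (nat set \<times> nat) set \<Rightarrow> (('e \<Rightarrow> nat) \<times> nat set) set" where
  "copies t V S = {(J, z). J \<in> injs (leaves t) V \<and> z \<subseteq> V - J ` leaves t \<and> copy t S J z}"

definition density :: "nat set \<Rightarrow> (nat set \<times> nat) set \<Rightarrow> real" where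
  "density V S = real (card S) / real (card (arcs V))"

text \<open>The error term \<open>C / card V\<close> replaces a lower bound on the density, which makes the property easy
  to compose.\<close>

definition supersaturated :: "'e sp \<Rightarrow> bool" where
  "supersaturated t \<longleftrightarrow> (\<exists>k C. 1 \<le> k \<and> 0 \<le> C \<and>
     (\<forall>V S. finite V \<longrightarrow> card (leaves t) \<le> card V \<longrightarrow> S \<subseteq> arcs V \<longrightarrow>
       real (card (copies t V S)) \<ge> (density V S ^ k - C / real (card V))
          * (real (card (injs (leaves t) V)) * 2 ^ (card V - card (leaves t)))))"

lemma arcs_Sigma: "arcs V = prod.swap ` (SIGMA i:V. Pow (V - {i}))"
  by (auto simp: arcs_def image_iff)

lemma finite_arcs: "finite V \<Longrightarrow> finite (arcs V)"
  by (simp add: arcs_Sigma)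

lemma card_arcs: "finite V \<Longrightarrow> card (arcs V) = card V * 2 ^ (card V - 1)"
  by (simp add: arcs_Sigma card_image card_Pow)

lemma finite_injs: "finite L \<Longrightarrow> finite V \<Longrightarrow> finite (injs L V)"
  unfolding injs_def by (rule finite_subset[of _ "L \<rightarrow>\<^sub>E V"]) (auto intro: finite_PiE)

lemma card_injs_le:
  assumes "finite L" "finite L'" "finite V" "finite V'" "card L = card L'" "card V = card V'"
  shows "card (injs L V) \<le> card (injs L' V')"
proof -
  obtain h where h: "bij_betw h L' L" using finite_same_card_bij assms by metis
  obtain g where g: "bij_betw g V V'" using finite_same_card_bij assms by metis
  define F where "F J = restrict (g \<circ> J \<circ> h) L'" for J
  have hL: "h x \<in> L" if "x \<in> L'" for x using h that by (auto simp: bij_betw_def)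
  have "F J \<in> injs L' V'" if J: "J \<in> injs L V" for J
  proof -
    have "J (h x) \<in> V" if "x \<in> L'" for x using J hL[OF that] by (auto simp: injs_def)
    moreover from this have "inj_on (g \<circ> J \<circ> h) L'"
      using g h J hL unfolding inj_on_def bij_betw_def injs_def by (auto simp: inj_on_def)
    ultimately show ?thesis using g by (auto simp: F_def injs_def bij_betw_def inj_on_def)
  qed
  moreover have "inj_on F (injs L V)"
  proof (rule inj_onI)
    fix J K assume J: "J \<in> injs L V" and K: "K \<in> injs L V" and eq: "F J = F K"
    show "J = K"
    proof (rule PiE_ext)
      show "J \<in> L \<rightarrow>\<^sub>E V" "K \<in> L \<rightarrow>\<^sub>E V" using J K by (auto simp: injs_def)
      fix y assume "y \<in> L"
      then obtain x where x: "x \<in> L'" "y = h x" using h by (auto simp: bij_betw_def)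
      have "g (J (h x)) = g (K (h x))" using fun_cong[OF eq, of x] x by (simp add: F_def)
      moreover have "J (h x) \<in> V" "K (h x) \<in> V" using J K hL x by (auto simp: injs_def)
      ultimately show "J y = K y" using g x by (auto simp: bij_betw_def inj_on_def)
    qed
  qed
  ultimately show ?thesis by (intro card_inj_on_le[of F]) (auto simp: finite_injs assms)
qed

lemma card_injs_cong:
  assumes "finite L" "finite L'" "finite V" "finite V'" "card L = card L'" "card V = card V'"
  shows "card (injs L V) = card (injs L' V')"
  using assms by (intro antisym card_injs_le) auto

lemma injs_D:
  assumes "J \<in> injs L V"
  shows "J ` L \<subseteq> V" "inj_on J L" "card (J ` L) = card L"
  using assms by (auto simp: injs_def card_image)

lemma density_bounds:
  assumes "finite V" "S \<subseteq> arcs V"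
  shows "0 \<le> density V S" "density V S \<le> 1"
proof -
  have "card S \<le> card (arcs V)" using assms finite_arcs card_mono by blast
  then show "density V S \<le> 1" unfolding density_def by (simp add: divide_le_eq)
qed (simp add: density_def)

text \<open>Convexity of powers on the nonnegative reals. Multiplying the bound for \<open>k\<close>
  by \<open>x\<close> gives the bound for \<open>Suc k\<close> plus a nonnegative multiple of
  \<open>(x - a) ^ 2\<close>.\<close>

lemma power_tangent:
  fixes x a :: real
  assumes "0 \<le> x" "0 \<le> a"
  shows "x ^ Suc k \<ge> a ^ Suc k + real (Suc k) * a ^ k * (x - a)"
proof (induction k)
  case 0
  then show ?case by simp
next
  case (Suc k)
  have "a ^ Suc (Suc k) + real (Suc (Suc k)) * a ^ Suc k * (x - a) + real (Suc k) * a ^ k * (x - a) ^ 2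
     = x * (a ^ Suc k + real (Suc k) * a ^ k * (x - a))"
    by (simp add: algebra_simps power2_eq_square)
  also have "\<dots> \<le> x * x ^ Suc k" using Suc assms by (intro mult_left_mono)
  finally show ?case using assms by (smt (verit) mult_nonneg_nonneg of_nat_0_le_iff power_Suc zero_le_power zero_le_power2)
qed

text \<open>Jensen's inequality, with the tangent at \<open>a\<close> instead of the mean.\<close>

lemma sum_power_lower_bound:
  fixes d :: "'i \<Rightarrow> real" and a y :: real
  assumes "finite I" "\<And>i. i \<in> I \<Longrightarrow> 0 \<le> d i" "0 \<le> a" "a \<le> 1" "0 \<le> y" "1 \<le> k"
    and sum: "(\<Sum>i\<in>I. d i) \<ge> real (card I) * (a - y)"
  shows "(\<Sum>i\<in>I. d i ^ k) \<ge> real (card I) * (a ^ k - real k * y)"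
proof -
  obtain l where k: "k = Suc l" using assms(6) by (cases k) auto
  \<comment> \<open>As \<open>a\<close> is at most 1, the slope of the tangent is at most
    \<open>k\<close>, so a deficit \<open>y\<close> in the mean costs at most
    \<open>k * y\<close>.\<close>
  have c: "0 \<le> real (Suc l) * a ^ l" "real (Suc l) * a ^ l \<le> real k"
    using assms k by (auto simp: power_le_one mult_left_le)
  have "real (card I) * (a ^ k - real k * y) \<le> real (card I) * (a ^ k - (real (Suc l) * a ^ l) * y)"
    using c assms by (intro mult_left_mono diff_left_mono mult_right_mono) auto
  also have "\<dots> = real (card I) * a ^ k + (real (Suc l) * a ^ l) * (real (card I) * (a - y) - real (card I) * a)"
    by (simp add: algebra_simps)
  also have "\<dots> \<le> real (card I) * a ^ k + (real (Suc l) * a ^ l) * ((\<Sum>i\<in>I. d i) - real (card I) * a)"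
    using c sum by (intro add_left_mono mult_left_mono) auto
  also have "\<dots> = (\<Sum>i\<in>I. a ^ Suc l + real (Suc l) * a ^ l * (d i - a))"
    by (simp add: sum.distrib sum_subtractf sum_distrib_left[symmetric] k)
  also have "\<dots> \<le> (\<Sum>i\<in>I. d i ^ k)"
    unfolding k using assms by (intro sum_mono power_tangent) auto
  finally show ?thesis .
qed

section \<open>Injections on disjoint sets of leaves\<close>

definition merge :: "'e set \<Rightarrow> 'e set \<Rightarrow> ('e \<Rightarrow> nat) \<Rightarrow> ('e \<Rightarrow> nat) \<Rightarrow> 'e \<Rightarrow> nat" where
  "merge L1 L2 J1 J2 = (\<lambda>f\<in>L1 \<union> L2. if f \<in> L1 then J1 f else J2 f)"

lemma merge_apply:
  assumes "L1 \<inter> L2 = {}"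
  shows "f \<in> L1 \<Longrightarrow> merge L1 L2 J1 J2 f = J1 f" "f \<in> L2 \<Longrightarrow> merge L1 L2 J1 J2 f = J2 f"
  using assms by (auto simp: merge_def)

lemma merge_image:
  assumes "L1 \<inter> L2 = {}"
  shows "T \<subseteq> L1 \<Longrightarrow> merge L1 L2 J1 J2 ` T = J1 ` T" "T \<subseteq> L2 \<Longrightarrow> merge L1 L2 J1 J2 ` T = J2 ` T"
  by (intro image_cong HOL.refl; use merge_apply[OF assms] in blast)+

lemma merge_injs:
  assumes dj: "L1 \<inter> L2 = {}" and "J2 \<in> injs L2 V" "J1 \<in> injs L1 (V - J2 ` L2)"
  shows "merge L1 L2 J1 J2 \<in> injs (L1 \<union> L2) V"
proof -
  have J1: "J1 ` L1 \<subseteq> V - J2 ` L2" "inj_on J1 L1" and J2: "J2 ` L2 \<subseteq> V" "inj_on J2 L2"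
    using injs_D(1,2)[OF assms(2)] injs_D(1,2)[OF assms(3)] by simp_all
  have im: "merge L1 L2 J1 J2 ` L1 = J1 ` L1" "merge L1 L2 J1 J2 ` L2 = J2 ` L2"
    by (simp_all add: merge_image[OF dj])
  have "inj_on (merge L1 L2 J1 J2) L1" "inj_on (merge L1 L2 J1 J2) L2"
    using J1(2) J2(2) inj_on_cong[of L1 "merge L1 L2 J1 J2" J1] inj_on_cong[of L2 "merge L1 L2 J1 J2" J2]
    by (simp_all add: merge_apply[OF dj])
  moreover have "L1 - L2 = L1" "L2 - L1 = L2" using dj by blast+
  ultimately have "inj_on (merge L1 L2 J1 J2) (L1 \<union> L2)"
    using J1 J2 by (auto simp: inj_on_Un im)
  moreover have "merge L1 L2 J1 J2 ` (L1 \<union> L2) \<subseteq> V"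
    using J1 J2 by (auto simp: image_Un im)
  moreover have "merge L1 L2 J1 J2 \<in> extensional (L1 \<union> L2)" by (simp add: merge_def)
  ultimately show ?thesis by (auto simp: injs_def PiE_def)
qed

lemma merge_inject:
  assumes dj: "L1 \<inter> L2 = {}"
    and "J2 \<in> injs L2 V" "K2 \<in> injs L2 V" "J1 \<in> injs L1 W" "K1 \<in> injs L1 W'"
    and eq: "merge L1 L2 J1 J2 = merge L1 L2 K1 K2"
  shows "J1 = K1 \<and> J2 = K2"
proof
  have "J1 f = K1 f" if "f \<in> L1" for f
    using fun_cong[OF eq, of f] that by (simp add: merge_apply[OF dj])
  moreover have "J1 \<in> extensional L1" "K1 \<in> extensional L1"
    using assms by (auto simp: injs_def PiE_def)
  ultimately show "J1 = K1" by (metis extensionalityI)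
  have "J2 f = K2 f" if "f \<in> L2" for f
    using fun_cong[OF eq, of f] that by (simp add: merge_apply[OF dj])
  moreover have "J2 \<in> extensional L2" "K2 \<in> extensional L2"
    using assms by (auto simp: injs_def PiE_def)
  ultimately show "J2 = K2" by (metis extensionalityI)
qed

text \<open>Placing \<open>L2\<close> first and \<open>L1\<close> on the remaining coordinates
  produces each injection exactly once.\<close>

lemma card_injs_Un:
  assumes dj: "L1 \<inter> L2 = {}" and fin: "finite L1" "finite L2" "finite V"
  shows "card (injs (L1 \<union> L2) V) = (\<Sum>J2\<in>injs L2 V. card (injs L1 (V - J2 ` L2)))"
proof -
  define F where "F = (\<lambda>(J2, J1). merge L1 L2 J1 J2)"
  have "bij_betw F (SIGMA J2:injs L2 V. injs L1 (V - J2 ` L2)) (injs (L1 \<union> L2) V)"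
    unfolding bij_betw_def
  proof
    show "inj_on F (SIGMA J2:injs L2 V. injs L1 (V - J2 ` L2))"
      by (rule inj_onI) (auto simp: F_def dest: merge_inject[OF dj])
    show "F ` (SIGMA J2:injs L2 V. injs L1 (V - J2 ` L2)) = injs (L1 \<union> L2) V"
    proof
      show "F ` (SIGMA J2:injs L2 V. injs L1 (V - J2 ` L2)) \<subseteq> injs (L1 \<union> L2) V"
        by (auto simp: F_def merge_injs[OF dj])
      show "injs (L1 \<union> L2) V \<subseteq> F ` (SIGMA J2:injs L2 V. injs L1 (V - J2 ` L2))"
      proof
        fix J assume J: "J \<in> injs (L1 \<union> L2) V"
        have inj: "inj_on J (L1 \<union> L2)" and im: "\<And>f. f \<in> L1 \<union> L2 \<Longrightarrow> J f \<in> V"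
          using J by (auto simp: injs_def)
        have "restrict J L2 \<in> injs L2 V"
          using inj im by (auto simp: injs_def inj_on_def)
        moreover have "restrict J L1 \<in> injs L1 (V - restrict J L2 ` L2)"
          using inj im dj by (auto simp: injs_def inj_on_def; blast)
        moreover have "J = merge L1 L2 (restrict J L1) (restrict J L2)"
        proof
          fix f show "J f = merge L1 L2 (restrict J L1) (restrict J L2) f"
            using J dj by (auto simp: merge_def injs_def PiE_def extensional_def)
        qed
        ultimately show "J \<in> F ` (SIGMA J2:injs L2 V. injs L1 (V - J2 ` L2))"
          unfolding F_def by (force simp: image_iff)
      qed
    qed
  qed
  then have "card (injs (L1 \<union> L2) V) = card (SIGMA J2:injs L2 V. injs L1 (V - J2 ` L2))"
    by (simp add: bij_betw_same_card)
  also have "\<dots> = (\<Sum>J2\<in>injs L2 V. card (injs L1 (V - J2 ` L2)))"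
    using fin by (intro card_SigmaI) (auto intro: finite_injs)
  finally show ?thesis .
qed

lemma card_Diff_injs:
  assumes "J \<in> injs L V" "finite L"
  shows "card (V - J ` L) = card V - card L"
proof -
  have "card (V - J ` L) = card V - card (J ` L)"
    using injs_D(1)[OF assms(1)] assms(2) by (intro card_Diff_subset) auto
  then show ?thesis using injs_D(3)[OF assms(1)] by simp
qed

text \<open>Double counting of the pairs of an injection and a coordinate outside its image.\<close>

lemma sum_card_injs_remove:
  assumes fin: "finite L" "finite V"
  shows "(\<Sum>i\<in>V. card (injs L (V - {i}))) = card (injs L V) * (card V - card L)"
proof -
  have "(\<Sum>i\<in>V. card (injs L (V - {i}))) = card (SIGMA i:V. injs L (V - {i}))"
    using fin by (intro card_SigmaI[symmetric]) (auto intro: finite_injs)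
  also have "(SIGMA i:V. injs L (V - {i})) = prod.swap ` (SIGMA J:injs L V. V - J ` L)"
    by (auto simp: injs_def image_iff PiE_iff)
  also have "card \<dots> = card (SIGMA J:injs L V. V - J ` L)"
    by (rule card_image) auto
  also have "\<dots> = (\<Sum>J\<in>injs L V. card (V - J ` L))"
    using fin by (intro card_SigmaI) (auto intro: finite_injs)
  also have "\<dots> = (\<Sum>J\<in>injs L V. card V - card L)"
    by (intro sum.cong[OF HOL.refl] card_Diff_injs fin)
  finally show ?thesis by simp
qed

section \<open>Parallel composition\<close>

definition cherries :: "nat set \<Rightarrow> (nat set \<times> nat) set \<Rightarrow> nat \<Rightarrow> (nat set \<times> nat) set" where
  "cherries V S i = {(x, j) \<in> arcs (V - {i}). (x, i) \<in> S \<and> (x, j) \<in> S}"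

text \<open>For fixed \<open>i\<close> the cherries are a set of arcs of the cube on
  \<open>V - {i}\<close>, to which the bound for a network applies. The last factor is the sum of
  \<open>card (arcs (V - {i}))\<close> over all \<open>i\<close>, so this bounds an average density:
  Cauchy-Schwarz gives the square, and the error term pays for the pairs whose two directions
  coincide.\<close>

lemma sum_card_cherries:
  assumes V: "finite V" "2 \<le> card V" and S: "S \<subseteq> arcs V"
  shows "(\<Sum>i\<in>V. real (card (cherries V S i)))
     \<ge> (density V S ^ 2 - 4 / real (card V)) * (real (card V) * real (card V - 1) * 2 ^ (card V - 2))"
proof -
  define N where "N x = {i. (x, i) \<in> S}" for x
  define s where "s x = real (card (N x))" for x
  obtain m where m: "card V = Suc (Suc m)"
    using V(2) by (metis add_2_eq_Suc le_Suc_ex)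
  define d where "d = density V S"
  define n where "n = real (card V)"
  define M :: real where "M = 2 ^ m"
  have N: "N x \<subseteq> V" "finite (N x)" for x
    using S V finite_subset[of "N x" V] by (auto simp: N_def arcs_def)
  have "card S = card (SIGMA x:Pow V. N x)"
    by (rule arg_cong[of _ _ card]) (use S in \<open>auto simp: N_def arcs_def\<close>)
  also have "\<dots> = (\<Sum>x\<in>Pow V. card (N x))"
    using V N by (intro card_SigmaI) auto
  finally have cS: "real (card S) = (\<Sum>x\<in>Pow V. s x)" by (simp add: s_def)
  have d: "0 \<le> d" "d \<le> 1" using density_bounds V S by (auto simp: d_def)
  have "real (card (arcs V)) = n * (2 * M)"
    using V m by (simp add: card_arcs n_def M_def algebra_simps)
  moreover have "n > 0" "M > 0" using m by (simp_all add: n_def M_def)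
  ultimately have "real (card S) = d * (n * (2 * M))"
    by (simp add: d_def density_def mult_ac)
  then have sum_s: "(\<Sum>x\<in>Pow V. s x) = d * (n * (2 * M))" using cS by simp
  have "(\<Sum>i\<in>V. card (cherries V S i)) = card (SIGMA i:V. cherries V S i)"
    using V finite_arcs[of "V - {_}"] by (intro card_SigmaI[symmetric])
      (auto simp: cherries_def intro: finite_subset[OF _ finite_arcs[of "V - {_}"]])
  also have "\<dots> = card (SIGMA x:Pow V. SIGMA i:N x. N x - {i})"
  proof (rule bij_betw_same_card[of "\<lambda>(i, x, j). (x, i, j)"])
    show "bij_betw (\<lambda>(i, x, j). (x, i, j)) (SIGMA i:V. cherries V S i) (SIGMA x:Pow V. SIGMA i:N x. N x - {i})"
      by (rule bij_betw_byWitness[of _ "\<lambda>(x, i, j). (i, x, j)"])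
        (use S in \<open>auto simp: N_def cherries_def arcs_def\<close>)
  qed
  also have "\<dots> = (\<Sum>x\<in>Pow V. card (SIGMA i:N x. N x - {i}))"
    using V N by (intro card_SigmaI) auto
  also have "\<dots> = (\<Sum>x\<in>Pow V. card (N x) * (card (N x) - 1))"
    using N by (intro sum.cong HOL.refl) (simp add: card_SigmaI)
  finally have "(\<Sum>i\<in>V. real (card (cherries V S i))) = (\<Sum>x\<in>Pow V. s x * (s x - 1))"
    by (simp add: s_def of_nat_diff_if flip: of_nat_sum)
      (auto intro!: sum.cong simp: algebra_simps of_nat_diff Suc_leI)
  moreover have "(\<Sum>x\<in>Pow V. s x * (s x - 1)) \<ge> (\<Sum>x\<in>Pow V. d * n * s x - d ^ 2 * n ^ 2 / 4 - s x)"
  proof (rule sum_mono)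
    fix x
    \<comment> \<open>Cauchy-Schwarz in the form of the tangent to the square at the mean of
      \<open>s\<close>: the sum \<open>d * (n * (2 * M))\<close> divided by the number
      \<open>4 * M\<close> of vertices is \<open>d * n / 2\<close>.\<close>
    have "0 \<le> (s x - d * n / 2) ^ 2" by simp
    then show "d * n * s x - d ^ 2 * n ^ 2 / 4 - s x \<le> s x * (s x - 1)"
      by (simp add: power2_eq_square algebra_simps)
  qed
  moreover have "(\<Sum>x\<in>Pow V. d * n * s x - d ^ 2 * n ^ 2 / 4 - s x)
      = d * n * (d * (n * (2 * M))) - 4 * M * (d ^ 2 * n ^ 2 / 4) - d * (n * (2 * M))"
    using V m by (simp add: sum_subtractf sum_distrib_left[symmetric] sum_s card_Pow M_def)
  moreover have "d * n * (d * (n * (2 * M))) - 4 * M * (d ^ 2 * n ^ 2 / 4) - d * (n * (2 * M))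
      \<ge> (d ^ 2 - 4 / n) * (n * (n - 1) * M)"
  proof -
    have n: "n \<ge> 2" using V by (simp add: n_def)
    \<comment> \<open>The difference of the two sides is
      \<open>M * ((1 - d) ^ 2 * n + 3 * n - 4)\<close>. The constant 4 in the error term makes it
      nonnegative for \<open>n \<ge> 2\<close>.\<close>
    have "(1 - d) ^ 2 * n \<ge> 0" using n by simp
    then have "(1 - d) ^ 2 * n + 3 * n - 4 \<ge> 0" using n by linarith
    then have "0 \<le> M * ((1 - d) ^ 2 * n + 3 * n - 4)" by (simp add: M_def)
    also have "\<dots> = d * n * (d * (n * (2 * M))) - 4 * M * (d ^ 2 * n ^ 2 / 4) - d * (n * (2 * M))
      - (d ^ 2 - 4 / n) * (n * (n - 1) * M)"
      using n by (simp add: field_simps power2_eq_square)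
    finally show ?thesis by simp
  qed
  ultimately have "(d ^ 2 - 4 / n) * (n * (n - 1) * M) \<le> (\<Sum>i\<in>V. real (card (cherries V S i)))"
    by linarith
  then show ?thesis using m by (simp add: d_def n_def M_def)
qed

text \<open>A link is an arc \<open>(z, i)\<close> such that \<open>J\<close>, \<open>z\<close> and \<open>i\<close> form a copy of the parallel composition of
  \<open>t\<close> and a single edge.\<close>

definition links :: "'e sp \<Rightarrow> nat set \<Rightarrow> (nat set \<times> nat) set \<Rightarrow> ('e \<Rightarrow> nat) \<Rightarrow> (nat set \<times> nat) set" where
  "links t V S J = {(z, i) \<in> arcs (V - J ` leaves t). copy t S J z \<and> (\<forall>T\<in>cuts t. (z \<union> J ` T, i) \<in> S)}"

lemma finite_copies: "finite V \<Longrightarrow> finite (copies t V S)"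
  by (rule finite_subset[of _ "injs (leaves t) V \<times> Pow V"]) (auto simp: copies_def finite_injs)

lemma finite_links: "finite V \<Longrightarrow> finite (links t V S J)"
  by (rule finite_subset[OF _ finite_arcs[of "V - J ` leaves t"]]) (auto simp: links_def)

text \<open>A copy of \<open>t\<close> among the cherries in direction \<open>i\<close> carries an
  arc of \<open>S\<close> in direction \<open>i\<close> at the lower end of each of its arcs. By
  \<open>cuts_extend\<close> every cut provides such a lower end, so \<open>(z, i)\<close> is a
  link.\<close>

lemma sum_card_copies_cherries_le:
  assumes dl: "distinct_leaves t" and V: "finite V" and S: "S \<subseteq> arcs V"
  shows "(\<Sum>i\<in>V. card (copies t (V - {i}) (cherries V S i))) \<le> (\<Sum>J\<in>injs (leaves t) V. card (links t V S J))"
proof -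
  let ?F = "\<lambda>(i :: nat, J :: 'a \<Rightarrow> nat, z :: nat set). (J, z, i)"
  have "(\<Sum>i\<in>V. card (copies t (V - {i}) (cherries V S i))) = card (SIGMA i:V. copies t (V - {i}) (cherries V S i))"
    using V by (intro card_SigmaI[symmetric]) (auto intro: finite_copies)
  also have "\<dots> \<le> card (SIGMA J:injs (leaves t) V. links t V S J)"
  proof (rule card_inj_on_le[of ?F])
    show "inj_on ?F (SIGMA i:V. copies t (V - {i}) (cherries V S i))" by (auto simp: inj_on_def)
    show "finite (SIGMA J:injs (leaves t) V. links t V S J)"
      using V by (auto intro!: finite_SigmaI finite_injs finite_links)
    have "J \<in> injs (leaves t) V \<and> (z, i) \<in> links t V S J"
      if i: "i \<in> V" and cp: "(J, z) \<in> copies t (V - {i}) (cherries V S i)" for i J z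
    proof
      have J: "J \<in> injs (leaves t) (V - {i})" and z: "z \<subseteq> V - {i} - J ` leaves t"
        and c: "copy t (cherries V S i) J z" using cp by (auto simp: copies_def)
      show "J \<in> injs (leaves t) V" using J by (auto simp: injs_def)
      have "i \<notin> J ` leaves t" using injs_D(1)[OF J] by auto
      then have "(z, i) \<in> arcs (V - J ` leaves t)" using i z by (auto simp: arcs_def)
      moreover have "copy t S J z" using c by (auto simp: copy_def cherries_def)
      moreover have "(z \<union> J ` T, i) \<in> S" if T: "T \<in> cuts t" for T
        using cuts_extend[OF dl T] c T by (auto simp: copy_def cherries_def)
      ultimately show "(z, i) \<in> links t V S J" by (simp add: links_def)
    qed
    then show "?F ` (SIGMA i:V. copies t (V - {i}) (cherries V S i)) \<subseteq> (SIGMA J:injs (leaves t) V. links t V S J)"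
      by auto
  qed
  also have "\<dots> = (\<Sum>J\<in>injs (leaves t) V. card (links t V S J))"
    using V by (intro card_SigmaI) (auto intro: finite_injs finite_links)
  finally show ?thesis .
qed

text \<open>Split a cut of the composition into a cut \<open>T1\<close> of \<open>s\<close> and a
  cut \<open>T2\<close> of \<open>t\<close>. If \<open>f\<close> belongs to \<open>s\<close>, the
  arc comes from the link in direction \<open>J1 f\<close>, which lies in \<open>S\<close> at every
  cut of \<open>t\<close>. If \<open>f\<close> belongs to \<open>t\<close>, the arc comes from the
  copy of \<open>t\<close> whose base is \<open>z\<close> enlarged by the image of
  \<open>T1\<close>; any link at that base provides this copy.\<close>

lemma copy_merge:
  assumes dl: "distinct_leaves (Par s t)" and J2: "J2 \<in> injs (leaves t) V"
    and cp: "(J1, z) \<in> copies s (V - J2 ` leaves t) (links t V S J2)"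
  shows "(merge (leaves s) (leaves t) J1 J2, z) \<in> copies (Par s t) V S"
proof -
  let ?J = "merge (leaves s) (leaves t) J1 J2"
  have dj: "leaves s \<inter> leaves t = {}" and dls: "distinct_leaves s" and dlt: "distinct_leaves t"
    using dl by auto
  note im = merge_image[OF dj] and app = merge_apply[OF dj]
  have J1: "J1 \<in> injs (leaves s) (V - J2 ` leaves t)" and z: "z \<subseteq> V - J2 ` leaves t - J1 ` leaves s"
    and c: "copy s (links t V S J2) J1 z" using cp by (auto simp: copies_def)
  have "?J ` leaves (Par s t) = J1 ` leaves s \<union> J2 ` leaves t" by (simp add: image_Un im)
  then have zJ: "z \<subseteq> V - ?J ` leaves (Par s t)" using z by auto
  have main: "(z \<union> ?J ` T, ?J f) \<in> S"
    if T: "T \<in> cuts (Par s t)" and f: "f \<in> leaves (Par s t) - T" "insert f T \<in> trees (Par s t)" for T f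
  proof -
    obtain T1 T2 where T12: "T = T1 \<union> T2" "T1 \<in> cuts s" "T2 \<in> cuts t" using T by (auto elim: joinE)
    have sub: "T1 \<subseteq> leaves s" "T2 \<subseteq> leaves t" using T12 cuts_subset by auto
    have JT: "?J ` T = J1 ` T1 \<union> J2 ` T2" using T12 sub by (simp add: image_Un im)
    have link: "(z \<union> J1 ` T1, J1 g) \<in> links t V S J2"
      if "g \<in> leaves s - T1" "insert g T1 \<in> trees s" for g
      using c T12(2) that by (auto simp: copy_def)
    consider U1 U2 where "insert f T = U1 \<union> U2" "U1 \<in> cuts s" "U2 \<in> trees t"
      | U1 U2 where "insert f T = U1 \<union> U2" "U1 \<in> trees s" "U2 \<in> cuts t" using f by (auto elim: joinE)
    then show ?thesis
    proof cases
      case 1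
      have subU: "U1 \<subseteq> leaves s" "U2 \<subseteq> leaves t" using 1(2,3) by (auto dest: cuts_subset trees_subset)
      \<comment> \<open>Otherwise the \<open>t\<close>-part \<open>T2\<close> would remain unchanged
        and be a cut and a tree at once.\<close>
      have "f \<in> leaves t"
      proof (rule ccontr)
        assume "f \<notin> leaves t"
        then have "U2 = T2"
          using disjoint_Un_eqD(2)[of "insert f T1" "T2" U1 U2, OF _ _ subU(1) _ subU(2) dj] sub f(1) 1(1) T12(1) by auto
        then show False using cuts_trees_disjoint[OF dlt] T12 1 by auto
      qed
      then have "U2 = insert f T2"
        using disjoint_Un_eqD(2)[of "T1" "insert f T2" U1 U2, OF _ _ subU(1) _ subU(2) dj] sub 1(1) T12(1) by auto
      then have U: "insert f T2 \<in> trees t" "f \<in> leaves t - T2" using 1 f T12 \<open>f \<in> leaves t\<close> by auto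
      \<comment> \<open>Any completion of \<open>T1\<close> will do: it only serves to produce a
        link at this base, and with it the copy of \<open>t\<close>.\<close>
      obtain g where g: "g \<in> leaves s - T1" "insert g T1 \<in> trees s" using cuts_extend[OF dls T12(2)] by auto
      have "copy t S J2 (z \<union> J1 ` T1)" using link[OF g] by (auto simp: links_def)
      then have "(z \<union> J1 ` T1 \<union> J2 ` T2, J2 f) \<in> S" using U T12 by (auto simp: copy_def)
      then show ?thesis using \<open>f \<in> leaves t\<close> by (simp add: JT app Un_assoc)
    next
      case 2
      have subU: "U1 \<subseteq> leaves s" "U2 \<subseteq> leaves t" using 2(2,3) by (auto dest: cuts_subset trees_subset)
      have "f \<in> leaves s"
      proof (rule ccontr)
        assume "f \<notin> leaves s"
        then have "U1 = T1"
          using disjoint_Un_eqD(1)[of "T1" "insert f T2" U1 U2, OF _ _ subU(1) _ subU(2) dj] sub f(1) 2(1) T12(1) by auto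
        then show False using cuts_trees_disjoint[OF dls] T12 2 by auto
      qed
      then have "U1 = insert f T1"
        using disjoint_Un_eqD(1)[of "insert f T1" "T2" U1 U2, OF _ _ subU(1) _ subU(2) dj] sub 2(1) T12(1) by auto
      then have U: "insert f T1 \<in> trees s" "f \<in> leaves s - T1" using 2 f T12 \<open>f \<in> leaves s\<close> by auto
      have "(z \<union> J1 ` T1 \<union> J2 ` T2, J1 f) \<in> S" using link[OF U(2,1)] T12 by (auto simp: links_def)
      then show ?thesis using \<open>f \<in> leaves s\<close> by (simp add: JT app Un_assoc)
    qed
  qed
  show ?thesis
    using merge_injs[OF dj J2 J1] zJ main by (simp add: copies_def copy_def del: cuts.simps trees.simps)
qed

lemma sum_card_copies_links_le:
  assumes dl: "distinct_leaves (Par s t)" and V: "finite V"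
  shows "(\<Sum>J\<in>injs (leaves t) V. card (copies s (V - J ` leaves t) (links t V S J))) \<le> card (copies (Par s t) V S)"
proof -
  let ?F = "\<lambda>(J2, J1, z). (merge (leaves s) (leaves t) J1 J2, z :: nat set)"
  let ?A = "SIGMA J:injs (leaves t) V. copies s (V - J ` leaves t) (links t V S J)"
  have dj: "leaves s \<inter> leaves t = {}" using dl by simp
  have "(\<Sum>J\<in>injs (leaves t) V. card (copies s (V - J ` leaves t) (links t V S J))) = card ?A"
    using V by (intro card_SigmaI[symmetric]) (auto intro: finite_copies finite_injs)
  also have "\<dots> \<le> card (copies (Par s t) V S)"
  proof (rule card_inj_on_le[of ?F])
    show "inj_on ?F ?A"
      by (rule inj_onI) (auto simp: copies_def dest: merge_inject[OF dj])
    show "?F ` ?A \<subseteq> copies (Par s t) V S" using copy_merge[OF dl] by auto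
    show "finite (copies (Par s t) V S)" by (rule finite_copies[OF V])
  qed
  finally show ?thesis .
qed

lemma supersaturatedE:
  assumes "supersaturated t"
  obtains k C where "1 \<le> k" "0 \<le> C"
    "\<And>V S. finite V \<Longrightarrow> card (leaves t) \<le> card V \<Longrightarrow> S \<subseteq> arcs V \<Longrightarrow>
       (density V S ^ k - C / real (card V)) * (real (card (injs (leaves t) V)) * 2 ^ (card V - card (leaves t)))
         \<le> real (card (copies t V S))"
  using assms unfolding supersaturated_def by auto

text \<open>The averaging step shared by cherries, indexed by a direction, and links, indexed by an
  injection. Convexity carries a lower bound on the mean density through the power \<open>k\<close>,
  while the bounds for the single members, with a common normalising factor \<open>K\<close>, are
  summed.\<close>

lemma averaged_bound:
  fixes d c :: "'i \<Rightarrow> real" and a y D K :: real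
  assumes I: "finite I" and d: "\<And>i. i \<in> I \<Longrightarrow> 0 \<le> d i" and "0 \<le> a" "a \<le> 1" "0 \<le> y" "1 \<le> k" "0 \<le> K"
    and sum: "(\<Sum>i\<in>I. d i) \<ge> real (card I) * (a - y)"
    and c: "\<And>i. i \<in> I \<Longrightarrow> (d i ^ k - D) * K \<le> c i"
  shows "(a ^ k - (real k * y + D)) * (real (card I) * K) \<le> (\<Sum>i\<in>I. c i)"
proof -
  have "(a ^ k - (real k * y + D)) * (real (card I) * K)
      = (real (card I) * (a ^ k - real k * y) - real (card I) * D) * K"
    by (simp add: algebra_simps)
  also have "\<dots> \<le> ((\<Sum>i\<in>I. d i ^ k) - real (card I) * D) * K"
    using sum_power_lower_bound[OF I d assms(3-6) sum] assms(7) by (intro mult_right_mono) auto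
  also have "\<dots> = (\<Sum>i\<in>I. (d i ^ k - D) * K)"
    by (simp add: sum_distrib_right sum_subtractf left_diff_distrib)
  also have "\<dots> \<le> (\<Sum>i\<in>I. c i)" using c by (rule sum_mono)
  finally show ?thesis .
qed

lemma density_card_arcs:
  assumes "finite V" "S \<subseteq> arcs V"
  shows "real (card S) = density V S * real (card (arcs V))"
proof (cases "card (arcs V) = 0")
  case True
  then have "arcs V = {}" using assms finite_arcs by auto
  then show ?thesis using assms by simp
qed (simp add: density_def)

lemma card_injs_Diff:
  assumes "finite L" "finite V" "W \<subseteq> V" "W' \<subseteq> V" "card W = card W'"
  shows "card (injs L (V - W)) = card (injs L (V - W'))"
  using assms by (intro card_injs_cong) (auto simp: card_Diff_subset finite_subset)

text \<open>Cherries have average density about the square of the density of \<open>S\<close>, and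
  the bound for \<open>t\<close> in the cubes on \<open>V - {i}\<close> raises this to the power
  \<open>k\<close>. The normalisation counts all pairs of an injection \<open>J\<close> and an arc
  of the cube on the coordinates avoided by \<open>J\<close>, so the result is a bound on the
  average density of the link sets.\<close>

lemma sum_card_links:
  assumes dl: "distinct_leaves t" and ss: "supersaturated t"
  obtains a C where "1 \<le> a" "0 \<le> C"
    "\<And>V S. finite V \<Longrightarrow> card (leaves t) < card V \<Longrightarrow> S \<subseteq> arcs V \<Longrightarrow>
       (density V S ^ a - C / real (card V)) * (real (card (injs (leaves t) V)) * real (card V - card (leaves t))
           * 2 ^ (card V - 1 - card (leaves t)))
         \<le> (\<Sum>J\<in>injs (leaves t) V. real (card (links t V S J)))"
proof -
  from ss obtain k C where k: "1 \<le> k" and C: "0 \<le> C" and bound: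
    "\<And>V S. finite V \<Longrightarrow> card (leaves t) \<le> card V \<Longrightarrow> S \<subseteq> arcs V \<Longrightarrow>
       (density V S ^ k - C / real (card V)) * (real (card (injs (leaves t) V)) * 2 ^ (card V - card (leaves t)))
         \<le> real (card (copies t V S))" by (rule supersaturatedE) blast
  show thesis
  proof
    show "1 \<le> 2 * k" using k by simp
    \<comment> \<open>The cherry error 4 is multiplied by the slope bound \<open>k\<close> of the
      tangent; the factor 2 of \<open>C\<close> pays for passing from the dimension \<open>m\<close>
      of the smaller cubes to \<open>card V = Suc m\<close>.\<close>
    show "0 \<le> 4 * real k + 2 * C" using C by simp
    fix V S
    assume V: "finite V" and card: "card (leaves t) < card V" and S: "S \<subseteq> arcs V"
    define m where "m = card V - 1"
    define d where "d = density V S"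
    let ?d = "\<lambda>i. density (V - {i}) (cherries V S i)"
    have m: "1 \<le> m" "card (leaves t) \<le> m" "card V = Suc m"
      using card card_leaves_pos[of t] by (auto simp: m_def)
    have d: "0 \<le> d" "d \<le> 1" using density_bounds V S by (auto simp: d_def)
    have cV: "card (V - {i}) = m" if "i \<in> V" for i using that V by (simp add: m_def)
    have sub: "cherries V S i \<subseteq> arcs (V - {i})" for i by (auto simp: cherries_def)
    obtain i0 where i0: "i0 \<in> V" using card by fastforce
    define I where "I = card (injs (leaves t) (V - {i0}))"
    have I: "card (injs (leaves t) (V - {i})) = I" if "i \<in> V" for i
      unfolding I_def using that i0 V by (intro card_injs_Diff) auto
    have "(d ^ 2 - 4 / real (card V)) * (real (card V) * (real m * 2 ^ (m - 1))) \<le> (\<Sum>i\<in>V. real (card (cherries V S i)))"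
      using sum_card_cherries[OF V _ S] m by (simp add: d_def numeral_2_eq_2 mult.assoc)
    also have "\<dots> = (\<Sum>i\<in>V. ?d i) * (real m * 2 ^ (m - 1))"
      unfolding sum_distrib_right
    proof (rule sum.cong[OF HOL.refl])
      fix i assume i: "i \<in> V"
      show "real (card (cherries V S i)) = ?d i * (real m * 2 ^ (m - 1))"
        using density_card_arcs[OF _ sub, of i] V cV[OF i] by (simp add: card_arcs)
    qed
    finally have "(real (card V) * (d ^ 2 - 4 / real (card V))) * (real m * 2 ^ (m - 1))
      \<le> (\<Sum>i\<in>V. ?d i) * (real m * 2 ^ (m - 1))" by (simp add: mult_ac)
    then have sum: "real (card V) * (d ^ 2 - 4 / real (card V)) \<le> (\<Sum>i\<in>V. ?d i)"
      by (rule mult_right_le_imp_le) (use m in simp)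
    have "((d ^ 2) ^ k - (real k * (4 / real (card V)) + C / real m)) * (real (card V) * (real I * 2 ^ (m - card (leaves t))))
      \<le> (\<Sum>i\<in>V. real (card (copies t (V - {i}) (cherries V S i))))"
    proof (rule averaged_bound[OF V _ _ _ _ k _ sum])
      show "0 \<le> ?d i" for i using density_bounds[OF _ sub] V by simp
      show "(?d i ^ k - C / real m) * (real I * 2 ^ (m - card (leaves t))) \<le> real (card (copies t (V - {i}) (cherries V S i)))"
        if "i \<in> V" for i
        using bound[OF _ _ sub, of i] V m I[OF that] cV[OF that] by simp
    qed (use d in \<open>auto simp: power_le_one\<close>)
    also have "\<dots> \<le> (\<Sum>J\<in>injs (leaves t) V. real (card (links t V S J)))"
      using sum_card_copies_cherries_le[OF dl V S] by (simp flip: of_nat_sum)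
    finally have main: "((d ^ 2) ^ k - (real k * (4 / real (card V)) + C / real m)) * (real (card V) * (real I * 2 ^ (m - card (leaves t))))
      \<le> (\<Sum>J\<in>injs (leaves t) V. real (card (links t V S J)))" .
    have "C / real m \<le> 2 * C / real (card V)"
      using m C mult_left_mono[of 1 "real m" C] by (simp add: field_simps)
    then have "d ^ (2 * k) - (4 * real k + 2 * C) / real (card V) \<le> (d ^ 2) ^ k - (real k * (4 / real (card V)) + C / real m)"
      by (simp add: power_mult add_divide_distrib mult.commute[of _ 4])
    then have "(d ^ (2 * k) - (4 * real k + 2 * C) / real (card V)) * (real (card V) * (real I * 2 ^ (m - card (leaves t))))
      \<le> (\<Sum>J\<in>injs (leaves t) V. real (card (links t V S J)))"
      by (intro order.trans[OF mult_right_mono main]) auto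
    \<comment> \<open>Choosing the spare direction before or after the injection counts the same
      pairs; this converts the normalisation over \<open>V - {i}\<close> into one over
      \<open>V\<close>.\<close>
    moreover have "card V * I = card (injs (leaves t) V) * (card V - card (leaves t))"
      using sum_card_injs_remove[OF finite_leaves V, of t] I by simp
    then have "real (card V) * real I = real (card (injs (leaves t) V)) * real (card V - card (leaves t))"
      by (simp flip: of_nat_mult)
    ultimately show "(density V S ^ (2 * k) - (4 * real k + 2 * C) / real (card V)) *
        (real (card (injs (leaves t) V)) * real (card V - card (leaves t)) * 2 ^ (card V - 1 - card (leaves t)))
         \<le> (\<Sum>J\<in>injs (leaves t) V. real (card (links t V S J)))"
      by (simp add: d_def m_def mult.assoc[symmetric])
  qed
qed

text \<open>The links of \<open>J\<close> are arcs of the cube on the coordinates avoided by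
  \<open>J\<close>. Copies of \<open>s\<close> among them merge with \<open>J\<close> into copies of
  the composition, and averaging over \<open>J\<close> multiplies the exponents \<open>a\<close> and
  \<open>k\<close>.\<close>

lemma supersaturated_Par:
  assumes dl: "distinct_leaves (Par s t)" and ss: "supersaturated s" and st: "supersaturated t"
  shows "supersaturated (Par s t)"
proof -
  have dj: "leaves s \<inter> leaves t = {}" and dlt: "distinct_leaves t" using dl by auto
  from ss obtain k C where k: "1 \<le> k" and C: "0 \<le> C" and bound:
    "\<And>V S. finite V \<Longrightarrow> card (leaves s) \<le> card V \<Longrightarrow> S \<subseteq> arcs V \<Longrightarrow>
       (density V S ^ k - C / real (card V)) * (real (card (injs (leaves s) V)) * 2 ^ (card V - card (leaves s)))
         \<le> real (card (copies s V S))" by (rule supersaturatedE) blast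
  from sum_card_links[OF dlt st] obtain a D where a: "1 \<le> a" and D: "0 \<le> D" and links:
    "\<And>V S. finite V \<Longrightarrow> card (leaves t) < card V \<Longrightarrow> S \<subseteq> arcs V \<Longrightarrow>
       (density V S ^ a - D / real (card V)) * (real (card (injs (leaves t) V)) * real (card V - card (leaves t))
           * 2 ^ (card V - 1 - card (leaves t)))
         \<le> (\<Sum>J\<in>injs (leaves t) V. real (card (links t V S J)))" by blast
  define d1 where "d1 = card (leaves s)"
  define d2 where "d2 = card (leaves t)"
  \<comment> \<open>The factor \<open>real d2 + 1\<close> compares the dimension \<open>m\<close>
    left for \<open>s\<close> with \<open>card V = m + d2\<close>, using
    \<open>m \<ge> 1\<close>.\<close>
  define E where "E = real k * D + (real d2 + 1) * C"
  have pos: "1 \<le> d1" "1 \<le> d2" using card_leaves_pos by (auto simp: d1_def d2_def)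
  have cL: "card (leaves (Par s t)) = d1 + d2" using dj by (simp add: card_Un_disjoint d1_def d2_def)
  have "(density V S ^ (a * k) - E / real (card V)) * (real (card (injs (leaves (Par s t)) V)) * 2 ^ (card V - card (leaves (Par s t))))
     \<le> real (card (copies (Par s t) V S))"
    if V: "finite V" and card: "card (leaves (Par s t)) \<le> card V" and S: "S \<subseteq> arcs V" for V S
  proof -
    define m where "m = card V - d2"
    define d where "d = density V S"
    let ?I = "injs (leaves t) V"
    let ?W = "\<lambda>J. V - J ` leaves t"
    let ?d = "\<lambda>J. density (?W J) (links t V S J)"
    have m: "1 \<le> m" "d1 \<le> m" "card V = m + d2" using card[unfolded cL] pos by (auto simp: m_def)
    have d: "0 \<le> d" "d \<le> 1" using density_bounds V S by (auto simp: d_def)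
    have cW: "card (?W J) = m" if "J \<in> ?I" for J
      using card_Diff_injs[OF that] by (simp add: m_def d2_def)
    have sub: "links t V S J \<subseteq> arcs (?W J)" for J by (auto simp: links_def)
    have finI: "finite ?I" using V by (simp add: finite_injs)
    define I where "I = card (injs (leaves s) {..<m})"
    have I: "card (injs (leaves s) (?W J)) = I" if "J \<in> ?I" for J
      unfolding I_def using V cW[OF that] by (intro card_injs_cong) auto
    have "(d ^ a - D / real (card V)) * (real (card ?I) * (real m * 2 ^ (m - 1))) \<le> (\<Sum>J\<in>?I. real (card (links t V S J)))"
    proof -
      have "card (leaves t) < card V" "card V - card (leaves t) = m" "card V - 1 - card (leaves t) = m - 1"
        using m by (auto simp: d2_def)
      then show ?thesis using links[OF V _ S] by (simp only: d_def mult.assoc)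
    qed
    also have "\<dots> = (\<Sum>J\<in>?I. ?d J) * (real m * 2 ^ (m - 1))"
      unfolding sum_distrib_right
    proof (rule sum.cong[OF HOL.refl])
      fix J assume J: "J \<in> ?I"
      show "real (card (links t V S J)) = ?d J * (real m * 2 ^ (m - 1))"
        using density_card_arcs[OF _ sub, of J] V cW[OF J] by (simp add: card_arcs)
    qed
    finally have "(real (card ?I) * (d ^ a - D / real (card V))) * (real m * 2 ^ (m - 1))
      \<le> (\<Sum>J\<in>?I. ?d J) * (real m * 2 ^ (m - 1))" by (simp add: mult_ac)
    then have sum: "real (card ?I) * (d ^ a - D / real (card V)) \<le> (\<Sum>J\<in>?I. ?d J)"
      by (rule mult_right_le_imp_le) (use m in simp)
    have "((d ^ a) ^ k - (real k * (D / real (card V)) + C / real m)) * (real (card ?I) * (real I * 2 ^ (m - d1)))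
      \<le> (\<Sum>J\<in>?I. real (card (copies s (?W J) (links t V S J))))"
    proof (rule averaged_bound[OF finI _ _ _ _ k _ sum])
      show "0 \<le> ?d J" for J using density_bounds[OF _ sub] V by simp
      show "(?d J ^ k - C / real m) * (real I * 2 ^ (m - d1)) \<le> real (card (copies s (?W J) (links t V S J)))"
        if "J \<in> ?I" for J
        using bound[OF _ _ sub, of J] V m I[OF that] cW[OF that] by (simp add: d1_def)
    qed (use d D in \<open>auto simp: power_le_one\<close>)
    also have "\<dots> \<le> real (card (copies (Par s t) V S))"
      using sum_card_copies_links_le[OF dl V] by (simp flip: of_nat_sum)
    finally have main: "((d ^ a) ^ k - (real k * (D / real (card V)) + C / real m)) * (real (card ?I) * (real I * 2 ^ (m - d1)))
      \<le> real (card (copies (Par s t) V S))" .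
    have "real m + real d2 \<le> (real d2 + 1) * real m"
      using mult_mono[of 1 "real m" "real d2" "real d2"] m(1) by (simp add: algebra_simps)
    then have "C * real (card V) \<le> C * ((real d2 + 1) * real m)"
      using C m by (intro mult_left_mono) auto
    then have "C / real m \<le> (real d2 + 1) * C / real (card V)"
      using m pos by (simp add: divide_le_eq le_divide_eq mult_ac)
    then have "d ^ (a * k) - E / real (card V) \<le> (d ^ a) ^ k - (real k * (D / real (card V)) + C / real m)"
      by (simp add: power_mult add_divide_distrib E_def)
    then have "(d ^ (a * k) - E / real (card V)) * (real (card ?I) * (real I * 2 ^ (m - d1))) \<le> real (card (copies (Par s t) V S))"
      by (intro order.trans[OF mult_right_mono main]) auto
    moreover have "card (injs (leaves (Par s t)) V) = card ?I * I"
      using card_injs_Un[OF dj _ _ V] I by simp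
    then have "real (card (injs (leaves (Par s t)) V)) = real (card ?I) * real I" by simp
    moreover have "card V - card (leaves (Par s t)) = m - d1" unfolding cL by (simp add: m_def)
    ultimately show ?thesis by (simp add: d_def mult.assoc)
  qed
  moreover have "0 \<le> E" using C D by (simp add: E_def)
  moreover have "1 \<le> a * k" using a k by simp
  ultimately show ?thesis unfolding supersaturated_def by blast
qed

section \<open>Single edges, complementation and series composition\<close>

lemma supersaturated_Edge: "supersaturated (Edge f)"
proof -
  have "real (card (injs {f} V)) * 2 ^ (card V - 1) = real (card (arcs V)) \<and> card S \<le> card (copies (Edge f) V S)"
    if V: "finite V" and S: "S \<subseteq> arcs V" for V S
  proof
    have "bij_betw (\<lambda>J. J f) (injs {f} V) V"
    proof (rule bij_betw_byWitness[of _ "\<lambda>i. \<lambda>x\<in>{f}. i"])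
      show "\<forall>J\<in>injs {f} V. (\<lambda>x\<in>{f}. J f) = J"
        by (auto simp: injs_def PiE_def extensional_def fun_eq_iff)
    qed (auto simp: injs_def PiE_def extensional_def)
    then have "card (injs {f} V) = card V" by (rule bij_betw_same_card)
    then show "real (card (injs {f} V)) * 2 ^ (card V - 1) = real (card (arcs V))"
      using V by (simp add: card_arcs)
    show "card S \<le> card (copies (Edge f) V S)"
    proof (rule card_inj_on_le[of "\<lambda>(x, i). (\<lambda>y\<in>{f}. i, x)"])
      show "inj_on (\<lambda>(x, i). (\<lambda>y\<in>{f}. i, x)) S"
        by (auto simp: inj_on_def fun_eq_iff split: if_splits)
      show "(\<lambda>(x, i). (\<lambda>y\<in>{f}. i, x)) ` S \<subseteq> copies (Edge f) V S"
      proof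
        fix p assume "p \<in> (\<lambda>(x, i). (\<lambda>y\<in>{f}. i, x)) ` S"
        then obtain x i where p: "p = (\<lambda>y\<in>{f}. i, x)" "(x, i) \<in> S" by auto
        then have "i \<in> V" "x \<subseteq> V - {i}" using S by (auto simp: arcs_def)
        then show "p \<in> copies (Edge f) V S" using p by (auto simp: copies_def copy_def injs_def split: if_splits)
      qed
    qed (rule finite_copies[OF V])
  qed
  then have "(density V S ^ 1 - 0 / real (card V)) * (real (card (injs (leaves (Edge f)) V)) * 2 ^ (card V - card (leaves (Edge f))))
      \<le> real (card (copies (Edge f) V S))" if "finite V" "S \<subseteq> arcs V" for V S
    using that by (simp flip: density_card_arcs)
  then show ?thesis unfolding supersaturated_def by (intro exI[of _ 1] exI[of _ 0]) simp
qed

text \<open>The antipodal map of the cube: the edge between \<open>x\<close> and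
  \<open>insert i x\<close> goes to the edge between their complements in \<open>V\<close>, whose
  lower end is \<open>V - x - {i}\<close>.\<close>

definition mirror :: "nat set \<Rightarrow> (nat set \<times> nat) set \<Rightarrow> (nat set \<times> nat) set" where
  "mirror V S = (\<lambda>(x, i). (V - x - {i}, i)) ` S"

lemma density_mirror:
  assumes "S \<subseteq> arcs V"
  shows "density V (mirror V S) = density V S"
proof -
  have "x = x'" if "(x, i) \<in> S" "(x', i) \<in> S" "V - x - {i} = V - x' - {i}" for x x' i
    using that assms by (auto simp: arcs_def)
  then have "inj_on (\<lambda>(x, i). (V - x - {i}, i)) S" by (auto simp: inj_on_def)
  then show ?thesis by (simp add: density_def mirror_def card_image)
qed

text \<open>Complementing in \<open>leaves t\<close> turns a cut below a tree into a cut below a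
  tree of the dual, with the same additional leaf; complementing in \<open>V\<close> does the same
  for the arcs. The base is complemented among the coordinates that \<open>J\<close> avoids.\<close>

lemma copies_dual:
  assumes dl: "distinct_leaves t" and S: "S \<subseteq> arcs V" and cp: "(J, z) \<in> copies t V (mirror V S)"
  shows "(J, V - J ` leaves t - z) \<in> copies (dual t) V S"
proof -
  let ?L = "leaves t" and ?z = "V - J ` leaves t - z"
  have J: "J \<in> injs ?L V" and z: "z \<subseteq> V - J ` ?L" and c: "copy t (mirror V S) J z"
    using cp by (auto simp: copies_def)
  have "(?z \<union> J ` T', J f) \<in> S"
    if T': "T' \<in> cuts (dual t)" and f: "f \<in> ?L - T'" "insert f T' \<in> trees (dual t)" for T' f
  proof -
    obtain U where U: "U \<in> trees t" "T' = ?L - U" using T' cuts_trees_dual[OF dl] by auto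
    obtain T where T: "T \<in> cuts t" "insert f T' = ?L - T" using f cuts_trees_dual[OF dl] by auto
    have sub: "U \<subseteq> ?L" "T \<subseteq> ?L" using U T by (auto dest: cuts_subset trees_subset)
    \<comment> \<open>Complementation reverses inclusion: the lower end for \<open>t\<close> is the
      complement of the upper end for \<open>dual t\<close>.\<close>
    have "insert f T = U" "f \<in> ?L - T" using sub f(1) U(2) T(2) by auto
    then have "(z \<union> J ` T, J f) \<in> mirror V S" using c T(1) U(1) by (auto simp: copy_def)
    then obtain x where x: "(x, J f) \<in> S" "z \<union> J ` T = V - x - {J f}" by (auto simp: mirror_def)
    have "x \<subseteq> V - {J f}" using S x(1) by (auto simp: arcs_def)
    moreover have "J f \<in> V" using injs_D(1)[OF J] f(1) by auto
    ultimately have "x = V - (z \<union> J ` T) - {J f}" using x(2) by blast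
    moreover have "J ` T' = J ` ?L - J ` (insert f T)"
      using injs_D(2)[OF J] sub U(2) \<open>insert f T = U\<close> by (simp add: inj_on_image_set_diff)
    then have "V - (z \<union> J ` T) - {J f} = ?z \<union> J ` T'"
      using z injs_D(1)[OF J] image_mono[of "insert f T" ?L J] sub \<open>insert f T = U\<close> by auto
    ultimately show ?thesis using x(1) by simp
  qed
  then show ?thesis using J by (auto simp: copies_def copy_def)
qed

lemma supersaturated_dual:
  assumes dl: "distinct_leaves t" and ss: "supersaturated t"
  shows "supersaturated (dual t)"
proof -
  have le: "card (copies t V (mirror V S)) \<le> card (copies (dual t) V S)"
    if V: "finite V" and S: "S \<subseteq> arcs V" for V S
  proof (rule card_inj_on_le[of "\<lambda>(J, z). (J, V - J ` leaves t - z)"])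
    show "inj_on (\<lambda>(J, z). (J, V - J ` leaves t - z)) (copies t V (mirror V S))"
      by (auto simp: inj_on_def copies_def)
    show "(\<lambda>(J, z). (J, V - J ` leaves t - z)) ` copies t V (mirror V S) \<subseteq> copies (dual t) V S"
      using copies_dual[OF dl S] by auto
  qed (rule finite_copies[OF V])
  have mirror: "mirror V S \<subseteq> arcs V" if "S \<subseteq> arcs V" for V S
    using that by (auto simp: mirror_def arcs_def)
  obtain k C where kC: "1 \<le> k" "0 \<le> C" and bound:
    "\<And>V S. finite V \<Longrightarrow> card (leaves t) \<le> card V \<Longrightarrow> S \<subseteq> arcs V \<Longrightarrow>
       (density V S ^ k - C / real (card V)) * (real (card (injs (leaves t) V)) * 2 ^ (card V - card (leaves t)))
         \<le> real (card (copies t V S))" using ss by (rule supersaturatedE) blast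
  have "(density V S ^ k - C / real (card V)) * (real (card (injs (leaves t) V)) * 2 ^ (card V - card (leaves t)))
         \<le> real (card (copies (dual t) V S))"
    if "finite V" "card (leaves t) \<le> card V" "S \<subseteq> arcs V" for V S
    using bound[OF that(1,2) mirror[OF that(3)]] le[OF that(1,3)] density_mirror[OF that(3)] by simp
  then show ?thesis unfolding supersaturated_def leaves_dual
    using kC by (intro exI[of _ k] exI[of _ C]) simp
qed

text \<open>\<open>Ser s t\<close> is the dual of \<open>Par (dual s) (dual t)\<close>, so series
  composition reduces to the parallel case.\<close>

theorem distinct_leaves_supersaturated: "distinct_leaves t \<Longrightarrow> supersaturated t"
proof (induction t)
  case (Ser s t)
  then have "supersaturated (Par (dual s) (dual t))"
    by (intro supersaturated_Par supersaturated_dual) auto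
  then have "supersaturated (dual (Par (dual s) (dual t)))"
    using Ser.prems by (intro supersaturated_dual) auto
  then show ?case by simp
qed (auto intro: supersaturated_Edge supersaturated_Par)

section \<open>Connectivity by cuts\<close>

text \<open>Unlike connectivity by paths, this is stable under contraction with hardly any work.\<close>

definition cut_connected :: "'v set \<Rightarrow> ('e \<Rightarrow> 'v set) \<Rightarrow> 'e set \<Rightarrow> bool" where
  "cut_connected V en T \<longleftrightarrow>
     (\<forall>X. X \<subset> V \<longrightarrow> X \<noteq> {} \<longrightarrow> (\<exists>f\<in>T. en f \<inter> X \<noteq> {} \<and> en f \<inter> (V - X) \<noteq> {}))"

lemma cut_connectedI:
  assumes "\<And>X. X \<subset> V \<Longrightarrow> X \<noteq> {} \<Longrightarrow> \<exists>f\<in>T. en f \<inter> X \<noteq> {} \<and> en f \<inter> (V - X) \<noteq> {}"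
  shows "cut_connected V en T"
  using assms by (auto simp: cut_connected_def)

lemma cut_connectedE:
  assumes "cut_connected V en T" "X \<subset> V" "X \<noteq> {}"
  obtains f where "f \<in> T" "en f \<inter> X \<noteq> {}" "en f \<inter> (V - X) \<noteq> {}"
  using assms(1)[unfolded cut_connected_def, rule_format, OF assms(2,3)] by (elim bexE conjE)

lemma cut_connected_replace:
  assumes "cut_connected V en T" "\<And>f. f \<in> T \<Longrightarrow> \<exists>g\<in>U. en' g = en f"
  shows "cut_connected V en' U"
proof (rule cut_connectedI)
  fix X assume "X \<subset> V" "X \<noteq> {}"
  then obtain f where f: "f \<in> T" "en f \<inter> X \<noteq> {}" "en f \<inter> (V - X) \<noteq> {}"
    by (rule cut_connectedE[OF assms(1)])
  from assms(2)[OF f(1)] obtain g where "g \<in> U" "en' g = en f" by (elim bexE)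
  then show "\<exists>f\<in>U. en' f \<inter> X \<noteq> {} \<and> en' f \<inter> (V - X) \<noteq> {}"
    using f by (intro bexI[of _ g]) auto
qed

lemma cut_connected_remove_loop:
  assumes "cut_connected V en T" "card (en f) = 1"
  shows "cut_connected V en (T - {f})"
proof (rule cut_connectedI)
  fix X assume "X \<subset> V" "X \<noteq> {}"
  then obtain g where g: "g \<in> T" "en g \<inter> X \<noteq> {}" "en g \<inter> (V - X) \<noteq> {}"
    by (rule cut_connectedE[OF assms(1)])
  then have "g \<noteq> f" using assms(2) by (auto simp: card_1_singleton_iff)
  then show "\<exists>f\<in>T - {f}. en f \<inter> X \<noteq> {} \<and> en f \<inter> (V - X) \<noteq> {}" using g by auto
qed

text \<open>A vertex set of the contracted graph is lifted by putting \<open>w\<close> on the side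
  of \<open>a\<close>. The edge crossing the lifted set cannot be \<open>f\<close>, which has both
  ends on one side.\<close>

lemma cut_connected_contract:
  assumes cc: "cut_connected V en T" and f: "en f = {a, w}" "a \<noteq> w" "a \<in> V" "w \<in> V"
  shows "cut_connected (V - {w}) (\<lambda>g. (\<lambda>x. if x = w then a else x) ` en g) (T - {f})"
proof (rule cut_connectedI)
  let ?r = "\<lambda>x. if x = w then a else x"
  fix X assume X: "X \<subset> V - {w}" "X \<noteq> {}"
  define X' where "X' = (if a \<in> X then insert w X else X)"
  have "X' \<subset> V" "X' \<noteq> {}" using X f by (auto simp: X'_def)
  then obtain g where g: "g \<in> T" "en g \<inter> X' \<noteq> {}" "en g \<inter> (V - X') \<noteq> {}"
    by (rule cut_connectedE[OF cc])
  from g(2,3) obtain x y where xy: "x \<in> en g" "x \<in> X'" "y \<in> en g" "y \<in> V - X'" by blast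
  have "?r x \<in> X" "?r y \<in> V - {w} - X"
    using xy X f by (auto simp: X'_def split: if_splits)
  moreover have "g \<noteq> f" using xy f X by (auto simp: X'_def split: if_splits)
  ultimately show "\<exists>g\<in>T - {f}. ?r ` en g \<inter> X \<noteq> {} \<and> ?r ` en g \<inter> (V - {w} - X) \<noteq> {}"
    using g(1) xy(1,3) by blast
qed

text \<open>A set separating \<open>a\<close> from \<open>w\<close> is crossed by \<open>f\<close>;
  every other one descends to the contracted graph.\<close>

lemma cut_connected_uncontract:
  assumes cc: "cut_connected (V - {w}) (\<lambda>g. (\<lambda>x. if x = w then a else x) ` en g) (T - {f})"
    and f: "f \<in> T" "en f = {a, w}" "a \<noteq> w" "a \<in> V" "w \<in> V"
  shows "cut_connected V en T"
proof (rule cut_connectedI)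
  let ?r = "\<lambda>x. if x = w then a else x"
  fix X assume X: "X \<subset> V" "X \<noteq> {}"
  show "\<exists>g\<in>T. en g \<inter> X \<noteq> {} \<and> en g \<inter> (V - X) \<noteq> {}"
  proof (cases "a \<in> X \<longleftrightarrow> w \<in> X")
    case False
    then show ?thesis using f by (intro bexI[of _ f]) auto
  next
    case True
    then have "X - {w} \<subset> V - {w}" "X - {w} \<noteq> {}" using X f by auto
    then obtain g where g: "g \<in> T - {f}" "?r ` en g \<inter> (X - {w}) \<noteq> {}" "?r ` en g \<inter> (V - {w} - (X - {w})) \<noteq> {}"
      by (rule cut_connectedE[OF cc])
    from g(2,3) obtain x y where xy: "x \<in> en g" "?r x \<in> X - {w}" "y \<in> en g" "?r y \<in> V - {w} - (X - {w})" by blast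
    then have "x \<in> X" "y \<in> V - X" using True f by (auto split: if_splits)
    then show ?thesis using g(1) xy(1,3) by blast
  qed
qed

lemma cut_connected_pendant_edge:
  assumes cc: "cut_connected V en T" and w: "w \<in> V" "a \<in> V" "a \<noteq> w"
    and only: "\<And>g. g \<in> T \<Longrightarrow> w \<in> en g \<Longrightarrow> g = f"
  shows "f \<in> T"
proof -
  have "{w} \<subset> V" using w by auto
  then obtain g where "g \<in> T" "en g \<inter> {w} \<noteq> {}" by (rule cut_connectedE[OF cc]) auto
  then show ?thesis using only by auto
qed

text \<open>Contracting a pendant edge amounts to deleting its end \<open>w\<close>, because no
  other edge of \<open>T\<close> meets \<open>w\<close>.\<close>

lemma cut_connected_remove_pendant:
  assumes cc: "cut_connected V en T" and f: "en f = {a, w}" "a \<noteq> w" "a \<in> V" "w \<in> V"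
    and only: "\<And>g. g \<in> T \<Longrightarrow> w \<in> en g \<Longrightarrow> g = f"
  shows "cut_connected (V - {w}) en (T - {f})"
proof (rule cut_connected_replace[OF cut_connected_contract[OF cc f]])
  fix g assume g: "g \<in> T - {f}"
  then have "(\<lambda>x. if x = w then a else x) ` en g = en g" using only by force
  then show "\<exists>h\<in>T - {f}. en h = (\<lambda>x. if x = w then a else x) ` en g" using g by auto
qed

lemma cut_connected_add_pendant:
  assumes cc: "cut_connected (V - {w}) en (T - {f})" and f: "f \<in> T" "en f = {a, w}" "a \<noteq> w" "a \<in> V" "w \<in> V"
    and only: "\<And>g. g \<in> T \<Longrightarrow> w \<in> en g \<Longrightarrow> g = f"
  shows "cut_connected V en T"
proof (rule cut_connected_uncontract[of V w a en T f, OF _ f])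
  show "cut_connected (V - {w}) (\<lambda>g. (\<lambda>x. if x = w then a else x) ` en g) (T - {f})"
  proof (rule cut_connected_replace[OF cc])
    fix g assume g: "g \<in> T - {f}"
    then have "(\<lambda>x. if x = w then a else x) ` en g = en g" using only by force
    then show "\<exists>h\<in>T - {f}. (\<lambda>x. if x = w then a else x) ` en h = en g" using g by auto
  qed
qed

section \<open>Minimally connected edge sets\<close>

text \<open>Stands in for the edge sets of spanning trees. Minimality passes through deletions and
  contractions by applying the cut criterion to \<open>T\<close> and to \<open>T - {f}\<close>, so
  no cycles have to be followed.\<close>

definition min_connected :: "'v set \<Rightarrow> ('e \<Rightarrow> 'v set) \<Rightarrow> 'e set \<Rightarrow> bool" where
  "min_connected V en T \<longleftrightarrow> cut_connected V en T \<and> (\<forall>f\<in>T. \<not> cut_connected V en (T - {f}))"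

lemma min_connected_no_loop:
  "min_connected V en T \<Longrightarrow> card (en f) = 1 \<Longrightarrow> f \<notin> T"
  using cut_connected_remove_loop by (metis min_connected_def)

lemma min_connected_parallel:
  assumes mc: "min_connected V en T" and "en f = en g" "f \<noteq> g"
  shows "f \<notin> T \<or> g \<notin> T"
proof (rule ccontr)
  assume both: "\<not> ?thesis"
  have "cut_connected V en (T - {f})"
  proof (rule cut_connected_replace)
    show "cut_connected V en T" using mc by (simp add: min_connected_def)
    fix h assume "h \<in> T"
    then show "\<exists>h'\<in>T - {f}. en h' = en h"
      using both assms(2,3) by (cases "h = f") (auto intro: bexI[of _ g])
  qed
  then show False using mc both by (auto simp: min_connected_def)
qed

lemma min_connected_swap_parallel:
  assumes mc: "min_connected V en T" and fg: "en f = en g" "f \<noteq> g" "f \<in> T"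
  shows "min_connected V en (insert g (T - {f}))"
proof -
  have g: "g \<notin> T" using min_connected_parallel[OF mc fg(1,2)] fg by auto
  have swap: "cut_connected V en U'" if "cut_connected V en U" "U - {f, g} \<subseteq> U'" "f \<in> U \<or> g \<in> U \<Longrightarrow> f \<in> U' \<or> g \<in> U'" for U U'
  proof (rule cut_connected_replace[OF that(1)])
    fix h assume h: "h \<in> U"
    show "\<exists>h'\<in>U'. en h' = en h"
    proof (cases "h \<in> {f, g}")
      case True
      then have "f \<in> U' \<or> g \<in> U'" using that(3) h by auto
      then show ?thesis using True fg(1) by auto
    qed (use that(2) h in auto)
  qed
  have "\<not> cut_connected V en (insert g (T - {f}) - {h})" if h: "h \<in> insert g (T - {f})" for h
  proof
    assume cc: "cut_connected V en (insert g (T - {f}) - {h})"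
    \<comment> \<open>Removing \<open>h\<close> after the exchange corresponds to removing
      \<open>h'\<close> before it.\<close>
    define h' where "h' = (if h = g then f else h)"
    have "cut_connected V en (T - {h'})"
      by (rule swap[OF cc]) (use h g fg in \<open>auto simp: h'_def\<close>)
    moreover have "h' \<in> T" using h fg by (auto simp: h'_def)
    ultimately show False using mc by (auto simp: min_connected_def)
  qed
  moreover have "cut_connected V en (insert g (T - {f}))"
    by (rule swap[of T]) (use mc in \<open>auto simp: min_connected_def\<close>)
  ultimately show ?thesis by (simp add: min_connected_def)
qed

lemma min_connected_remove_pendant:
  assumes mc: "min_connected V en T" and f: "en f = {a, w}" "a \<noteq> w" "a \<in> V" "w \<in> V"
    and only: "\<And>g. g \<in> T \<Longrightarrow> w \<in> en g \<Longrightarrow> g = f"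
  shows "f \<in> T" "min_connected (V - {w}) en (T - {f})"
proof -
  have cc: "cut_connected V en T" using mc by (simp add: min_connected_def)
  show "f \<in> T" using cut_connected_pendant_edge[OF cc f(4,3,2) only] .
  have "\<not> cut_connected (V - {w}) en (T - {f} - {h})" if h: "h \<in> T - {f}" for h
  proof
    assume "cut_connected (V - {w}) en (T - {f} - {h})"
    then have cc': "cut_connected (V - {w}) en (T - {h} - {f})" by (simp add: Diff_insert2[symmetric] insert_commute)
    have "f \<in> T - {h}" using h \<open>f \<in> T\<close> by auto
    then have "cut_connected V en (T - {h})"
      by (rule cut_connected_add_pendant[of V w en "T - {h}" f a, OF cc' _ f]) (rule only, simp_all)
    then show False using mc h by (auto simp: min_connected_def)
  qed
  then show "min_connected (V - {w}) en (T - {f})"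
    using cut_connected_remove_pendant[OF cc f only] by (simp add: min_connected_def)
qed

lemma min_connected_contract:
  assumes mc: "min_connected V en T" and f: "f \<in> T" "en f = {a, w}" "a \<noteq> w" "a \<in> V" "w \<in> V"
  shows "min_connected (V - {w}) (\<lambda>g. (\<lambda>x. if x = w then a else x) ` en g) (T - {f})"
proof -
  let ?en = "\<lambda>g. (\<lambda>x. if x = w then a else x) ` en g"
  have "\<not> cut_connected (V - {w}) ?en (T - {f} - {h})" if h: "h \<in> T - {f}" for h
  proof
    assume "cut_connected (V - {w}) ?en (T - {f} - {h})"
    then have "cut_connected (V - {w}) ?en (T - {h} - {f})" by (simp add: Diff_insert2[symmetric] insert_commute)
    then have "cut_connected V en (T - {h})"
      by (rule cut_connected_uncontract[of V w a en _ f]) (use h f in auto)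
    then show False using mc h by (auto simp: min_connected_def)
  qed
  then show ?thesis
    using cut_connected_contract[of V en T f a w, OF _ f(2-)] mc by (simp add: min_connected_def)
qed

lemma min_connected_cong:
  assumes "min_connected V en T" "\<And>f. f \<in> T \<Longrightarrow> en' f = en f"
  shows "min_connected V en' T"
proof -
  have "cut_connected V en' U = cut_connected V en U" if "U \<subseteq> T" for U
    using assms(2) that unfolding cut_connected_def by (metis subsetD)
  then show ?thesis using assms(1) unfolding min_connected_def by (metis Diff_subset order.refl)
qed

section \<open>From spanning trees to minimal connectivity\<close>

lemma connected_imp_cut_connected:
  assumes "finite_multigraph G" "connected_graph G"
  shows "cut_connected (verts G) (ends G) (edges G)"
proof (rule cut_connectedI)
  fix X assume X: "X \<subset> verts G" "X \<noteq> {}"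
  then obtain x y where xy: "x \<in> X" "y \<in> verts G" "y \<notin> X" by auto
  then have "(x, y) \<in> (adjacency G)\<^sup>*" using assms X by (auto simp: connected_graph_def)
  then have "y \<in> X \<or> (\<exists>f\<in>edges G. ends G f \<inter> X \<noteq> {} \<and> ends G f \<inter> (verts G - X) \<noteq> {})"
  proof (induction rule: rtrancl_induct)
    case (step y z)
    then obtain f where f: "f \<in> edges G" "ends G f = {y, z}" by (auto simp: adjacency_def)
    then have "{y, z} \<subseteq> verts G" using assms(1) by (auto simp: finite_multigraph_def)
    then show ?case using f step.IH by auto
  qed (use xy in auto)
  then show "\<exists>f\<in>edges G. ends G f \<inter> X \<noteq> {} \<and> ends G f \<inter> (verts G - X) \<noteq> {}" using xy by auto
qed

lemma card_1_2_E:
  assumes "card A \<in> {1, 2}" "x \<in> A"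
  obtains y where "A = {x, y}"
proof -
  consider z where "A = {z}" | z z' where "A = {z, z'}"
    using assms(1) by (auto simp: card_1_singleton_iff card_2_iff)
  then show thesis using assms(2) that by cases (auto simp: insert_commute)
qed

text \<open>If the vertices reached from \<open>x\<close> by simple paths formed a proper subset, an
  edge crossing it would extend a path, or a prefix of the path would already end at the new vertex.
  Simplicity is what makes the path close up to a cycle later.\<close>

lemma cut_connected_path:
  assumes cc: "cut_connected V en T" and en: "\<And>f. f \<in> T \<Longrightarrow> en f \<subseteq> V \<and> card (en f) \<in> {1, 2}"
    and "x \<in> V" "y \<in> V"
  obtains p where "p \<noteq> []" "hd p = x" "last p = y" "distinct p" "set p \<subseteq> V"
    "successively (\<lambda>a b. \<exists>f\<in>T. en f = {a, b}) p"
proof -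
  let ?P = "\<lambda>z p. p \<noteq> [] \<and> hd p = x \<and> last p = z \<and> distinct p \<and> set p \<subseteq> V \<and>
    successively (\<lambda>a b. \<exists>f\<in>T. en f = {a, b}) p"
  define X where "X = {z \<in> V. \<exists>p. ?P z p}"
  have "?P x [x]" using assms by simp
  then have x: "x \<in> X" using assms X_def by blast
  have "X = V"
  proof (rule ccontr)
    assume "X \<noteq> V"
    then have "X \<subset> V" "X \<noteq> {}" using x by (auto simp: X_def)
    then obtain f where f: "f \<in> T" "en f \<inter> X \<noteq> {}" "en f \<inter> (V - X) \<noteq> {}"
      by (rule cut_connectedE[OF cc])
    from f(2,3) obtain a b where ab: "a \<in> en f" "a \<in> X" "b \<in> en f" "b \<in> V" "b \<notin> X" by blast
    then have "en f = {a, b}" using en[OF f(1)] by (elim conjE card_1_2_E[of "en f" a]) auto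
    obtain p where p: "?P a p" using ab by (auto simp: X_def)
    have "\<exists>q. ?P b q"
    proof (cases "b \<in> set p")
      case True
      then obtain q r where qr: "p = q @ b # r" by (meson split_list)
      have "?P b (q @ [b])" using p by (auto simp: qr hd_append successively_append_iff)
      then show ?thesis by blast
    next
      case False
      have "?P b (p @ [b])" using p False ab f(1) \<open>en f = {a, b}\<close> by (auto simp: successively_append_iff)
      then show ?thesis by blast
    qed
    then show False using ab by (auto simp: X_def)
  qed
  then show thesis using that assms by (auto simp: X_def)
qed

text \<open>If removing \<open>f\<close> left the vertices connected, a simple path between the ends
  of \<open>f\<close> would close with \<open>f\<close> to a cycle.\<close>

lemma spanning_tree_min_connected:
  assumes fin: "finite_multigraph G" and st: "spanning_tree G T"
  shows "min_connected (verts G) (ends G) T"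
proof -
  let ?H = "G\<lparr>edges := T\<rparr>"
  have T: "T \<subseteq> edges G" and conn: "connected_graph ?H" and acyc: "\<And>vs es. \<not> is_cycle ?H vs es"
    using st by (auto simp: spanning_tree_def is_tree_def)
  have finH: "finite_multigraph ?H" using fin T by (auto simp: finite_multigraph_def finite_subset)
  have en: "ends G f \<subseteq> verts G \<and> card (ends G f) \<in> {1, 2}" if "f \<in> T" for f
    using fin T that by (auto simp: finite_multigraph_def)
  have "\<not> cut_connected (verts G) (ends G) (T - {f})" if f: "f \<in> T" for f
  proof
    assume cc: "cut_connected (verts G) (ends G) (T - {f})"
    obtain x where "x \<in> ends G f" using en[OF f] by fastforce
    \<comment> \<open>Possibly \<open>y = x\<close>: for a loop the path is a single vertex and the
      cycle has length 1.\<close>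
    then obtain y where xy: "ends G f = {x, y}" using en[OF f] card_1_2_E by metis
    then have xyV: "x \<in> verts G" "y \<in> verts G" using en[OF f] by auto
    obtain p where p: "p \<noteq> []" "hd p = x" "last p = y" "distinct p" "set p \<subseteq> verts G"
      and suc: "successively (\<lambda>a b. \<exists>g\<in>T - {f}. ends G g = {a, b}) p"
      by (rule cut_connected_path[OF cc _ xyV]) (use en in auto)
    define k where "k = length p - 1"
    have k: "length p = Suc k" using p(1) by (simp add: k_def)
    have "\<exists>g. g \<in> T - {f} \<and> ends G g = {p ! i, p ! Suc i}" if "i < k" for i
      using suc that k by (auto simp: successively_conv_nth)
    then obtain g where g: "\<And>i. i < k \<Longrightarrow> g i \<in> T - {f} \<and> ends G (g i) = {p ! i, p ! Suc i}"
      by metis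
    have inj: "inj_on g {0..<k}"
    proof (rule inj_onI)
      fix i j assume ij: "i \<in> {0..<k}" "j \<in> {0..<k}" "g i = g j"
      then have "{p ! i, p ! Suc i} = {p ! j, p ! Suc j}" using g by (metis atLeastLessThan_iff)
      then show "i = j" using ij k p(4) by (auto simp: doubleton_eq_iff nth_eq_iff_index_eq)
    qed
    \<comment> \<open>\<open>f\<close> comes last and joins \<open>p ! k\<close> to
      \<open>p ! 0\<close>, the vertex at index \<open>Suc k mod length p\<close>.\<close>
    have "is_cycle ?H p (map g [0..<k] @ [f])"
      unfolding is_cycle_def
    proof (intro conjI allI impI)
      show "distinct (map g [0..<k] @ [f])" proof -
        have "f \<notin> g ` {0..<k}" using g by fastforce
        then show ?thesis using inj by (simp add: distinct_map)
      qed
      show "set (map g [0..<k] @ [f]) \<subseteq> edges ?H" using g f by auto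
      fix i assume "i < length (map g [0..<k] @ [f])"
      then consider "i < k" | "i = k" by force
      then show "ends ?H ((map g [0..<k] @ [f]) ! i) = {p ! i, p ! (Suc i mod length p)}"
      proof cases
        case 1
        then show ?thesis using g k by (simp add: nth_append)
      next
        case 2
        then show ?thesis using p k xy by (auto simp: nth_append hd_conv_nth last_conv_nth)
      qed
    qed (use p k in auto)
    then show False using acyc by blast
  qed
  then show ?thesis using connected_imp_cut_connected[OF finH conn] by (simp add: min_connected_def)
qed

lemma ends_doubleton:
  assumes "finite_multigraph G" "f \<in> edges G" "x \<in> ends G f" "y \<in> ends G f" "x \<noteq> y"
  shows "ends G f = {x, y}"
proof -
  have "card (ends G f) \<in> {1, 2}" using assms by (auto simp: finite_multigraph_def)
  then obtain z where "ends G f = {x, z}" using assms(3) by (rule card_1_2_E)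
  then show ?thesis using assms(4,5) by auto
qed

section \<open>Replacing a leaf\<close>

text \<open>Undoes a reduction: when two edges in parallel or in series were replaced by the single
  edge \<open>g\<close>, the leaf \<open>g\<close> is expanded into the network \<open>r\<close> of
  both.\<close>

primrec graft :: "'e \<Rightarrow> 'e sp \<Rightarrow> 'e sp \<Rightarrow> 'e sp" where
  "graft g r (Edge f) = (if f = g then r else Edge f)"
| "graft g r (Par s t) = Par (graft g r s) (graft g r t)"
| "graft g r (Ser s t) = Ser (graft g r s) (graft g r t)"

lemma graft_id: "g \<notin> leaves t \<Longrightarrow> graft g r t = t"
  by (induction t) auto

lemma leaves_graft:
  "distinct_leaves t \<Longrightarrow> g \<in> leaves t \<Longrightarrow> leaves (graft g r t) = leaves t - {g} \<union> leaves r"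
proof (induction t)
  case (Par s t)
  then show ?case by (cases "g \<in> leaves s") (auto simp: graft_id disjoint_iff)
next
  case (Ser s t)
  then show ?case by (cases "g \<in> leaves s") (auto simp: graft_id disjoint_iff)
qed auto

lemma distinct_leaves_graft:
  "distinct_leaves t \<Longrightarrow> g \<in> leaves t \<Longrightarrow> distinct_leaves r \<Longrightarrow> leaves r \<inter> (leaves t - {g}) = {} \<Longrightarrow>
    distinct_leaves (graft g r t)"
proof (induction t)
  case (Par s t)
  then show ?case by (cases "g \<in> leaves s") (auto simp: graft_id leaves_graft disjoint_iff)
next
  case (Ser s t)
  then show ?case by (cases "g \<in> leaves s") (auto simp: graft_id leaves_graft disjoint_iff)
qed auto

lemma join_graft_left:
  assumes "W \<in> join A B" "g \<notin> \<Union>B" "X = (if g \<in> W then X1 else X0)"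
    and "\<And>T. T \<in> A \<Longrightarrow> T - {g} \<union> (if g \<in> T then X1 else X0) \<in> A'"
  shows "W - {g} \<union> X \<in> join A' B"
proof -
  obtain T U where W: "W = T \<union> U" "T \<in> A" "U \<in> B" using assms(1) by (rule joinE)
  then have "g \<notin> U" using assms(2) by auto
  then have "W - {g} \<union> X = (T - {g} \<union> (if g \<in> T then X1 else X0)) \<union> U" using W assms(3) by auto
  then show ?thesis using assms(4)[OF W(2)] W(3) by (simp add: joinI)
qed

lemma join_commute: "join A B = join B A"
  unfolding join_def by (auto simp: Un_commute)

lemma join_graft_right:
  assumes "W \<in> join B A" "g \<notin> \<Union>B" "X = (if g \<in> W then X1 else X0)"
    and "\<And>T. T \<in> A \<Longrightarrow> T - {g} \<union> (if g \<in> T then X1 else X0) \<in> A'"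
  shows "W - {g} \<union> X \<in> join B A'"
  using join_graft_left[of W A B g X X1 X0 A'] assms by (simp add: join_commute)

text \<open>A leaf contained in a forest connects its two ends, an absent one leaves them apart;
  accordingly \<open>r\<close> contributes a tree or a cut.\<close>

lemma graft_cuts_trees:
  assumes X: "X1 \<in> trees r" "X0 \<in> cuts r"
  shows "distinct_leaves t \<Longrightarrow> g \<in> leaves t \<Longrightarrow>
    (T \<in> cuts t \<longrightarrow> T - {g} \<union> (if g \<in> T then X1 else X0) \<in> cuts (graft g r t)) \<and>
    (T \<in> trees t \<longrightarrow> T - {g} \<union> (if g \<in> T then X1 else X0) \<in> trees (graft g r t))"
proof (induction t arbitrary: T)
  case (Edge f)
  then show ?case using X by simp
next
  case (Par s t)
  show ?case
  proof (cases "g \<in> leaves s")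
    case True
    then have "g \<notin> leaves t" using Par.prems by auto
    then have g: "graft g r t = t" "g \<notin> \<Union>(cuts t)" "g \<notin> \<Union>(trees t)"
      by (auto simp: graft_id dest: cuts_subset trees_subset)
    show ?thesis using Par.IH(1)[OF _ True] Par.prems
      by (auto simp only: g(1) graft.simps cuts.simps trees.simps Un_iff distinct_leaves.simps
          intro: join_graft_left[OF _ g(2) HOL.refl] join_graft_left[OF _ g(3) HOL.refl])
  next
    case False
    then have True: "g \<in> leaves t" using Par.prems by auto
    have g: "graft g r s = s" "g \<notin> \<Union>(cuts s)" "g \<notin> \<Union>(trees s)"
      using False by (auto simp: graft_id dest: cuts_subset trees_subset)
    show ?thesis using Par.IH(2)[OF _ True] Par.prems
      by (auto simp only: g(1) graft.simps cuts.simps trees.simps Un_iff distinct_leaves.simps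
          intro: join_graft_right[OF _ g(2) HOL.refl] join_graft_right[OF _ g(3) HOL.refl])
  qed
next
  case (Ser s t)
  show ?case
  proof (cases "g \<in> leaves s")
    case True
    then have "g \<notin> leaves t" using Ser.prems by auto
    then have g: "graft g r t = t" "g \<notin> \<Union>(cuts t)" "g \<notin> \<Union>(trees t)"
      by (auto simp: graft_id dest: cuts_subset trees_subset)
    show ?thesis using Ser.IH(1)[OF _ True] Ser.prems
      by (auto simp only: g(1) graft.simps cuts.simps trees.simps Un_iff distinct_leaves.simps
          intro: join_graft_left[OF _ g(2) HOL.refl] join_graft_left[OF _ g(3) HOL.refl])
  next
    case False
    then have True: "g \<in> leaves t" using Ser.prems by auto
    have g: "graft g r s = s" "g \<notin> \<Union>(cuts s)" "g \<notin> \<Union>(trees s)"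
      using False by (auto simp: graft_id dest: cuts_subset trees_subset)
    show ?thesis using Ser.IH(2)[OF _ True] Ser.prems
      by (auto simp only: g(1) graft.simps cuts.simps trees.simps Un_iff distinct_leaves.simps
          intro: join_graft_right[OF _ g(2) HOL.refl] join_graft_right[OF _ g(3) HOL.refl])
  qed
qed

text \<open>The induction in \<open>graft_cuts_trees\<close> fixes one tree and one cut of
  \<open>r\<close>. Here \<open>X\<close> takes the slot that matches \<open>g \<in> T\<close>, and
  \<open>X1\<close> or \<open>X0\<close> takes the other.\<close>

lemma graft_mem:
  assumes "distinct_leaves t" "g \<in> leaves t" "if g \<in> T then X \<in> trees r else X \<in> cuts r"
    and "X1 \<in> trees r" "X0 \<in> cuts r"
  shows "T \<in> cuts t \<Longrightarrow> T - {g} \<union> X \<in> cuts (graft g r t)"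
    "T \<in> trees t \<Longrightarrow> T - {g} \<union> X \<in> trees (graft g r t)"
  using graft_cuts_trees[of "if g \<in> T then X else X1" r "if g \<in> T then X0 else X" t g T] assms
  by (auto split: if_splits)

section \<open>Minors\<close>

lemma has_minor_trans: "has_minor G H \<Longrightarrow> has_minor H K \<Longrightarrow> has_minor G K"
  by (rotate_tac, induction rule: has_minor.induct) (auto intro: has_minor.intros)

lemma finite_multigraph_delete_edge: "finite_multigraph G \<Longrightarrow> finite_multigraph (delete_edge G e)"
  by (auto simp: finite_multigraph_def delete_edge_def)

lemma finite_multigraph_delete_vertex: "finite_multigraph G \<Longrightarrow> finite_multigraph (delete_vertex G v)"
  by (auto simp: finite_multigraph_def delete_vertex_def)

lemma finite_multigraph_contract_edge:
  assumes G: "finite_multigraph G" and e: "e \<in> edges G" "ends G e = {u, v}" "u \<noteq> v"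
  shows "finite_multigraph (contract_edge G e u v)"
proof -
  have u: "u \<in> verts G" using G e by (auto simp: finite_multigraph_def)
  have "card ((\<lambda>w. if w = v then u else w) ` ends G f) \<in> {1, 2}" if "f \<in> edges G" for f
  proof -
    have c: "card (ends G f) \<in> {1, 2}" using G that by (auto simp: finite_multigraph_def)
    then have fin: "finite (ends G f)" "ends G f \<noteq> {}" using card.infinite by fastforce+
    have "card ((\<lambda>w. if w = v then u else w) ` ends G f) \<le> card (ends G f)"
      by (rule card_image_le[OF fin(1)])
    moreover have "card ((\<lambda>w. if w = v then u else w) ` ends G f) > 0"
      using fin by (subst card_gt_0_iff) auto
    ultimately show ?thesis using c by auto
  qed
  then show ?thesis using G u e(3) unfolding finite_multigraph_def contract_edge_def by auto
qed

lemma finite_multigraph_minor: "has_minor G H \<Longrightarrow> finite_multigraph G \<Longrightarrow> finite_multigraph H"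
  by (induction rule: has_minor.induct)
    (auto intro: finite_multigraph_delete_edge finite_multigraph_delete_vertex finite_multigraph_contract_edge)

lemma series_parallel_minor: "series_parallel G \<Longrightarrow> has_minor G H \<Longrightarrow> series_parallel H"
  unfolding series_parallel_def by (blast intro: has_minor_trans finite_multigraph_minor)

lemma has_minor_delete_edges:
  assumes "finite F" "F \<subseteq> edges G"
  shows "has_minor G (G\<lparr>edges := edges G - F\<rparr>)"
  using assms
proof (induction F rule: finite_induct)
  case empty
  then show ?case by (simp add: has_minor.refl)
next
  case (insert f F)
  let ?H = "G\<lparr>edges := edges G - F\<rparr>"
  have "has_minor G (delete_edge ?H f)" using insert by (intro has_minor.del_edge) auto
  moreover have "delete_edge ?H f = G\<lparr>edges := edges G - insert f F\<rparr>"
    by (rule multigraph.equality) (auto simp: delete_edge_def)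
  ultimately show ?case by simp
qed

lemma has_minor_delete_verts:
  assumes "finite W" "W \<subseteq> verts G"
  shows "has_minor G (G\<lparr>verts := verts G - W, edges := {f \<in> edges G. ends G f \<inter> W = {}}\<rparr>)"
  using assms
proof (induction W rule: finite_induct)
  case empty
  then show ?case by (simp add: has_minor.refl)
next
  case (insert w W)
  let ?H = "\<lambda>W. G\<lparr>verts := verts G - W, edges := {f \<in> edges G. ends G f \<inter> W = {}}\<rparr>"
  have "has_minor G (delete_vertex (?H W) w)" using insert by (intro has_minor.del_vertex) auto
  moreover have "delete_vertex (?H W) w = ?H (insert w W)"
    by (rule multigraph.equality) (auto simp: delete_vertex_def)
  ultimately show ?case by simp
qed

text \<open>The sets \<open>Br i\<close> are the branch sets of a \<open>K\<^sub>4\<close> minor.\<close>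

definition K4_model :: "('v, 'e) multigraph \<Rightarrow> (nat \<Rightarrow> 'v set) \<Rightarrow> bool" where
  "K4_model G Br \<longleftrightarrow>
     (\<forall>i<4. Br i \<subseteq> verts G \<and> Br i \<noteq> {} \<and> cut_connected (Br i) (ends G) (edges G)) \<and>
     (\<forall>i<4. \<forall>j<4. i \<noteq> j \<longrightarrow> Br i \<inter> Br j = {} \<and>
        (\<exists>f\<in>edges G. ends G f \<inter> Br i \<noteq> {} \<and> ends G f \<inter> Br j \<noteq> {}))"

text \<open>Select one edge for each pair of the four vertices, then delete all other vertices and
  all unselected edges.\<close>

lemma K4_model_singletons:
  assumes G: "finite_multigraph G" and m: "K4_model G (\<lambda>i. {r i})"
  shows "\<exists>H. has_minor G H \<and> graph_iso H K4"
proof -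
  have rV: "r i \<in> verts G" if "i < 4" for i using m that by (auto simp: K4_model_def)
  have inj: "inj_on r {..<4}" using m by (auto simp: K4_model_def inj_on_def)
  have "\<exists>f\<in>edges G. ends G f = r ` X" if X: "X \<in> edges K4" for X
  proof -
    obtain i j where ij: "X = {i, j}" "i \<noteq> j" "i < 4" "j < 4"
      using X by (auto simp: K4_def card_2_iff)
    then have "\<exists>f\<in>edges G. ends G f \<inter> {r i} \<noteq> {} \<and> ends G f \<inter> {r j} \<noteq> {}"
      using m[unfolded K4_model_def, THEN conjunct2] by blast
    then obtain f where f: "f \<in> edges G" "r i \<in> ends G f" "r j \<in> ends G f" by auto
    have "r i \<noteq> r j" using inj ij by (auto simp: inj_on_def)
    then have "ends G f = {r i, r j}" by (rule ends_doubleton[OF G f])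
    then show ?thesis using f ij(1) by auto
  qed
  then obtain \<eta> where \<eta>: "\<And>X. X \<in> edges K4 \<Longrightarrow> \<eta> X \<in> edges G \<and> ends G (\<eta> X) = r ` X" by metis
  let ?W = "verts G - r ` {..<4}"
  define H1 where "H1 = G\<lparr>verts := verts G - ?W, edges := {f \<in> edges G. ends G f \<inter> ?W = {}}\<rparr>"
  define H where "H = H1\<lparr>edges := edges H1 - (edges H1 - \<eta> ` edges K4)\<rparr>"
  have "has_minor G H1" unfolding H1_def
    using G by (intro has_minor_delete_verts) (auto simp: finite_multigraph_def)
  moreover have "has_minor H1 H" unfolding H_def
    using G by (intro has_minor_delete_edges) (auto simp: H1_def finite_multigraph_def)
  ultimately have GH: "has_minor G H" by (rule has_minor_trans)
  have "r ` X \<inter> ?W = {}" if "X \<in> edges K4" for X using that by (auto simp: K4_def)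
  then have "\<eta> X \<in> edges H1" if "X \<in> edges K4" for X using \<eta>[OF that] that by (simp add: H1_def)
  then have "\<eta> ` edges K4 \<subseteq> edges H1" by blast
  then have edH: "edges H = \<eta> ` edges K4" by (auto simp: H_def)
  have vH: "verts H = r ` {..<4}" using rV by (auto simp: H_def H1_def)
  have enH: "ends H = ends G" by (simp add: H_def H1_def)
  define f where "f = inv_into {..<4} r"
  have f: "bij_betw f (verts H) {..<4}"
    unfolding vH f_def using inj by (intro bij_betw_inv_into) (auto simp: bij_betw_def)
  have fr: "f ` r ` X = X" if "X \<in> edges K4" for X
    using that inj by (force simp: f_def K4_def image_image)
  have "bij_betw (\<lambda>e. f ` ends H e) (edges H) (edges K4)"
    unfolding edH by (rule bij_betw_byWitness[of _ \<eta>]) (auto simp: enH \<eta> fr)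
  moreover have "\<forall>e\<in>edges H. ends K4 (f ` ends H e) = f ` ends H e" by (simp add: K4_def)
  moreover have "verts K4 = {..<4}" by (simp add: K4_def)
  ultimately show ?thesis using GH f unfolding graph_iso_def by metis
qed

text \<open>Merging \<open>q\<close> into \<open>p\<close> moves no vertex out of its branch set,
  and the other branch sets contain neither of them. The contracted edge lies inside one branch set,
  so no edge joining two of them is lost.\<close>

lemma K4_model_contract:
  assumes G: "finite_multigraph G" and m: "K4_model G Br" and i: "i < 4"
    and f: "f \<in> edges G" "ends G f = {p, q}" "p \<noteq> q" "p \<in> Br i" "q \<in> Br i"
  shows "K4_model (contract_edge G f p q) (Br(i := Br i - {q}))"
proof -
  let ?H = "contract_edge G f p q" and ?B = "Br(i := Br i - {q})"
  let ?r = "\<lambda>x. if x = q then p else x"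
  have sub: "\<And>j. j < 4 \<Longrightarrow> Br j \<subseteq> verts G" and ne: "\<And>j. j < 4 \<Longrightarrow> Br j \<noteq> {}"
    and cc: "\<And>j. j < 4 \<Longrightarrow> cut_connected (Br j) (ends G) (edges G)"
    and dj: "\<And>j k. j < 4 \<Longrightarrow> k < 4 \<Longrightarrow> j \<noteq> k \<Longrightarrow> Br j \<inter> Br k = {}"
    and adj: "\<And>j k. j < 4 \<Longrightarrow> k < 4 \<Longrightarrow> j \<noteq> k \<Longrightarrow> \<exists>f\<in>edges G. ends G f \<inter> Br j \<noteq> {} \<and> ends G f \<inter> Br k \<noteq> {}"
    using m by (auto simp: K4_model_def)
  have out: "p \<notin> Br j" "q \<notin> Br j" if "j < 4" "j \<noteq> i" for j
    using dj[OF i that(1)] that f by auto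
  have moved: "?r x \<in> ?B j" if "j < 4" "x \<in> Br j" for j x
    using that out f by (auto split: if_splits)
  have "?B j \<subseteq> verts ?H \<and> ?B j \<noteq> {} \<and> cut_connected (?B j) (ends ?H) (edges ?H)" if j: "j < 4" for j
  proof (cases "j = i")
    case True
    have "cut_connected (Br i - {q}) (ends ?H) (edges ?H)"
      using cut_connected_contract[OF cc[OF i], of f p q] f by (simp add: contract_edge_def)
    then show ?thesis using True sub[OF i] f by (auto simp: contract_edge_def)
  next
    case False
    have "cut_connected (Br j) (ends ?H) (edges ?H)"
    proof (rule cut_connectedI)
      fix X assume X: "X \<subset> Br j" "X \<noteq> {}"
      then obtain g where g: "g \<in> edges G" "ends G g \<inter> X \<noteq> {}" "ends G g \<inter> (Br j - X) \<noteq> {}"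
        by (rule cut_connectedE[OF cc[OF j]])
      then obtain x y where xy: "x \<in> ends G g" "x \<in> X" "y \<in> ends G g" "y \<in> Br j - X" by auto
      then have "?r x = x" "?r y = y" using out[OF j False] X by auto
      then have "x \<in> ends ?H g" "y \<in> ends ?H g" using xy unfolding contract_edge_def by (auto intro: rev_image_eqI)
      moreover have "g \<noteq> f" using xy f out[OF j False] X by auto
      ultimately show "\<exists>g\<in>edges ?H. ends ?H g \<inter> X \<noteq> {} \<and> ends ?H g \<inter> (Br j - X) \<noteq> {}"
        using xy g(1) by (intro bexI[of _ g]) (auto simp: contract_edge_def)
    qed
    then show ?thesis using False sub[OF j] ne[OF j] out[OF j False] by (auto simp: contract_edge_def)
  qed
  moreover have "?B j \<inter> ?B k = {} \<and> (\<exists>g\<in>edges ?H. ends ?H g \<inter> ?B j \<noteq> {} \<and> ends ?H g \<inter> ?B k \<noteq> {})"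
    if jk: "j < 4" "k < 4" "j \<noteq> k" for j k
  proof
    show "?B j \<inter> ?B k = {}" using dj[OF jk] by auto
    obtain g where g: "g \<in> edges G" "ends G g \<inter> Br j \<noteq> {}" "ends G g \<inter> Br k \<noteq> {}" using adj[OF jk] by auto
    then obtain x y where xy: "x \<in> ends G g" "x \<in> Br j" "y \<in> ends G g" "y \<in> Br k" by auto
    have "g \<noteq> f"
    proof
      assume "g = f"
      then have "x \<in> Br i" "y \<in> Br i" using xy f by auto
      then show False using dj[OF jk(1) i] dj[OF jk(2) i] xy jk by auto
    qed
    moreover have "?r x \<in> ends ?H g" "?r y \<in> ends ?H g" using xy by (auto simp: contract_edge_def)
    ultimately show "\<exists>g\<in>edges ?H. ends ?H g \<inter> ?B j \<noteq> {} \<and> ends ?H g \<inter> ?B k \<noteq> {}"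
      using moved[OF jk(1) xy(2)] moved[OF jk(2) xy(4)] g(1)
      by (intro bexI[of _ g]) (blast, simp add: contract_edge_def)
  qed
  ultimately show ?thesis unfolding K4_model_def by blast
qed

text \<open>Edges inside branch sets are contracted, each time losing a vertex, until all branch
  sets are single vertices.\<close>

lemma K4_model_imp_minor:
  "finite_multigraph G \<Longrightarrow> K4_model G Br \<Longrightarrow> \<exists>H. has_minor G H \<and> graph_iso H K4"
proof (induction "card (verts G)" arbitrary: G Br rule: less_induct)
  case less
  have ne: "\<And>j. j < 4 \<Longrightarrow> Br j \<noteq> {}" using less.prems by (auto simp: K4_model_def)
  show ?case
  proof (cases "\<exists>i<4. \<exists>p\<in>Br i. Br i \<noteq> {p}")
    case True
    then obtain i p where ip: "i < 4" "p \<in> Br i" "Br i \<noteq> {p}" by auto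
    have cc: "cut_connected (Br i) (ends G) (edges G)" and sub: "Br i \<subseteq> verts G"
      using ip less.prems by (auto simp: K4_model_def)
    have "{p} \<subset> Br i" using ip by auto
    then obtain f where f: "f \<in> edges G" "ends G f \<inter> {p} \<noteq> {}" "ends G f \<inter> (Br i - {p}) \<noteq> {}"
      by (rule cut_connectedE[OF cc]) auto
    then obtain q where q: "p \<in> ends G f" "q \<in> ends G f" "q \<in> Br i" "p \<noteq> q" by auto
    have "ends G f = {p, q}"
      by (rule ends_doubleton[OF less.prems(1) f(1) q(1,2,4)])
    let ?H = "contract_edge G f p q"
    have "card (verts ?H) < card (verts G)"
      unfolding contract_edge_def multigraph.simps
      using sub q(3) less.prems(1) by (intro card_Diff1_less) (auto simp: finite_multigraph_def)
    moreover have "finite_multigraph ?H"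
      by (rule finite_multigraph_contract_edge) (use less.prems(1) f(1) \<open>ends G f = {p, q}\<close> q in auto)
    moreover have "K4_model ?H (Br(i := Br i - {q}))"
      by (rule K4_model_contract) (use less.prems ip f(1) \<open>ends G f = {p, q}\<close> q in auto)
    ultimately have "\<exists>K. has_minor ?H K \<and> graph_iso K K4" by (rule less.hyps)
    moreover have "has_minor G ?H"
      by (rule has_minor.contract) (use f(1) \<open>ends G f = {p, q}\<close> q has_minor.refl in auto)
    ultimately show ?thesis using has_minor_trans by metis
  next
    case False
    define r where "r i = (SOME p. p \<in> Br i)" for i
    have "Br i = {r i}" if "i < 4" for i
      using False that someI_ex[of "\<lambda>p. p \<in> Br i"] ne[OF that] unfolding r_def by blast
    then have "K4_model G (\<lambda>i. {r i})" using less.prems(2) by (simp add: K4_model_def)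
    then show ?thesis by (rule K4_model_singletons[OF less.prems(1)])
  qed
qed

section \<open>Paths and minimum degree\<close>

definition nbrs :: "('v, 'e) multigraph \<Rightarrow> 'v \<Rightarrow> 'v set" where
  "nbrs G x = {y. y \<noteq> x \<and> (\<exists>f\<in>edges G. ends G f = {x, y})}"

lemma nbrs_sym: "y \<in> nbrs G x \<longleftrightarrow> x \<in> nbrs G y"
  by (auto simp: nbrs_def insert_commute)

lemma nbrs_subset: "finite_multigraph G \<Longrightarrow> nbrs G x \<subseteq> verts G"
  by (auto simp: nbrs_def finite_multigraph_def)

lemma nbrs_crossing:
  assumes "y \<in> nbrs G x" "x \<in> A" "y \<in> B"
  shows "\<exists>f\<in>edges G. ends G f \<inter> A \<noteq> {} \<and> ends G f \<inter> B \<noteq> {}"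
  using assms by (fastforce simp: nbrs_def)

abbreviation walk :: "('v, 'e) multigraph \<Rightarrow> 'v list \<Rightarrow> bool" where
  "walk G \<equiv> successively (\<lambda>x y. y \<in> nbrs G x)"

lemma walk_rev [simp]: "walk G (rev p) = walk G p"
  by (simp add: successively_rev nbrs_sym[of _ G])

lemma walk_cut_connected: "walk G p \<Longrightarrow> cut_connected (set p) (ends G) (edges G)"
proof (induction p)
  case Nil
  then show ?case by (simp add: cut_connected_def)
next
  case (Cons x p)
  show ?case
  proof (cases p)
    case Nil
    then show ?thesis by (auto simp: cut_connected_def)
  next
    case (Cons y q)
    have cc: "cut_connected (set p) (ends G) (edges G)" and y: "y \<in> nbrs G x" "y \<in> set p"
      using Cons.IH Cons.prems Cons by (auto simp: successively_Cons)
    show ?thesis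
    proof (rule cut_connectedI)
      fix X assume X: "X \<subset> set (x # p)" "X \<noteq> {}"
      let ?C = "\<exists>f\<in>edges G. ends G f \<inter> X \<noteq> {} \<and> ends G f \<inter> (set (x # p) - X) \<noteq> {}"
      have x: "x \<in> nbrs G y" using y nbrs_sym by metis
      show ?C
      proof (cases "x \<in> X \<longleftrightarrow> y \<in> X")
        case False
        then show ?thesis
        proof (cases "x \<in> X")
          case True
          then show ?thesis using nbrs_crossing[OF y(1), of X "set (x # p) - X"] False y(2) by auto
        next
          case xX: False
          then show ?thesis using nbrs_crossing[OF x, of X "set (x # p) - X"] False by auto
        qed
      next
        case True
        have "X \<inter> set p \<subset> set p" "X \<inter> set p \<noteq> {}" using X True y(2) by auto
        then obtain f where "f \<in> edges G" "ends G f \<inter> (X \<inter> set p) \<noteq> {}" "ends G f \<inter> (set p - X \<inter> set p) \<noteq> {}"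
          by (rule cut_connectedE[OF cc])
        then show ?thesis by (intro bexI[of _ f]) auto
      qed
    qed
  qed
qed

text \<open>The branch sets are segments of a path. Three adjacencies run along the path; the other
  three are the chords from \<open>x\<close> to \<open>y\<close>, from \<open>x\<close> to
  \<open>a\<close> and from \<open>hd B\<close> to \<open>c\<close>.\<close>

lemma path_K4_model:
  assumes p: "walk G (A @ y # B @ [x])" "distinct (A @ y # B @ [x])" "set (A @ y # B @ [x]) \<subseteq> verts G"
    and xy: "y \<in> nbrs G x" and a: "a \<in> set A" "a \<in> nbrs G x"
    and B: "B \<noteq> []" and c: "c \<in> set A" "c \<in> nbrs G (hd B)"
  shows "K4_model G (\<lambda>i. if i = 0 then set A else if i = 1 then {y} else if i = 2 then set B else {x})"
    (is "K4_model G ?Br")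
proof -
  have four: "(\<forall>i<4::nat. P i) \<longleftrightarrow> P 0 \<and> P 1 \<and> P 2 \<and> P 3" for P
    by (auto simp: eval_nat_numeral less_Suc_eq)
  have A: "A \<noteq> []" using a by auto
  have w: "walk G A" "walk G B" "y \<in> nbrs G (last A)" "hd B \<in> nbrs G y" "x \<in> nbrs G (last B)"
    using p(1) A B by (auto simp: successively_append_iff successively_Cons)
  define adj where "adj P Q \<longleftrightarrow> (\<exists>f\<in>edges G. ends G f \<inter> P \<noteq> {} \<and> ends G f \<inter> Q \<noteq> {})" for P Q
  have adj_sym: "adj P Q \<Longrightarrow> adj Q P" for P Q by (auto simp: adj_def)
  have "adj (set A) {y}" using nbrs_crossing[OF w(3), of "set A" "{y}"] A by (simp add: adj_def)
  moreover have "adj (set B) (set A)" using nbrs_crossing[OF c(2), of "set B" "set A"] B c(1) by (simp add: adj_def)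
  moreover have "adj {x} (set A)" using nbrs_crossing[OF a(2), of "{x}" "set A"] a(1) by (simp add: adj_def)
  moreover have "adj {y} (set B)" using nbrs_crossing[OF w(4), of "{y}" "set B"] B by (simp add: adj_def)
  moreover have "adj {x} {y}" using nbrs_crossing[OF xy, of "{x}" "{y}"] by (simp add: adj_def)
  moreover have "adj (set B) {x}" using nbrs_crossing[OF w(5), of "set B" "{x}"] B by (simp add: adj_def)
  ultimately have "\<forall>i<4. \<forall>j<4. i \<noteq> j \<longrightarrow> adj (?Br i) (?Br j)"
    using adj_sym by (simp add: four)
  moreover have "\<forall>i<4. \<forall>j<4. i \<noteq> j \<longrightarrow> ?Br i \<inter> ?Br j = {}"
    using p(2) by (auto simp: four)
  moreover have "\<forall>i<4. ?Br i \<subseteq> verts G \<and> ?Br i \<noteq> {} \<and> cut_connected (?Br i) (ends G) (edges G)"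
    using p(3) A B walk_cut_connected[OF w(1)] walk_cut_connected[OF w(2)] walk_cut_connected[of G "[x]"]
      walk_cut_connected[of G "[y]"] by (auto simp: four)
  ultimately show ?thesis unfolding K4_model_def adj_def by blast
qed

text \<open>\<open>a\<close> and \<open>y\<close> are chosen as the first two members of
  \<open>N\<close> on the list; a third one lies in \<open>B\<close>.\<close>

lemma three_members_split:
  assumes "3 \<le> card (set p \<inter> N)"
  obtains A y B a where "p = A @ y # B" "y \<in> N" "a \<in> set A" "a \<in> N" "B \<noteq> []"
proof -
  have "set p \<inter> N \<noteq> {}" using assms by auto
  then obtain A0 a R where p: "p = A0 @ a # R" "a \<in> N" "\<forall>z\<in>set A0. z \<notin> N"
    using split_list_first_prop[of p "\<lambda>z. z \<in> N"] by auto
  have "set p \<inter> N \<subseteq> insert a (set R \<inter> N)" using p by auto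
  then have "card (set p \<inter> N) \<le> Suc (card (set R \<inter> N))"
    using card_mono[of "insert a (set R \<inter> N)"] card_insert_le_m1 by (metis List.finite_set card_insert_if finite_Int finite_insert le_SucI)
  then have R: "2 \<le> card (set R \<inter> N)" using assms by simp
  then have "set R \<inter> N \<noteq> {}" by auto
  then obtain R1 y B where R1: "R = R1 @ y # B" "y \<in> N" "\<forall>z\<in>set R1. z \<notin> N"
    using split_list_first_prop[of R "\<lambda>z. z \<in> N"] by auto
  have "B \<noteq> []"
  proof
    assume "B = []"
    then have "set R \<inter> N \<subseteq> {y}" using R1 by auto
    then have "card (set R \<inter> N) \<le> 1" using card_mono[of "{y}"] by fastforce
    then show False using R by simp
  qed
  then show thesis using that[of "A0 @ a # R1" y B a] p R1 by auto
qed

text \<open>Among the longest paths that start with the edge \<open>uv\<close> and whose end \<open>x\<close> has two earlier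
  neighbours \<open>a\<close>, \<open>y\<close>, take one with \<open>y\<close> as late as possible. Rotating it at \<open>y\<close> gives another
  longest path, ending at the successor \<open>h\<close> of \<open>y\<close>. A third neighbour of \<open>h\<close> after \<open>y\<close> would contradict
  the choice of \<open>y\<close>, and one before \<open>y\<close> yields a \<open>K\<^sub>4\<close> minor.\<close>

lemma min_degree_K4_model:
  assumes G: "finite_multigraph G" and uv: "u \<in> verts G" "v \<in> nbrs G u" and w: "w \<in> nbrs G v" "w \<noteq> u"
    and deg: "\<And>x. x \<in> verts G - {u, v} \<Longrightarrow> 3 \<le> card (nbrs G x)"
  shows "\<exists>Br. K4_model G Br"
proof -
  define path where "path p \<longleftrightarrow> walk G p \<and> distinct p \<and> set p \<subseteq> verts G \<and> (\<exists>q. q \<noteq> [] \<and> p = u # v # q)" for p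
  have finV: "finite (verts G)" using G by (simp add: finite_multigraph_def)
  have len: "length p \<le> card (verts G)" if "path p" for p
    using that card_mono[OF finV] distinct_card by (metis path_def)
  \<comment> \<open>A path in this sense has at least three vertices, so that its end is neither
    \<open>u\<close> nor \<open>v\<close> and satisfies the degree condition. The vertex
    \<open>w\<close> guarantees that one exists.\<close>
  have "path [u, v, w]"
    using uv w nbrs_subset[OF G] by (auto simp: path_def nbrs_def)
  then obtain p0 where p0: "path p0" and longest: "\<And>p. path p \<Longrightarrow> length p \<le> length p0"
    using ex_has_greatest_nat[of path "[u, v, w]" length "card (verts G) + 1"] len by fastforce
  define m where "m = length p0"
  have closed: "nbrs G x \<subseteq> set p" if "path (p @ [x])" "length (p @ [x]) = m" for p x
  proof
    fix z assume z: "z \<in> nbrs G x"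
    show "z \<in> set p"
    proof (rule ccontr)
      assume "z \<notin> set p"
      then have "path (p @ [x] @ [z])"
        using that(1) z nbrs_subset[OF G] unfolding path_def
        by (auto simp: successively_append_iff nbrs_def Cons_eq_append_conv append_eq_Cons_conv)
      then show False using longest[of "p @ [x] @ [z]"] that(2) by (simp add: m_def)
    qed
  qed
  define good where "good A \<longleftrightarrow> (\<exists>y B x a. path (A @ y # B @ [x]) \<and> length (A @ y # B @ [x]) = m \<and>
    y \<in> nbrs G x \<and> a \<in> set A \<and> a \<in> nbrs G x \<and> B \<noteq> [])" for A
  \<comment> \<open>The path starts with \<open>u\<close> and \<open>v\<close>, and both are used up
    by the at least two entries of \<open>A @ [y]\<close>.\<close>
  have tail: "z \<in> verts G - {u, v}" if "path (A @ y # C)" "A \<noteq> []" "z \<in> set C" for A y C z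
    using that by (auto simp: path_def Cons_eq_append_conv append_eq_Cons_conv)
  have "\<exists>A. good A"
  proof -
    obtain q where q: "p0 = u # v # q" "q \<noteq> []" using p0 by (auto simp: path_def)
    define p x where "p = u # v # butlast q" and "x = last q"
    have px: "p0 = p @ [x]" using q by (simp add: p_def x_def)
    have "3 \<le> card (nbrs G x)"
      by (rule deg, rule tail[of "[u]" v q]) (use p0 q in \<open>auto simp: x_def\<close>)
    moreover have "nbrs G x \<subseteq> set p" using closed[of p x] p0 by (simp add: px m_def)
    ultimately have "3 \<le> card (set p \<inter> nbrs G x)" by (simp add: Int_absorb1)
    then obtain A y B a where *: "p = A @ y # B" "y \<in> nbrs G x" "a \<in> set A" "a \<in> nbrs G x" "B \<noteq> []"
      by (rule three_members_split)
    have "p0 = A @ y # B @ [x]" using px *(1) by simp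
    then have "good A" unfolding good_def m_def using p0 * by metis
    then show ?thesis by blast
  qed
  moreover have "length A \<le> m" if "good A" for A using that by (auto simp: good_def)
  ultimately obtain A where A: "good A" and A_max: "\<And>A'. good A' \<Longrightarrow> length A' \<le> length A"
    using ex_has_greatest_nat[of good _ length "m + 1"] by (metis le_imp_less_Suc Suc_eq_plus1)
  then obtain y B x a where p: "path (A @ y # B @ [x])" "length (A @ y # B @ [x]) = m"
    and y: "y \<in> nbrs G x" and a: "a \<in> set A" "a \<in> nbrs G x" and B: "B \<noteq> []"
    unfolding good_def by blast
  obtain h B' where hB: "B = h # B'" using B by (cases B) auto
  define C where "C = B' @ [x]"
  have "C \<noteq> []" by (simp add: C_def)
  then obtain g R where gR: "C = g # R" by (cases C) auto
  have pC: "A @ y # B @ [x] = A @ y # h # C" by (simp add: hB C_def)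
  have An: "A \<noteq> []" using a by auto
  have walk: "walk G (A @ [y])" "walk G C" "g \<in> nbrs G h" "h \<in> nbrs G y" and dist: "distinct (A @ y # h # C)"
    using p(1) unfolding pC path_def by (auto simp: successively_append_iff successively_Cons gR)
  have lastC: "last C = x" by (simp add: C_def)
  have rot: "path (A @ y # rev C @ [h])"
  proof -
    have "walk G (h # C)" using walk(2,3) by (simp add: gR)
    then have "walk G (rev (h # C))" by (simp only: walk_rev)
    moreover have "hd (rev (h # C)) = x" by (simp add: hd_rev lastC \<open>C \<noteq> []\<close>)
    moreover have "x \<in> nbrs G y" using y nbrs_sym by metis
    ultimately have "walk G ((A @ [y]) @ rev (h # C))"
      using walk(1) by (subst successively_append_iff) simp
    then have "walk G (A @ y # rev C @ [h])" by simp
    moreover have "\<exists>q. q \<noteq> [] \<and> A @ y # rev C @ [h] = u # v # q"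
    proof -
      obtain q where "A @ y # h # C = u # v # q" using p(1) unfolding pC path_def by blast
      then show ?thesis using An by (cases A; cases "tl A") auto
    qed
    moreover have "set (A @ y # rev C @ [h]) \<subseteq> verts G" using p(1) unfolding pC path_def by auto
    ultimately show ?thesis using dist by (auto simp: path_def)
  qed
  have hV: "h \<in> verts G - {u, v}" using tail[OF rot An] by simp
  have "length (A @ y # rev C @ [h]) = m" using p(2) unfolding pC by simp
  then have hN: "nbrs G h \<subseteq> set (A @ y # rev C)" using closed[of "A @ y # rev C" h] rot by simp
  have "\<not> nbrs G h \<subseteq> {y, g}"
  proof
    assume "nbrs G h \<subseteq> {y, g}"
    then have "card (nbrs G h) \<le> card {y, g}" by (intro card_mono) auto
    also have "\<dots> \<le> 2" by (simp add: card_insert_if)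
    finally show False using deg[OF hV] by simp
  qed
  then obtain c where c: "c \<in> nbrs G h" "c \<noteq> y" "c \<noteq> g" by auto
  have "c \<notin> set R"
  proof
    assume "c \<in> set R"
    then obtain R1 R2 where R: "R = R1 @ c # R2" by (meson split_list)
    \<comment> \<open>On the rotated path \<open>h\<close> is the end, \<open>c\<close> takes the
      role of \<open>y\<close>, and \<open>y\<close> that of \<open>a\<close>. The segment between
      \<open>c\<close> and \<open>h\<close> contains \<open>g\<close>, and the part before
      \<open>c\<close> is longer than \<open>A\<close>.\<close>
    have "A @ y # rev C @ [h] = (A @ y # rev R2) @ c # (rev R1 @ [g]) @ [h]" by (simp add: gR R)
    moreover have "y \<in> nbrs G h" using walk(4) nbrs_sym by metis
    ultimately have "good (A @ y # rev R2)"
      unfolding good_def using rot \<open>length (A @ y # rev C @ [h]) = m\<close> c(1)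
      by (intro exI[of _ c] exI[of _ "rev R1 @ [g]"] exI[of _ h] exI[of _ y]) auto
    from A_max[OF this] show False by simp
  qed
  then have "c \<in> set A" using c hN by (auto simp: gR)
  then show ?thesis
    using path_K4_model[of G A y B x a c] p(1) y a B c(1) by (auto simp: path_def hB)
qed

section \<open>Decomposing series-parallel graphs\<close>

abbreviation min_conn :: "('v, 'e) multigraph \<Rightarrow> 'e set \<Rightarrow> bool" where
  "min_conn G \<equiv> min_connected (verts G) (ends G)"

text \<open>Two implications suffice: a larger \<open>Y(G,e)\<close> only makes the theorem stronger.\<close>

definition decomposes :: "'e sp \<Rightarrow> ('v, 'e) multigraph \<Rightarrow> 'e \<Rightarrow> bool" where
  "decomposes t G e \<longleftrightarrow> distinct_leaves t \<and> leaves t = edges G - {e} \<and>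
     (\<forall>T\<subseteq>edges G - {e}. (min_conn G (insert e T) \<longrightarrow> T \<in> cuts t) \<and> (min_conn G T \<longrightarrow> T \<in> trees t))"

section \<open>Undoing single reductions\<close>

text \<open>\<open>f\<close> is the edge lost in the reduction from \<open>G\<close> to
  \<open>H\<close>, and \<open>g\<close> stands for both edges in \<open>H\<close>. By
  \<open>step\<close>, each minimally connected set of \<open>G\<close> arises from one of
  \<open>H\<close> by expanding \<open>g\<close>, present or absent, into a tree or cut of
  \<open>r\<close>; since \<open>e\<close> is kept, cuts come from cuts and trees from
  trees.\<close>

lemma decomposes_graft:
  assumes t: "decomposes t H e" and e: "e \<in> edges G" and E: "edges G = insert f (edges H)" "f \<notin> edges H" "g \<in> edges H" "g \<noteq> e" "f \<noteq> e"
    and r: "distinct_leaves r" "leaves r = {f, g}" "{} \<in> cuts r \<or> {f} \<in> cuts r"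
    and step: "\<And>U. U \<subseteq> edges G \<Longrightarrow> min_conn G U \<Longrightarrow> \<exists>U' X. U' \<subseteq> edges H \<and> min_conn H U' \<and> (e \<in> U' \<longleftrightarrow> e \<in> U) \<and>
      U = U' - {g} \<union> X \<and> (if g \<in> U' then X \<in> trees r else X \<in> cuts r)"
  shows "decomposes (graft g r t) G e"
proof -
  have dl: "distinct_leaves t" and lv: "leaves t = edges H - {e}"
    and mem: "\<And>T. T \<subseteq> edges H - {e} \<Longrightarrow> min_conn H (insert e T) \<Longrightarrow> T \<in> cuts t"
      "\<And>T. T \<subseteq> edges H - {e} \<Longrightarrow> min_conn H T \<Longrightarrow> T \<in> trees t"
    using t by (auto simp: decomposes_def)
  have g: "g \<in> leaves t" using lv E by auto
  obtain X0 where X0: "X0 \<in> cuts r" using r(3) by auto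
  obtain X1 where X1: "X1 \<in> trees r" using cuts_extend[OF r(1) X0] by auto
  note graft = graft_mem[OF dl g _ X1 X0]
  have e_notin: "e \<notin> X" if "if P then X \<in> trees r else X \<in> cuts r" for P X
    using that cuts_subset[of X r] trees_subset[of X r] r(2) E by (auto split: if_splits)
  have "T \<in> cuts (graft g r t)" if T: "T \<subseteq> edges G - {e}" "min_conn G (insert e T)" for T
  proof -
    obtain U' X where U': "min_conn H U'" "U' \<subseteq> edges H" "e \<in> U'" "insert e T = U' - {g} \<union> X"
      "if g \<in> U' then X \<in> trees r else X \<in> cuts r"
      using step[of "insert e T"] T e by auto
    have "U' - {e} \<in> cuts t" by (rule mem) (use U' in \<open>auto simp: insert_absorb\<close>)
    moreover have "if g \<in> U' - {e} then X \<in> trees r else X \<in> cuts r" using U'(5) E by auto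
    ultimately have "U' - {e} - {g} \<union> X \<in> cuts (graft g r t)" by (intro graft(1))
    moreover have "T = U' - {e} - {g} \<union> X" using T(1) U'(4) e_notin[OF U'(5)] by auto
    ultimately show ?thesis by simp
  qed
  moreover have "T \<in> trees (graft g r t)" if T: "T \<subseteq> edges G - {e}" "min_conn G T" for T
  proof -
    obtain U' X where U': "min_conn H U'" "U' \<subseteq> edges H" "e \<notin> U'" "T = U' - {g} \<union> X"
      "if g \<in> U' then X \<in> trees r else X \<in> cuts r"
      using step[of T] T by auto
    have "U' \<in> trees t" by (rule mem) (use U' in auto)
    then show ?thesis using graft(2)[of U' X] U'(4,5) by simp
  qed
  moreover have "leaves (graft g r t) = edges G - {e}"
    using leaves_graft[OF dl g] lv r(2) E by auto
  moreover have "distinct_leaves (graft g r t)"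
    by (rule distinct_leaves_graft[OF dl g r(1)]) (use lv r(2) E in auto)
  ultimately show ?thesis by (simp add: decomposes_def)
qed

text \<open>A loop lies in no minimally connected set, so it may be treated like an edge parallel to
  \<open>e\<close>. The additional trees through \<open>f\<close> are harmless, as
  \<open>decomposes\<close> asks for implications only.\<close>

lemma decomposes_remove_loop:
  assumes t: "decomposes t (delete_edge G f) e" and f: "f \<in> edges G" "f \<noteq> e" "card (ends G f) = 1"
  shows "decomposes (Par t (Edge f)) G e"
proof -
  have lv: "leaves t = edges G - {f} - {e}" using t by (simp add: decomposes_def delete_edge_def)
  have "T \<in> cuts (Par t (Edge f))" if T: "T \<subseteq> edges G - {e}" "min_conn G (insert e T)" for T
  proof -
    have "f \<notin> T" using min_connected_no_loop[OF T(2) f(3)] by simp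
    then have "T \<in> cuts t" using t T by (auto simp: decomposes_def delete_edge_def)
    then show ?thesis using joinI[of T "cuts t" "{}" "{{}}"] by simp
  qed
  moreover have "T \<in> trees (Par t (Edge f))" if T: "T \<subseteq> edges G - {e}" "min_conn G T" for T
  proof -
    have "f \<notin> T" using min_connected_no_loop[OF T(2) f(3)] .
    then have "T \<in> trees t" using t T by (auto simp: decomposes_def delete_edge_def)
    then show ?thesis using joinI[of T "trees t" "{}" "{{}}"] by simp
  qed
  ultimately show ?thesis using t f lv by (auto simp: decomposes_def)
qed

text \<open>A pendant edge lies in every minimally connected set, just as an edge in series with the
  whole network lies in all its trees. The additional cuts that omit \<open>f\<close> are
  harmless.\<close>

lemma decomposes_remove_pendant:
  assumes t: "decomposes t (delete_vertex G w) e" and e: "e \<in> edges G"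
    and f: "f \<in> edges G" "f \<noteq> e" "ends G f = {a, w}" "a \<noteq> w" "a \<in> verts G" "w \<in> verts G"
    and only: "\<And>g. g \<in> edges G \<Longrightarrow> w \<in> ends G g \<Longrightarrow> g = f"
  shows "decomposes (Ser t (Edge f)) G e"
proof -
  let ?H = "delete_vertex G w"
  have H: "edges ?H = edges G - {f}" "ends ?H = ends G" "verts ?H = verts G - {w}"
    using only f(3) by (auto simp: delete_vertex_def)
  have lv: "leaves t = edges G - {f} - {e}" using t by (simp add: decomposes_def H)
  have mem: "\<And>T. T \<subseteq> edges G - {f} - {e} \<Longrightarrow> min_conn ?H (insert e T) \<Longrightarrow> T \<in> cuts t"
      "\<And>T. T \<subseteq> edges G - {f} - {e} \<Longrightarrow> min_conn ?H T \<Longrightarrow> T \<in> trees t"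
    using t H(1) by (auto simp: decomposes_def)
  have red: "f \<in> U \<and> min_conn ?H (U - {f})" if "U \<subseteq> edges G" "min_conn G U" for U
    using min_connected_remove_pendant[of "verts G" "ends G" U f a w, OF that(2) f(3-)] only that(1)
    unfolding H by blast
  have "T \<in> cuts (Ser t (Edge f))" if T: "T \<subseteq> edges G - {e}" "min_conn G (insert e T)" for T
  proof -
    have "f \<in> T" "min_conn ?H (insert e T - {f})" using red[of "insert e T"] T e f(2) by auto
    moreover have "insert e T - {f} = insert e (T - {f})" using f(2) by auto
    ultimately have "T - {f} \<in> cuts t" using T(1) by (intro mem(1)) auto
    then have "T - {f} \<union> {f} \<in> join (cuts t) {{f}}" by (rule joinI) simp
    then show ?thesis using \<open>f \<in> T\<close> by (simp add: insert_absorb)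
  qed
  moreover have "T \<in> trees (Ser t (Edge f))" if T: "T \<subseteq> edges G - {e}" "min_conn G T" for T
  proof -
    have "f \<in> T" "min_conn ?H (T - {f})" using red[of T] T by auto
    then have "T - {f} \<in> trees t" using T(1) by (intro mem(2)) auto
    then have "T - {f} \<union> {f} \<in> join (trees t) {{f}}" by (rule joinI) simp
    then show ?thesis using \<open>f \<in> T\<close> by (simp add: insert_absorb)
  qed
  moreover have "distinct_leaves t" using t by (simp add: decomposes_def)
  ultimately show ?thesis using f lv by (auto simp: decomposes_def)
qed

text \<open>A minimally connected set contains at most one of \<open>f\<close> and \<open>g\<close>;
  if it contains \<open>f\<close>, exchanging \<open>f\<close> for \<open>g\<close> gives one of the
  reduced graph.\<close>

lemma decomposes_remove_parallel:
  assumes t: "decomposes t (delete_edge G f) e" and e: "e \<in> edges G"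
    and fg: "f \<in> edges G" "g \<in> edges G" "f \<noteq> e" "g \<noteq> e" "f \<noteq> g" "ends G f = ends G g"
  shows "decomposes (graft g (Par (Edge f) (Edge g)) t) G e"
proof (rule decomposes_graft[OF t e])
  let ?H = "delete_edge G f" and ?r = "Par (Edge f) (Edge g)"
  have r: "cuts ?r = {{}}" "trees ?r = {{f}, {g}}" by (auto simp: join_def)
  show "{} \<in> cuts ?r \<or> {f} \<in> cuts ?r" unfolding r by simp
  show "\<exists>U' X. U' \<subseteq> edges ?H \<and> min_conn ?H U' \<and> (e \<in> U' \<longleftrightarrow> e \<in> U) \<and>
      U = U' - {g} \<union> X \<and> (if g \<in> U' then X \<in> trees ?r else X \<in> cuts ?r)"
    if U: "U \<subseteq> edges G" "min_conn G U" for U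
  proof (cases "f \<in> U")
    case False
    then show ?thesis using U unfolding r
      by (intro exI[of _ U] exI[of _ "U \<inter> {g}"]) (auto simp: delete_edge_def)
  next
    case True
    have "g \<notin> U" using min_connected_parallel[OF U(2) fg(6,5)] True by simp
    moreover have "min_conn G (insert g (U - {f}))"
      by (rule min_connected_swap_parallel[OF U(2) fg(6,5) True])
    ultimately show ?thesis using U(1) True fg unfolding r
      by (intro exI[of _ "insert g (U - {f})"] exI[of _ "{f}"]) (auto simp: delete_edge_def)
  qed
qed (use fg in \<open>auto simp: delete_edge_def\<close>)

text \<open>A minimally connected set containing \<open>f\<close> is contracted along
  \<open>f\<close>, and \<open>g\<close> remains or stays absent. If \<open>f\<close> is missing,
  \<open>g\<close> is pendant at \<open>w\<close> and is removed together with \<open>w\<close>; no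
  remaining edge meets \<open>w\<close>, so the rest is also minimally connected in the contracted
  graph.\<close>

lemma decomposes_contract_series:
  assumes t: "decomposes t (contract_edge G f a w) e" and e: "e \<in> edges G"
    and fg: "f \<in> edges G" "g \<in> edges G" "f \<noteq> e" "g \<noteq> e" "f \<noteq> g"
      "ends G f = {a, w}" "ends G g = {b, w}" "a \<noteq> w" "b \<noteq> w" "a \<in> verts G" "b \<in> verts G" "w \<in> verts G"
    and only: "\<And>h. h \<in> edges G \<Longrightarrow> w \<in> ends G h \<Longrightarrow> h = f \<or> h = g"
  shows "decomposes (graft g (Ser (Edge f) (Edge g)) t) G e"
proof (rule decomposes_graft[OF t e])
  let ?H = "contract_edge G f a w" and ?r = "Ser (Edge f) (Edge g)"
  have r: "cuts ?r = {{f}, {g}}" "trees ?r = {{f, g}}" by (auto simp: join_def)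
  have H: "verts ?H = verts G - {w}" "edges ?H = edges G - {f}"
    "ends ?H = (\<lambda>h. (\<lambda>x. if x = w then a else x) ` ends G h)"
    by (auto simp: contract_edge_def)
  show "{} \<in> cuts ?r \<or> {f} \<in> cuts ?r" unfolding r by simp
  show "\<exists>U' X. U' \<subseteq> edges ?H \<and> min_conn ?H U' \<and> (e \<in> U' \<longleftrightarrow> e \<in> U) \<and>
      U = U' - {g} \<union> X \<and> (if g \<in> U' then X \<in> trees ?r else X \<in> cuts ?r)"
    if U: "U \<subseteq> edges G" "min_conn G U" for U
  proof (cases "f \<in> U")
    case True
    have "min_conn ?H (U - {f})"
      unfolding H by (rule min_connected_contract[OF U(2) True]) (use fg in auto)
    moreover have "U = U - {f} - {g} \<union> (if g \<in> U then {f, g} else {f})" using True by auto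
    moreover have "U - {f} \<subseteq> edges ?H" using U(1) H(2) by auto
    moreover have "e \<in> U - {f} \<longleftrightarrow> e \<in> U" using fg(3) by auto
    moreover have "if g \<in> U - {f} then (if g \<in> U then {f, g} else {f}) \<in> trees ?r
        else (if g \<in> U then {f, g} else {f}) \<in> cuts ?r"
      unfolding r using fg(5) by simp
    ultimately show ?thesis by blast
  next
    case False
    have pend: "g \<in> U" "min_connected (verts G - {w}) (ends G) (U - {g})"
      using min_connected_remove_pendant[of "verts G" "ends G" U g b w, OF U(2) fg(7,9,11,12)] only U(1) False by blast+
    have "ends ?H h = ends G h" if "h \<in> U - {g}" for h
      using only[of h] that U(1) False unfolding H by force
    then have "min_conn ?H (U - {g})" using min_connected_cong[OF pend(2)] by (simp add: H)
    moreover have "U = U - {g} - {g} \<union> {g}" using pend(1) by auto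
    moreover have "U - {g} \<subseteq> edges ?H" using U(1) False H(2) by auto
    moreover have "e \<in> U - {g} \<longleftrightarrow> e \<in> U" using fg(4) by auto
    moreover have "if g \<in> U - {g} then {g} \<in> trees ?r else {g} \<in> cuts ?r" unfolding r by simp
    ultimately show ?thesis by blast
  qed
qed (use fg in \<open>auto simp: contract_edge_def\<close>)

text \<open>Parallel edges never occur together in a minimally connected set, and the empty set does
  not join \<open>u\<close> to \<open>v\<close>. This leaves \<open>{e}\<close> and
  \<open>{f}\<close>.\<close>

lemma decomposes_single_edge:
  assumes E: "edges G = {e, f}" "e \<noteq> f" "ends G e = ends G f" and V: "u \<in> verts G" "v \<in> verts G" "u \<noteq> v"
  shows "decomposes (Edge f) G e"
proof -
  have "T = {}" if T: "T \<subseteq> {f}" "min_conn G (insert e T)" for T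
    using min_connected_parallel[OF T(2) E(3,2)] T(1) by auto
  moreover have "\<not> min_conn G {}"
  proof
    assume "min_conn G {}"
    then have "cut_connected (verts G) (ends G) {}" by (simp add: min_connected_def)
    moreover have "{u} \<subset> verts G" using V by auto
    ultimately show False by (auto elim: cut_connectedE[of _ _ _ "{u}"])
  qed
  ultimately show ?thesis using E(1,2) by (auto simp: decomposes_def subset_singleton_iff)
qed

text \<open>Every reduction removes an edge other than \<open>e\<close> and keeps the graph
  connected without \<open>e\<close>. Once \<open>G - e\<close> has neither loops nor parallel
  pairs, a vertex outside \<open>e\<close> with at most two neighbours has at most two edges, so it
  is the end of a pendant edge or the middle of a series pair.\<close>

theorem series_parallel_decomposition:
  "series_parallel G \<Longrightarrow> e \<in> edges G \<Longrightarrow> \<not> is_loop G e \<Longrightarrow>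
     cut_connected (verts G) (ends G) (edges G - {e}) \<Longrightarrow> \<exists>t. decomposes t G e"
proof (induction "card (edges G)" arbitrary: G rule: less_induct)
  case less
  have fin: "finite_multigraph G" using less.prems(1) by (simp add: series_parallel_def)
  have finE: "finite (edges G)" and en: "\<And>f. f \<in> edges G \<Longrightarrow> ends G f \<subseteq> verts G \<and> card (ends G f) \<in> {1, 2}"
    using fin by (auto simp: finite_multigraph_def)
  note e = less.prems(2)
  note cc = less.prems(4)
  have IH: "\<exists>t. decomposes t H e" if "has_minor G H" "edges H = edges G - {f}" "f \<in> edges G" "e \<in> edges H"
    "\<not> is_loop H e" "cut_connected (verts H) (ends H) (edges G - {e} - {f})" for H f
  proof (rule less.hyps)
    show "card (edges H) < card (edges G)" unfolding that(2) using finE that(3) by (rule card_Diff1_less)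
    show "series_parallel H" using series_parallel_minor less.prems(1) that(1) by blast
    have "edges H - {e} = edges G - {e} - {f}" using that(2) by auto
    then show "cut_connected (verts H) (ends H) (edges H - {e})" using that(6) by simp
  qed (use that in auto)
  obtain u v where uv: "ends G e = {u, v}" "u \<noteq> v"
    using en[OF e] less.prems(2,3) by (auto simp: is_loop_def card_2_iff)
  have uvV: "u \<in> verts G" "v \<in> verts G" using en[OF e] uv by auto
  \<comment> \<open>Parallel pairs are sought away from \<open>e\<close> only: an edge parallel to
    \<open>e\<close> survives and becomes the network in the base case.\<close>
  consider (loop) f where "f \<in> edges G" "card (ends G f) = 1"
    | (parallel) f g where "f \<in> edges G - {e}" "g \<in> edges G - {e}" "f \<noteq> g" "ends G f = ends G g"
    | (simple) "\<And>f. f \<in> edges G \<Longrightarrow> card (ends G f) = 2"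
      "\<And>f g. f \<in> edges G - {e} \<Longrightarrow> g \<in> edges G - {e} \<Longrightarrow> ends G f = ends G g \<Longrightarrow> f = g"
    using en by blast
  then show ?case
  proof cases
    case loop
    have "f \<noteq> e" using loop less.prems(3) by (auto simp: is_loop_def)
    have "\<exists>t. decomposes t (delete_edge G f) e"
    proof (rule IH)
      show "has_minor G (delete_edge G f)" by (rule has_minor.del_edge[OF has_minor.refl loop(1)])
      show "cut_connected (verts (delete_edge G f)) (ends (delete_edge G f)) (edges G - {e} - {f})"
        using cut_connected_remove_loop[OF cc loop(2)] by (simp add: delete_edge_def)
    qed (use loop e less.prems(3) \<open>f \<noteq> e\<close> in \<open>auto simp: delete_edge_def is_loop_def\<close>)
    then show ?thesis using decomposes_remove_loop loop \<open>f \<noteq> e\<close> by metis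
  next
    case parallel
    have "\<exists>t. decomposes t (delete_edge G f) e"
    proof (rule IH)
      show "has_minor G (delete_edge G f)" by (rule has_minor.del_edge[OF has_minor.refl]) (use parallel in simp)
      have "cut_connected (verts G) (ends G) (edges G - {e} - {f})"
        by (rule cut_connected_replace[OF cc]) (use parallel in auto)
      then show "cut_connected (verts (delete_edge G f)) (ends (delete_edge G f)) (edges G - {e} - {f})"
        by (simp add: delete_edge_def)
    qed (use parallel e less.prems(3) in \<open>auto simp: delete_edge_def is_loop_def\<close>)
    then obtain t where "decomposes t (delete_edge G f) e" by blast
    then show ?thesis using decomposes_remove_parallel[of t G f e g] parallel e by auto
  next
    case simple
    show ?thesis
    proof (cases "verts G = {u, v}")
      case True
      have "{u} \<subset> verts G" using uvV uv by auto
      then obtain f where f: "f \<in> edges G - {e}" by (rule cut_connectedE[OF cc]) auto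
      have "ends G h = {u, v}" if "h \<in> edges G" for h
      proof (rule card_subset_eq)
        show "ends G h \<subseteq> {u, v}" using en[OF that] True by simp
        show "card (ends G h) = card {u, v}" using simple(1)[OF that] uv by simp
      qed simp
      then have "edges G = {e, f}" "ends G e = ends G f" using simple(2) f e by auto
      then have "decomposes (Edge f) G e" using f uvV uv by (intro decomposes_single_edge) auto
      then show ?thesis by blast
    next
      case False
      have "\<exists>w\<in>verts G - {u, v}. card (nbrs G w) \<le> 2"
      proof (rule ccontr)
        assume "\<not> ?thesis"
        then have deg: "3 \<le> card (nbrs G x)" if "x \<in> verts G - {u, v}" for x using that by force
        have "{u, v} \<subset> verts G" using uvV False by auto
        then obtain f where f: "f \<in> edges G - {e}" "ends G f \<inter> {u, v} \<noteq> {}" "ends G f \<inter> (verts G - {u, v}) \<noteq> {}"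
          by (rule cut_connectedE[OF cc]) auto
        then obtain x w where xw: "x \<in> ends G f" "x \<in> {u, v}" "w \<in> ends G f" "w \<in> verts G - {u, v}" by auto
        then have "ends G f = {x, w}" using f(1) by (intro ends_doubleton[OF fin]) auto
        then have w: "w \<in> nbrs G x" using f(1) xw by (auto simp: nbrs_def)
        have "v \<in> nbrs G u" "u \<in> nbrs G v" using uv e by (auto simp: nbrs_def insert_commute)
        \<comment> \<open>The path has to run through \<open>e\<close> towards the end
          \<open>x\<close> that has the outside neighbour \<open>w\<close>, hence the two
          orientations of \<open>e\<close>.\<close>
        then have "\<exists>Br. K4_model G Br"
          using min_degree_K4_model[OF fin uvV(1), of v w] min_degree_K4_model[OF fin uvV(2), of u w] deg w xw
          by (auto simp: insert_commute)
        then show False using K4_model_imp_minor[OF fin] less.prems(1) by (auto simp: series_parallel_def)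
      qed
      then obtain w where w: "w \<in> verts G" "w \<noteq> u" "w \<noteq> v" "card (nbrs G w) \<le> 2" by auto
      define D where "D = {f \<in> edges G. w \<in> ends G f}"
      have eD: "e \<notin> D" using w uv by (auto simp: D_def)
      have other: "\<exists>x. ends G f = {x, w} \<and> x \<noteq> w \<and> x \<in> nbrs G w \<and> x \<in> verts G" if "f \<in> D" for f
      proof -
        have f: "f \<in> edges G" "w \<in> ends G f" "card (ends G f) = 2" using that simple(1) by (auto simp: D_def)
        obtain x where x: "ends G f = {w, x}" by (rule card_1_2_E[of "ends G f" w]) (use f in auto)
        then show ?thesis using f en[OF f(1)]
          by (intro exI[of _ x]) (auto simp: nbrs_def insert_commute split: if_splits)
      qed
      then obtain o' where o': "\<And>f. f \<in> D \<Longrightarrow> ends G f = {o' f, w} \<and> o' f \<noteq> w \<and> o' f \<in> nbrs G w \<and> o' f \<in> verts G"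
        by metis
      have "inj_on o' D"
      proof (rule inj_onI)
        fix f g assume fg: "f \<in> D" "g \<in> D" "o' f = o' g"
        then have "ends G f = ends G g" using o' by metis
        then show "f = g" using simple(2) fg eD by (auto simp: D_def)
      qed
      moreover have "o' ` D \<subseteq> nbrs G w" using o' by auto
      moreover have "finite (nbrs G w)"
        by (rule finite_subset[OF nbrs_subset[OF fin]]) (use fin in \<open>simp add: finite_multigraph_def\<close>)
      ultimately have "card D \<le> 2" using card_inj_on_le w(4) by (metis order.trans)
      moreover have "D \<noteq> {}"
      proof
        assume "D = {}"
        have "{w} \<subset> verts G" using w uvV by auto
        then obtain f where "f \<in> edges G - {e}" "ends G f \<inter> {w} \<noteq> {}" by (rule cut_connectedE[OF cc]) auto
        then show False using \<open>D = {}\<close> by (auto simp: D_def)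
      qed
      moreover have "finite D" using finE by (simp add: D_def)
      ultimately have "card D = 1 \<or> card D = 2" using card_gt_0_iff[of D] by linarith
      then consider (pendant) f where "D = {f}" | (series) f g where "D = {f, g}" "f \<noteq> g"
        by (auto simp: card_1_singleton_iff card_2_iff)
      then show ?thesis
      proof cases
        case pendant
        let ?H = "delete_vertex G w"
        have f: "f \<in> edges G" "f \<noteq> e" using pendant eD by (auto simp: D_def)
        have only: "g = f" if "g \<in> edges G" "w \<in> ends G g" for g using that pendant by (auto simp: D_def)
        have of: "ends G f = {o' f, w}" "o' f \<noteq> w" "o' f \<in> verts G" using o' pendant by auto
        have H: "edges ?H = edges G - {f}" "ends ?H = ends G" "verts ?H = verts G - {w}"
          using only of(1) by (auto simp: delete_vertex_def)
        have "\<exists>t. decomposes t ?H e"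
        proof (rule IH)
          show "has_minor G ?H" by (rule has_minor.del_vertex[OF has_minor.refl w(1)])
          show "cut_connected (verts ?H) (ends ?H) (edges G - {e} - {f})"
            unfolding H by (rule cut_connected_remove_pendant[OF cc of w(1)]) (use only in auto)
        qed (use f e less.prems(3) H in \<open>auto simp: is_loop_def\<close>)
        then obtain t where "decomposes t ?H e" by blast
        then have "decomposes (Ser t (Edge f)) G e"
          by (rule decomposes_remove_pendant[OF _ e f of w(1) only])
        then show ?thesis by blast
      next
        case series
        let ?H = "contract_edge G f (o' f) w"
        have fg: "f \<in> edges G" "g \<in> edges G" "f \<noteq> e" "g \<noteq> e" using series eD by (auto simp: D_def)
        have only: "h = f \<or> h = g" if "h \<in> edges G" "w \<in> ends G h" for h using that series by (auto simp: D_def)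
        have of: "ends G f = {o' f, w}" "o' f \<noteq> w" "o' f \<in> verts G"
          and og: "ends G g = {o' g, w}" "o' g \<noteq> w" "o' g \<in> verts G" using o' series by auto
        have H: "edges ?H = edges G - {f}" "verts ?H = verts G - {w}"
          "ends ?H = (\<lambda>h. (\<lambda>x. if x = w then o' f else x) ` ends G h)"
          by (auto simp: contract_edge_def)
        have "ends ?H e = ends G e" using uv w(2,3) by (simp add: H)
        have "\<exists>t. decomposes t ?H e"
        proof (rule IH)
          show "has_minor G ?H" by (rule has_minor.contract[OF has_minor.refl fg(1) of(1,2)])
          show "cut_connected (verts ?H) (ends ?H) (edges G - {e} - {f})"
            unfolding H by (rule cut_connected_contract[OF cc of w(1)])
        qed (use fg e less.prems(3) H \<open>ends ?H e = ends G e\<close> in \<open>auto simp: is_loop_def\<close>)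
        then obtain t where "decomposes t ?H e" by blast
        then have "decomposes (graft g (Ser (Edge f) (Edge g)) t) G e"
          by (rule decomposes_contract_series[OF _ e fg series(2) of(1) og(1) of(2) og(2) of(3) og(3) w(1) only])
        then show ?thesis by blast
      qed
    qed
  qed
qed

section \<open>Oriented embeddings\<close>

lemma Q_edges_iff:
  "q \<in> Q_edges d \<longleftrightarrow> (\<exists>X i. q = {X, insert i X} \<and> X \<subseteq> {..<d} \<and> i < d \<and> i \<notin> X)"
  by (auto simp: cube_edges_def)

lemma doubleton_insert_inject:
  assumes "{X, insert i X} = {Y, insert j Y}" "i \<notin> X" "j \<notin> Y"
  shows "X = Y \<and> i = j"
proof -
  from assms(1) consider "X = Y" "insert i X = insert j Y" | "X = insert j Y" "insert i X = Y"
    by (auto simp: doubleton_eq_iff)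
  then show ?thesis
  proof cases
    case 1
    then show ?thesis using assms(2,3) by (metis insert_ident insertI1 insertE)
  next
    case 2
    then show ?thesis using assms(2,3) by blast
  qed
qed

lemma bij_betw_arcs_Q_edges: "bij_betw (\<lambda>(X, i). {X, insert i X}) (arcs {..<n}) (Q_edges n)"
  unfolding bij_betw_def
proof
  show "inj_on (\<lambda>(X, i). {X, insert i X}) (arcs {..<n})"
    by (rule inj_onI) (auto simp: arcs_def dest!: doubleton_insert_inject)
  show "(\<lambda>(X, i). {X, insert i X}) ` arcs {..<n} = Q_edges n"
    by (auto simp: arcs_def Q_edges_iff image_iff) blast+
qed

definition cube_map :: "nat \<Rightarrow> (nat \<Rightarrow> nat) \<Rightarrow> nat set \<Rightarrow> nat set \<Rightarrow> nat set" where
  "cube_map d J z = (\<lambda>X\<in>Q_verts d. z \<union> J ` X)"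

text \<open>Preservation of edges and order makes each additional element of \<open>X\<close> add
  exactly one coordinate to the image. \<open>J i\<close> is read off at \<open>{i}\<close>, and by
  monotonicity the coordinate added along \<open>i\<close> is the same at every
  \<open>X\<close>.\<close>

lemma oriented_embedding_cube_map:
  assumes psi: "\<psi> \<in> oriented_embeddings d n"
  obtains J z where "J \<in> injs {..<d} {..<n}" "z \<subseteq> {..<n} - J ` {..<d}" "\<psi> = cube_map d J z"
proof -
  have ext: "\<psi> \<in> Q_verts d \<rightarrow>\<^sub>E Q_verts n"
    and inj: "inj_on \<psi> (Q_verts d)"
    and edge: "\<And>X Y. X \<in> Q_verts d \<Longrightarrow> Y \<in> Q_verts d \<Longrightarrow> {X, Y} \<in> Q_edges d \<Longrightarrow> {\<psi> X, \<psi> Y} \<in> Q_edges n"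
    and mono: "\<And>X Y. X \<in> Q_verts d \<Longrightarrow> Y \<in> Q_verts d \<Longrightarrow> X \<subseteq> Y \<Longrightarrow> \<psi> X \<subseteq> \<psi> Y"
    using psi by (auto simp: oriented_embeddings_def embeddings_def bij_betw_def)
  define z where "z = \<psi> {}"
  have step: "\<exists>j. j < n \<and> j \<notin> \<psi> X \<and> \<psi> (insert i X) = insert j (\<psi> X)"
    if "X \<subseteq> {..<d}" "i < d" "i \<notin> X" for X i
  proof -
    have "{\<psi> X, \<psi> (insert i X)} \<in> Q_edges n"
      by (rule edge) (use that in \<open>auto simp: Q_edges_iff\<close>)
    then obtain Y j where Y: "{\<psi> X, \<psi> (insert i X)} = {Y, insert j Y}" "j < n" "j \<notin> Y"
      by (auto simp: Q_edges_iff)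
    have "\<psi> X \<subseteq> \<psi> (insert i X)" by (rule mono) (use that in auto)
    then have "\<psi> X = Y \<and> \<psi> (insert i X) = insert j Y" using Y(1,3) by (auto simp: doubleton_eq_iff)
    then show ?thesis using Y by auto
  qed
  have "\<exists>j. j < n \<and> j \<notin> z \<and> \<psi> {i} = insert j z" if "i < d" for i
    using step[of "{}" i] that by (simp add: z_def)
  then obtain J0 where J0: "\<And>i. i < d \<Longrightarrow> J0 i < n \<and> J0 i \<notin> z \<and> \<psi> {i} = insert (J0 i) z" by metis
  define J where "J = restrict J0 {..<d}"
  have J: "J i < n" "J i \<notin> z" "\<psi> {i} = insert (J i) z" if "i < d" for i
    using J0[OF that] that by (auto simp: J_def)
  have injJ: "inj_on J {..<d}"
  proof (rule inj_onI)
    fix i j assume ij: "i \<in> {..<d}" "j \<in> {..<d}" "J i = J j"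
    then have "\<psi> {i} = \<psi> {j}" using J by auto
    then have "{i} = {j}" using ij inj_onD[OF inj, of "{i}" "{j}"] by auto
    then show "i = j" by simp
  qed
  have val: "\<psi> X = z \<union> J ` X" if "X \<subseteq> {..<d}" for X
  proof -
    have "finite X" using that finite_subset by blast
    then show ?thesis using that
    proof (induction X rule: finite_induct)
      case empty
      then show ?case by (simp add: z_def)
    next
      case (insert i X)
      then have i: "i < d" "X \<subseteq> {..<d}" "i \<notin> X" by auto
      then obtain j where j: "j \<notin> \<psi> X" "\<psi> (insert i X) = insert j (\<psi> X)" using step by blast
      have "J i \<in> \<psi> {i}" using J[OF i(1)] by simp
      moreover have "\<psi> {i} \<subseteq> \<psi> (insert i X)" by (rule mono) (use i in auto)
      moreover have "J i \<notin> J ` X" using injJ i by (auto simp: inj_on_def)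
      then have "J i \<notin> \<psi> X" using insert.IH[OF i(2)] J(2)[OF i(1)] by simp
      ultimately have "j = J i" using j(2) by auto
      then show ?case using j(2) insert.IH[OF i(2)] by auto
    qed
  qed
  have "z \<subseteq> {..<n}" using ext by (auto simp: z_def)
  then have "z \<subseteq> {..<n} - J ` {..<d}" using J by auto
  moreover have "J \<in> injs {..<d} {..<n}" using J(1) injJ by (auto simp: injs_def J_def)
  moreover have "\<psi> = cube_map d J z"
  proof
    fix X show "\<psi> X = cube_map d J z X"
    proof (cases "X \<subseteq> {..<d}")
      case True
      then show ?thesis using val by (simp add: cube_map_def)
    next
      case False
      then have "X \<notin> Q_verts d" by simp
      then show ?thesis using ext by (simp add: cube_map_def PiE_def extensional_def)
    qed
  qed
  ultimately show thesis using that by blast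
qed

text \<open>The total number of embeddings occurs on the smaller side of the final inequality, so it
  is bounded from above.\<close>

lemma card_oriented_embeddings_le:
  "card (oriented_embeddings d n) \<le> card (injs {..<d} {..<n}) * 2 ^ (n - d)"
proof -
  let ?A = "SIGMA J:injs {..<d} {..<n}. Pow ({..<n} - J ` {..<d})"
  have fin: "finite ?A" by (intro finite_SigmaI finite_injs) auto
  have "oriented_embeddings d n \<subseteq> (\<lambda>(J, z). cube_map d J z) ` ?A"
  proof
    fix \<psi> assume "\<psi> \<in> oriented_embeddings d n"
    then obtain J z where "J \<in> injs {..<d} {..<n}" "z \<subseteq> {..<n} - J ` {..<d}" "\<psi> = cube_map d J z"
      by (rule oriented_embedding_cube_map)
    then show "\<psi> \<in> (\<lambda>(J, z). cube_map d J z) ` ?A" by (intro image_eqI[of _ _ "(J, z)"]) auto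
  qed
  then have "card (oriented_embeddings d n) \<le> card ?A" using fin by (rule surj_card_le[rotated])
  also have "\<dots> = (\<Sum>J\<in>injs {..<d} {..<n}. card (Pow ({..<n} - J ` {..<d})))"
    by (intro card_SigmaI) (auto intro: finite_injs)
  also have "\<dots> = (\<Sum>J\<in>injs {..<d} {..<n}. 2 ^ (n - d))"
  proof (rule sum.cong[OF HOL.refl])
    fix J :: "nat \<Rightarrow> nat" assume "J \<in> injs {..<d} {..<n}"
    then have "card ({..<n} - J ` {..<d}) = n - d" using card_Diff_injs by fastforce
    then show "card (Pow ({..<n} - J ` {..<d})) = 2 ^ (n - d)" by (simp add: card_Pow)
  qed
  finally show ?thesis by simp
qed

lemma cube_map_oriented_embedding:
  assumes J: "J ` {..<d} \<subseteq> {..<n}" "inj_on J {..<d}" and z: "z \<subseteq> {..<n} - J ` {..<d}"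
  shows "cube_map d J z \<in> oriented_embeddings d n"
proof -
  let ?D = "J ` {..<d}" and ?F = "{X \<in> Q_verts n. X - J ` {..<d} = z}"
  have val: "cube_map d J z X = z \<union> J ` X" if "X \<subseteq> {..<d}" for X using that by (simp add: cube_map_def)
  have J_mem: "J i \<in> J ` X \<longleftrightarrow> i \<in> X" if "i < d" "X \<subseteq> {..<d}" for i X
    using J(2) that by (auto simp: inj_on_image_mem_iff)
  have J_notin: "J i \<notin> z" if "i < d" for i using z that by auto
  have face: "is_face n d ?F"
    unfolding is_face_def using J z by (intro exI[of _ ?D] exI[of _ z]) (simp add: card_image)
  have sub: "z \<union> J ` X \<subseteq> {..<n}" if "X \<subseteq> {..<d}" for X using that z J(1) by auto
  have inj: "X = Y" if "X \<subseteq> {..<d}" "Y \<subseteq> {..<d}" "z \<union> J ` X = z \<union> J ` Y" for X Y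
  proof -
    have "J ` X = J ` Y" using that z by blast
    then show ?thesis using inj_on_image_eq_iff[OF J(2)] that by blast
  qed
  have bij: "bij_betw (cube_map d J z) (Q_verts d) ?F"
    unfolding bij_betw_def
  proof
    show "inj_on (cube_map d J z) (Q_verts d)" by (rule inj_onI, rule inj) (simp_all add: val)
    show "cube_map d J z ` Q_verts d = ?F"
    proof (intro set_eqI iffI)
      fix W assume "W \<in> cube_map d J z ` Q_verts d"
      then obtain X where "X \<subseteq> {..<d}" "W = z \<union> J ` X" by (auto simp: val)
      then show "W \<in> ?F" using sub z by auto
    next
      fix W assume W: "W \<in> ?F"
      define X where "X = {i. i < d \<and> J i \<in> W}"
      have "W = z \<union> J ` X" using W by (auto simp: X_def)
      moreover have "X \<subseteq> {..<d}" by (auto simp: X_def)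
      ultimately show "W \<in> cube_map d J z ` Q_verts d" by (auto simp: val image_iff intro!: bexI[of _ X])
    qed
  qed
  have edge: "{X, Y} \<in> Q_edges d \<longleftrightarrow> {z \<union> J ` X, z \<union> J ` Y} \<in> Q_edges n"
    if XY: "X \<subseteq> {..<d}" "Y \<subseteq> {..<d}" for X Y
  proof
    assume "{X, Y} \<in> Q_edges d"
    then obtain W i where W: "{X, Y} = {W, insert i W}" "W \<subseteq> {..<d}" "i < d" "i \<notin> W"
      by (auto simp: Q_edges_iff)
    then have "{z \<union> J ` X, z \<union> J ` Y} = {z \<union> J ` W, insert (J i) (z \<union> J ` W)}"
      by (auto simp: doubleton_eq_iff)
    then show "{z \<union> J ` X, z \<union> J ` Y} \<in> Q_edges n"
      unfolding Q_edges_iff using W sub[OF W(2)] J(1) J_mem J_notin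
      by (intro exI[of _ "z \<union> J ` W"] exI[of _ "J i"]) auto
  next
    have *: "{X, Y} \<in> Q_edges d" if "z \<union> J ` Y = insert j (z \<union> J ` X)" "j \<notin> z \<union> J ` X" "X \<subseteq> {..<d}" "Y \<subseteq> {..<d}"
      for X Y j
    proof -
      have "j \<in> J ` Y" using that(1,2) by blast
      then obtain i where i: "i \<in> Y" "j = J i" by auto
      have "z \<union> J ` Y = z \<union> J ` insert i X" using that(1) i(2) by simp
      moreover have "insert i X \<subseteq> {..<d}" using that(3,4) i(1) by auto
      ultimately have "Y = insert i X" using inj[OF that(4), of "insert i X"] by simp
      moreover have "i \<notin> X" using that(2) i(2) by auto
      ultimately show ?thesis unfolding Q_edges_iff using that(4) by (intro exI[of _ X] exI[of _ i]) auto
    qed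
    assume "{z \<union> J ` X, z \<union> J ` Y} \<in> Q_edges n"
    then obtain W j where W: "{z \<union> J ` X, z \<union> J ` Y} = {W, insert j W}" "j \<notin> W" by (auto simp: Q_edges_iff)
    then consider "z \<union> J ` X = W" "z \<union> J ` Y = insert j W" | "z \<union> J ` Y = W" "z \<union> J ` X = insert j W"
      by (auto simp: doubleton_eq_iff)
    then show "{X, Y} \<in> Q_edges d"
    proof cases
      case 1
      then show ?thesis using *[of Y j X] W(2) XY by simp
    next
      case 2
      then show ?thesis using *[of X j Y] W(2) XY by (simp add: insert_commute)
    qed
  qed
  have "cube_map d J z \<in> Q_verts d \<rightarrow>\<^sub>E Q_verts n" using sub by (auto simp: cube_map_def)
  then have "cube_map d J z \<in> embeddings d n"
    unfolding embeddings_def using face bij edge by (auto simp: val intro!: exI[of _ ?F])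
  then show ?thesis by (auto simp: oriented_embeddings_def val)
qed

text \<open>A copy \<open>(J, z)\<close> of \<open>t\<close> yields the embedding
  \<open>cube_map d (J \<circ> \<sigma>) z\<close>, and distinct copies yield distinct embeddings.
  The normalising factor in \<open>supersaturated\<close> bounds the number of all oriented
  embeddings, so the density bound becomes a proportion.\<close>

lemma supersaturated_embeddings:
  fixes t :: "'e sp" and Y :: "nat set set set"
  assumes ss: "supersaturated t" and bij: "bij_betw \<sigma> {..<d} (leaves t)"
    and Y: "\<And>q. q \<in> Y \<Longrightarrow> \<exists>X i. X \<subseteq> {..<d} \<and> i < d \<and> i \<notin> X \<and> q = {X, insert i X} \<and>
      \<sigma> ` X \<in> cuts t \<and> insert (\<sigma> i) (\<sigma> ` X) \<in> trees t"
  shows "\<exists>c1 c2 c3 c4 :: real. c1 > 0 \<and> c2 > 0 \<and> c3 > 0 \<and> c4 > 0 \<and>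
    (\<forall>(n :: nat) S (\<delta> :: real). n \<ge> d \<longrightarrow> S \<subseteq> Q_edges n \<longrightarrow>
       real (card S) = \<delta> * real (card (Q_edges n)) \<longrightarrow> \<delta> \<ge> c1 * real n powr (- c2) \<longrightarrow>
       real (card {\<psi> \<in> oriented_embeddings d n. (\<lambda>q. \<psi> ` q) ` Y \<subseteq> S})
         \<ge> c3 * \<delta> powr c4 * real (card (oriented_embeddings d n)))"
proof -
  from ss obtain k C where k: "1 \<le> k" and C: "0 \<le> C" and bound:
    "\<And>V S. finite V \<Longrightarrow> card (leaves t) \<le> card V \<Longrightarrow> S \<subseteq> arcs V \<Longrightarrow>
       (density V S ^ k - C / real (card V)) * (real (card (injs (leaves t) V)) * 2 ^ (card V - card (leaves t)))
         \<le> real (card (copies t V S))" by (rule supersaturatedE) blast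
  have d: "card (leaves t) = d" "d \<ge> 1"
    using bij_betw_same_card[OF bij] card_leaves_pos[of t] by auto
  have \<sigma>: "\<sigma> ` {..<d} = leaves t" "inj_on \<sigma> {..<d}" using bij by (auto simp: bij_betw_def)
  \<comment> \<open>\<open>2 * C\<close> makes the error term at most half of
    \<open>\<delta> ^ k\<close>; adding 1 ensures \<open>c1 \<ge> 1\<close>, hence
    \<open>c1 \<le> c1 ^ k\<close>.\<close>
  define c1 where "c1 = 2 * C + 1"
  have "1 / 2 * \<delta> powr real k * real (card (oriented_embeddings d n))
      \<le> real (card {\<psi> \<in> oriented_embeddings d n. (\<lambda>q. \<psi> ` q) ` Y \<subseteq> S})"
    if n: "n \<ge> d" and S: "S \<subseteq> Q_edges n" and card_S: "real (card S) = \<delta> * real (card (Q_edges n))"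
      and \<delta>: "\<delta> \<ge> c1 * real n powr (- (1 / real k))" for n S \<delta>
  proof -
    have n0: "real n > 0" using n d by simp
    then have \<delta>0: "\<delta> > 0" using \<delta> C by (smt (verit) c1_def mult_pos_pos powr_gt_zero)
    let ?pair = "\<lambda>(X, i). {X, insert i X}"
    define S' where "S' = {p \<in> arcs {..<n}. ?pair p \<in> S}"
    have surj: "?pair ` S' = S"
    proof
      show "S \<subseteq> ?pair ` S'"
      proof
        fix q assume q: "q \<in> S"
        then have "q \<in> ?pair ` arcs {..<n}" using S bij_betw_imp_surj_on[OF bij_betw_arcs_Q_edges[of n]] by auto
        then obtain p where "p \<in> arcs {..<n}" "q = ?pair p" by (rule imageE)
        then show "q \<in> ?pair ` S'" using q by (simp add: S'_def)
      qed
    qed (auto simp: S'_def)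
    have inj: "inj_on ?pair S'"
      using bij_betw_arcs_Q_edges[of n] unfolding bij_betw_def S'_def by (auto intro: inj_on_subset)
    have "card (?pair ` S') = card S'" using inj by (rule card_image)
    with surj have "card S' = card S" by simp
    moreover have ca: "card (arcs {..<n}) = card (Q_edges n)" using bij_betw_arcs_Q_edges by (rule bij_betw_same_card)
    moreover have "card (Q_edges n) > 0" using n d by (simp add: ca[symmetric] card_arcs)
    ultimately have dens: "density {..<n} S' = \<delta>" using card_S unfolding density_def by simp
    \<comment> \<open>The exponent \<open>1 / real k\<close> of the threshold is chosen so that its
      \<open>k\<close>-th power is of the order of the error term.\<close>
    have c1_le: "c1 / real n \<le> \<delta> ^ k"
    proof -
      have "c1 / real n \<le> c1 ^ k / real n"
        using k C n0 by (intro divide_right_mono self_le_power) (auto simp: c1_def)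
      also have "1 / real n = (real n powr (- (1 / real k))) ^ k"
        using n0 k by (simp add: powr_minus_divide power_divide powr_power)
      then have "c1 ^ k / real n = (c1 * real n powr (- (1 / real k))) ^ k"
        by (simp add: power_mult_distrib divide_inverse)
      also have "\<dots> \<le> \<delta> ^ k"
        using \<delta> C n0 by (intro power_mono) (auto simp: c1_def)
      finally show ?thesis .
    qed
    have "C / real n \<le> (c1 / real n) / 2" using n0 by (simp add: c1_def divide_simps)
    also have "\<dots> \<le> \<delta> ^ k / 2" using c1_le by (rule divide_right_mono) simp
    finally have half: "\<delta> ^ k / 2 \<le> \<delta> ^ k - C / real n" by simp
    let ?N = "real (card (injs (leaves t) {..<n})) * 2 ^ (n - d)"
    have "card (injs (leaves t) {..<n}) = card (injs {..<d} {..<n})"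
      by (rule card_injs_cong) (use d in auto)
    then have "real (card (oriented_embeddings d n)) \<le> ?N"
      using card_oriented_embeddings_le[of d n] by (metis of_nat_le_iff of_nat_mult of_nat_numeral of_nat_power)
    then have "1 / 2 * \<delta> powr real k * real (card (oriented_embeddings d n)) \<le> (\<delta> ^ k / 2) * ?N"
      using \<delta>0 by (simp add: powr_realpow mult_left_mono)
    also have "\<dots> \<le> (\<delta> ^ k - C / real n) * ?N" by (intro mult_right_mono half) simp
    also have "\<dots> \<le> real (card (copies t {..<n} S'))"
      using bound[of "{..<n}" S'] n d dens by (simp add: S'_def)
    also have "card (copies t {..<n} S') \<le> card {\<psi> \<in> oriented_embeddings d n. (\<lambda>q. \<psi> ` q) ` Y \<subseteq> S}"
    proof (rule card_inj_on_le)
      let ?F = "\<lambda>(J, z). cube_map d (J \<circ> \<sigma>) z"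
      show "finite {\<psi> \<in> oriented_embeddings d n. (\<lambda>q. \<psi> ` q) ` Y \<subseteq> S}"
      proof (rule finite_subset)
        show "{\<psi> \<in> oriented_embeddings d n. (\<lambda>q. \<psi> ` q) ` Y \<subseteq> S} \<subseteq> Q_verts d \<rightarrow>\<^sub>E Q_verts n"
          by (auto simp: oriented_embeddings_def embeddings_def)
      qed (auto intro: finite_PiE)
      have cp: "J ` leaves t \<subseteq> {..<n}" "inj_on J (leaves t)" "z \<subseteq> {..<n} - J ` leaves t" "copy t S' J z"
        "J \<in> extensional (leaves t)" if "(J, z) \<in> copies t {..<n} S'" for J z
        using that injs_D[of J "leaves t" "{..<n}"] by (auto simp: copies_def injs_def PiE_def)
      show "inj_on ?F (copies t {..<n} S')"
      proof (rule inj_onI, clarify)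
        fix J z K y assume J: "(J, z) \<in> copies t {..<n} S'" and K: "(K, y) \<in> copies t {..<n} S'"
          and eq: "cube_map d (J \<circ> \<sigma>) z = cube_map d (K \<circ> \<sigma>) y"
        have zy: "z = y" using fun_cong[OF eq, of "{}"] by (simp add: cube_map_def)
        have "J f = K f" if "f \<in> leaves t" for f
        proof -
          have "f \<in> \<sigma> ` {..<d}" using that \<sigma>(1) by simp
          then obtain i where i: "i < d" "f = \<sigma> i" by auto
          have "insert (J f) z = insert (K f) z" using fun_cong[OF eq, of "{i}"] i zy by (simp add: cube_map_def)
          moreover have "J f \<notin> z" "K f \<notin> z" using cp(3)[OF J] cp(3)[OF K] that zy by auto
          ultimately show ?thesis by (metis insertE insertI1)
        qed
        then show "J = K \<and> z = y" using zy cp(5)[OF J] cp(5)[OF K] extensionalityI by metis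
      qed
      show "?F ` copies t {..<n} S' \<subseteq> {\<psi> \<in> oriented_embeddings d n. (\<lambda>q. \<psi> ` q) ` Y \<subseteq> S}"
      proof clarify
        fix J z assume J: "(J, z) \<in> copies t {..<n} S'"
        note cp = cp[OF J]
        have "(J \<circ> \<sigma>) ` {..<d} = J ` leaves t" using \<sigma>(1) by (metis image_comp)
        then have "cube_map d (J \<circ> \<sigma>) z \<in> oriented_embeddings d n"
          using cp(1-3) \<sigma> comp_inj_on[of \<sigma> "{..<d}" J] by (intro cube_map_oriented_embedding) simp_all
        moreover have "cube_map d (J \<circ> \<sigma>) z ` q \<in> S" if qY: "q \<in> Y" for q
        proof -
          obtain X i where X: "X \<subseteq> {..<d}" "i < d" "i \<notin> X" "q = {X, insert i X}"
            "\<sigma> ` X \<in> cuts t" "insert (\<sigma> i) (\<sigma> ` X) \<in> trees t" using Y[OF qY] by blast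
          have "\<sigma> i \<notin> \<sigma> ` X" using \<sigma>(2) X(1-3) by (auto simp: inj_on_image_mem_iff)
          then have "\<sigma> i \<in> leaves t - \<sigma> ` X" using \<sigma>(1) X(2) by auto
          then have "(z \<union> J ` \<sigma> ` X, J (\<sigma> i)) \<in> S'" using cp(4) X(5,6) by (simp add: copy_def)
          then have "{z \<union> J ` \<sigma> ` X, insert (J (\<sigma> i)) (z \<union> J ` \<sigma> ` X)} \<in> S" by (simp add: S'_def)
          moreover have "cube_map d (J \<circ> \<sigma>) z ` q = {z \<union> J ` \<sigma> ` X, insert (J (\<sigma> i)) (z \<union> J ` \<sigma> ` X)}"
            using X(1,2) by (simp add: X(4) cube_map_def image_comp)
          ultimately show ?thesis by simp
        qed
        ultimately show "cube_map d (J \<circ> \<sigma>) z \<in> oriented_embeddings d n \<and> (\<lambda>q. cube_map d (J \<circ> \<sigma>) z ` q) ` Y \<subseteq> S"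
          by auto
      qed
    qed
    finally show ?thesis by simp
  qed
  then show ?thesis
    using k C by (intro exI[of _ c1] exI[of _ "1 / real k"] exI[of _ "1 / 2"] exI[of _ "real k"]) (auto simp: c1_def)
qed

lemma connected_delete_edge:
  assumes "connected_graph G" "e \<in> edges G" "\<not> is_bridge G e"
  shows "connected_graph (delete_edge G e)"
  using assms by (auto simp: connected_graph_def is_bridge_def delete_edge_def)

text \<open>The spanning tree \<open>insert e T\<close> makes \<open>T\<close> a cut and the
  spanning tree \<open>insert e' T\<close> is a tree of the network. The smaller end of a cube edge
  is unique, which matches \<open>T\<close> and \<open>e'\<close> with the images of
  \<open>X\<close> and \<open>i\<close>.\<close>

lemma Y_ordered_decomposed:
  assumes fin: "finite_multigraph G" and t: "decomposes t G e" and e: "e \<in> edges G"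
    and \<sigma>: "bij_betw \<sigma> {..<card (edges G) - 1} (edges G - {e})" and q: "q \<in> Y_ordered \<sigma> G e"
  shows "\<exists>X i. X \<subseteq> {..<card (edges G) - 1} \<and> i < card (edges G) - 1 \<and> i \<notin> X \<and> q = {X, insert i X} \<and>
      \<sigma> ` X \<in> cuts t \<and> insert (\<sigma> i) (\<sigma> ` X) \<in> trees t"
proof -
  let ?d = "card (edges G) - 1"
  have "q \<in> Q_edges ?d" and qY: "(\<lambda>X. \<sigma> ` X) ` q \<in> Y_set G e" using q by (auto simp: Y_ordered_def)
  then obtain X i where X: "q = {X, insert i X}" "X \<subseteq> {..<?d}" "i < ?d" "i \<notin> X" unfolding Q_edges_iff by blast
  have "(\<lambda>X. \<sigma> ` X) ` q = {\<sigma> ` X, insert (\<sigma> i) (\<sigma> ` X)}" by (simp add: X(1))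
  with qY obtain T e' where T: "{\<sigma> ` X, insert (\<sigma> i) (\<sigma> ` X)} = {T, insert e' T}"
    "T \<subseteq> edges G - {e}" "e' \<in> edges G - {e}" "e' \<notin> T" "spanning_tree G (insert e T)" "spanning_tree G (insert e' T)"
    unfolding Y_set_def by auto
  have "\<sigma> i \<notin> \<sigma> ` X" using inj_on_image_mem_iff[of \<sigma> "{..<?d}" i X] \<sigma> X(2-4) by (auto simp: bij_betw_def)
  then have eq: "\<sigma> ` X = T" "\<sigma> i = e'" using doubleton_insert_inject[OF T(1)] T(4) by auto
  have "T \<in> cuts t" "insert e' T \<in> trees t"
    using t T spanning_tree_min_connected[OF fin] by (auto simp: decomposes_def)
  then show ?thesis using X eq by blast
qed

theorem theorem3p11:
  fixes G :: "('v, 'e) multigraph" and e :: 'e and \<sigma> :: "nat \<Rightarrow> 'e"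
  assumes "(G, e) \<in> G_prime"
    and "bij_betw \<sigma> {..<card (edges G) - 1} (edges G - {e})"
  shows "\<exists>c1 c2 c3 c4 :: real. c1 > 0 \<and> c2 > 0 \<and> c3 > 0 \<and> c4 > 0 \<and>
    (\<forall>(n :: nat) S (\<delta> :: real).
       n \<ge> card (edges G) - 1 \<longrightarrow>
       S \<subseteq> Q_edges n \<longrightarrow>
       real (card S) = \<delta> * real (card (Q_edges n)) \<longrightarrow>
       \<delta> \<ge> c1 * real n powr (- c2) \<longrightarrow>
       real (card {\<psi> \<in> oriented_embeddings (card (edges G) - 1) n.
                     (\<lambda>q. \<psi> ` q) ` Y_ordered \<sigma> G e \<subseteq> S})
         \<ge> c3 * \<delta> powr c4 * real (card (oriented_embeddings (card (edges G) - 1) n)))"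
proof -
  have sp: "series_parallel G" and conn: "connected_graph G" and e: "e \<in> edges G"
    and bridge: "\<not> is_bridge G e" and loop: "\<not> is_loop G e"
    using assms(1) by (auto simp: G_prime_def)
  have fin: "finite_multigraph G" using sp by (simp add: series_parallel_def)
  have "cut_connected (verts G) (ends G) (edges G - {e})"
    using connected_imp_cut_connected[OF finite_multigraph_delete_edge[OF fin] connected_delete_edge[OF conn e bridge]]
    by (simp add: delete_edge_def)
  then obtain t where t: "decomposes t G e" using series_parallel_decomposition[OF sp e loop] by blast
  then have "supersaturated t" "leaves t = edges G - {e}" by (auto simp: decomposes_def distinct_leaves_supersaturated)
  then show ?thesis
    using supersaturated_embeddings[of t \<sigma> "card (edges G) - 1" "Y_ordered \<sigma> G e"] assms(2)
      Y_ordered_decomposed[OF fin t e assms(2)] by simp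
qed

end
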